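(* (a) Given a non-unimodular function $\varphi\in L^\infty$ with $\|\varphi\|_\infty=1$, there exists a Blaschke product $B$ such that $\|B\varphi\|_G=1$ and $B\varphi$ is a non-extreme point of $\mathrm{ball}(\mathrm{BMO})$. (b) Given a function $\varphi\in H^\infty$ with $\|\varphi\|_\infty=1$ for which $\int_{\mathbb T}\log(1-|\varphi|)\,dm>-\infty$, there exists a Blaschke product $B$ such that $\|B\varphi\|_G=1$ and $B\varphi$ is a non-extreme point of $\mathrm{ball}(\mathrm{BMOA})$. (c) Moreover: if $\varphi\in L^\infty$ is a non-unimodular function with $\|\varphi\|_\infty=1$ and $B$ is any Blaschke product, then $B\varphi$ is a non-extreme point of $\mathrm{ball}(\mathrm{BMO})$; and if $\varphi\in H^\infty$ satisfies $\|\varphi\|_\infty=1$ and $\int_{\mathbb T}\log(1-|\varphi|)\,dm>-\infty$, and $B$ is any Blaschke product, then $B\varphi$ is a non-extreme point of $\mathrm{ball}(\mathrm{BMOA})$.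
   Context: $\mathbb D=\{z\in\mathbb C:|z|<1\}$, $\mathbb T=\partial\mathbb D$, $m$ is normalized arc length measure on $\mathbb T$, $L^p=L^p(\mathbb T,m)$ (complex-valued functions). For $f\in L^1$, the Poisson integral is $\mathcal Pf(z)=\int_{\mathbb T}f(\zeta)\frac{1-|z|^2}{|\zeta-z|^2}\,dm(\zeta)$, $z\in\mathbb D$. $H^p$ is the set of $f\in L^p$ with $\mathcal Pf$ analytic on $\mathbb D$; such $f$ is identified with its analytic extension $\mathcal Pf$. A function $f\in L^\infty$ is unimodular if $|f|=1$ a.e. on $\mathbb T$. For $f\in L^2$ put $\Phi_f(z)=\mathcal P(|f|^2)(z)-|\mathcal Pf(z)|^2$, $z\in\mathbb D$, and $\|f\|_G=\sup_{z\in\mathbb D}\Phi_f(z)^{1/2}$ (the Garsia norm). $\mathrm{BMO}$ is the set of $f\in L^2$ with $\|f\|_G<\infty$, and $\mathrm{BMOA}=\mathrm{BMO}\cap H^2$. For $f\in L^\infty$ one has $\|f\|_G\le\|f\|_\infty$. A Blaschke product is a function $B(z)=\prod_j\frac{|z_j|}{z_j}\frac{z_j-z}{1-\bar z_jz}$, where $\{z_j\}\subset\mathbb D$ is a (possibly finite or empty) sequence with $\sum_j(1-|z_j|)<\infty$, and $|z_j|/z_j:=-1$ if $z_j=0$; its boundary values on $\mathbb T$ are unimodular. The functions annihilated by $\|\cdot\|_G$ are the constants, and $\mathrm{BMO}$ and $\mathrm{BMOA}$ are regarded here as quotient spaces modulo constants, normed by $\|\cdot\|_G$; an element $f$ is understood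 as the coset $f+\mathbb C$. For a normed space $X$, $\mathrm{ball}(X)=\{x\in X:\|x\|\le1\}$; $x\in\mathrm{ball}(X)$ is an extreme point of $\mathrm{ball}(X)$ if it is not of the form $x=\frac12(u+v)$ with two distinct points $u,v\in\mathrm{ball}(X)$; a non-extreme point of $\mathrm{ball}(X)$ is an element of $\mathrm{ball}(X)$ that is not an extreme point. *)

theory Defs
  imports "HOL-Probability.Essential_Supremum" "HOL-Complex_Analysis.Complex_Analysis"
    "HOL-Library.Extended_Nat"
begin

text \<open>
  Normalized arc length measure on the unit circle: the image of the uniform distribution on
  \<open>[0, 2\<pi>)\<close> under \<open>t \<mapsto> e\<^sup>i\<^sup>t\<close>, living on the Borel sets of the circle.
  Elements of the function spaces below are functions \<^typ>\<open>complex \<Rightarrow> complex\<close> of which only the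
  values on the circle matter.
\<close>

definition circle_measure :: "complex measure" where
  "circle_measure =
     distr (uniform_measure lborel {0..<2 * pi}) (restrict_space borel (sphere 0 1)) cis"

definition poisson :: "(complex \<Rightarrow> 'a::{banach, second_countable_topology}) \<Rightarrow> complex \<Rightarrow> 'a" where
  "poisson f z =
     (LINT \<zeta>|circle_measure. ((1 - (cmod z)\<^sup>2) / (cmod (\<zeta> - z))\<^sup>2) *\<^sub>R f \<zeta>)"

definition L2 :: "(complex \<Rightarrow> complex) set" where
  "L2 = {f \<in> borel_measurable circle_measure. integrable circle_measure (\<lambda>\<zeta>. (cmod (f \<zeta>))\<^sup>2)}"

definition Linf_norm :: "(complex \<Rightarrow> complex) \<Rightarrow> ereal" where
  "Linf_norm f = esssup circle_measure (\<lambda>\<zeta>. ereal (cmod (f \<zeta>)))"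

definition Linf :: "(complex \<Rightarrow> complex) set" where
  "Linf = {f \<in> borel_measurable circle_measure. Linf_norm f < \<infinity>}"

definition H2 :: "(complex \<Rightarrow> complex) set" where
  "H2 = {f \<in> L2. poisson f analytic_on ball 0 1}"

definition Hinf :: "(complex \<Rightarrow> complex) set" where
  "Hinf = {f \<in> Linf. poisson f analytic_on ball 0 1}"

definition unimodular :: "(complex \<Rightarrow> complex) \<Rightarrow> bool" where
  "unimodular f \<longleftrightarrow> f \<in> Linf \<and> (AE \<zeta> in circle_measure. cmod (f \<zeta>) = 1)"

text \<open>
  \<open>neg_log x\<close> is \<open>- log x\<close> for \<open>x \<in> [0, 1]\<close>, with the value \<open>\<infinity>\<close> at \<open>x = 0\<close>
  (whereas \<^term>\<open>ln (0 :: real) = 0\<close>). When \<open>|f| \<le> 1\<close> almost everywhere, the integral of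
  \<open>log (1 - |f|)\<close> is that of a function with values in \<open>[-\<infinity>, 0]\<close>, and it exceeds \<open>-\<infinity>\<close>
  iff the integral of its negative is finite.
\<close>

definition neg_log :: "real \<Rightarrow> ennreal" where
  "neg_log x = (if x \<le> 0 then \<infinity> else ennreal (- ln x))"

definition log_integral_finite :: "(complex \<Rightarrow> complex) \<Rightarrow> bool" where
  "log_integral_finite f \<longleftrightarrow> (\<integral>\<^sup>+ \<zeta>. neg_log (1 - cmod (f \<zeta>)) \<partial>circle_measure) < \<infinity>"

definition garsia_Phi :: "(complex \<Rightarrow> complex) \<Rightarrow> complex \<Rightarrow> real" where
  "garsia_Phi f z = poisson (\<lambda>\<zeta>. (cmod (f \<zeta>))\<^sup>2) z - (cmod (poisson f z))\<^sup>2"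

definition garsia_norm :: "(complex \<Rightarrow> complex) \<Rightarrow> ereal" where
  "garsia_norm f = (SUP z\<in>ball 0 1. ereal (sqrt (garsia_Phi f z)))"

definition BMO :: "(complex \<Rightarrow> complex) set" where
  "BMO = {f \<in> L2. garsia_norm f < \<infinity>}"

definition BMOA :: "(complex \<Rightarrow> complex) set" where
  "BMOA = BMO \<inter> H2"

text \<open>
  The coset \<open>f + \<complex>\<close>. Since functions that agree almost everywhere are identified, it consists of
  all measurable functions that differ from \<open>f\<close> by a constant almost everywhere.
\<close>

definition coset :: "(complex \<Rightarrow> complex) \<Rightarrow> (complex \<Rightarrow> complex) set" where
  "coset f = {g \<in> borel_measurable circle_measure.
                \<exists>c. AE \<zeta> in circle_measure. g \<zeta> = f \<zeta> + c}"

text \<open>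
  The closed unit ball of the quotient \<open>X/\<complex>\<close>. The Garsia norm is constant on cosets, so it does
  not matter which representative is measured.
\<close>

definition quotient_ball :: "(complex \<Rightarrow> complex) set \<Rightarrow> (complex \<Rightarrow> complex) set set" where
  "quotient_ball X = coset ` {f \<in> X. garsia_norm f \<le> 1}"

definition coset_midpoint ::
    "(complex \<Rightarrow> complex) set \<Rightarrow> (complex \<Rightarrow> complex) set \<Rightarrow> (complex \<Rightarrow> complex) set" where
  "coset_midpoint U V = {(\<lambda>\<zeta>. (u \<zeta> + v \<zeta>) / 2) | u v. u \<in> U \<and> v \<in> V}"

definition extreme_point_of_ball ::
    "(complex \<Rightarrow> complex) set \<Rightarrow> (complex \<Rightarrow> complex) set \<Rightarrow> bool" where
  "extreme_point_of_ball X W \<longleftrightarrow> W \<in> quotient_ball X \<and>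
     \<not> (\<exists>U\<in>quotient_ball X. \<exists>V\<in>quotient_ball X. U \<noteq> V \<and> W = coset_midpoint U V)"

definition nonextreme_point_of_ball ::
    "(complex \<Rightarrow> complex) set \<Rightarrow> (complex \<Rightarrow> complex) set \<Rightarrow> bool" where
  "nonextreme_point_of_ball X W \<longleftrightarrow> W \<in> quotient_ball X \<and> \<not> extreme_point_of_ball X W"

definition blaschke_factor :: "complex \<Rightarrow> complex \<Rightarrow> complex" where
  "blaschke_factor a z =
     (if a = 0 then -1 else of_real (cmod a) / a) * ((a - z) / (1 - cnj a * z))"

text \<open>
  \<open>a 0, a 1, \<dots>\<close> is a sequence of length \<open>N \<in> {0, 1, 2, \<dots>, \<infinity>}\<close>; the values \<open>a j\<close> with
  \<open>j \<ge> N\<close> are not used.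
\<close>

definition blaschke_sequence :: "enat \<Rightarrow> (nat \<Rightarrow> complex) \<Rightarrow> bool" where
  "blaschke_sequence N a \<longleftrightarrow> (\<forall>j. enat j < N \<longrightarrow> cmod (a j) < 1) \<and>
     summable (\<lambda>j. if enat j < N then 1 - cmod (a j) else 0)"

definition blaschke_product :: "(complex \<Rightarrow> complex) \<Rightarrow> bool" where
  "blaschke_product B \<longleftrightarrow> (\<exists>N a. blaschke_sequence N a \<and>
     (\<forall>z\<in>ball 0 1. B z = (\<Prod>j. if enat j < N then blaschke_factor (a j) z else 1)))"

text \<open>
  Boundary values are radial limits. For a Blaschke product they exist almost everywhere on the
  circle; elsewhere \<^const>\<open>Lim\<close> returns an unspecified value, which does not depend on the point.
\<close>

definition boundary_value :: "(complex \<Rightarrow> complex) \<Rightarrow> complex \<Rightarrow> complex" where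
  "boundary_value F \<zeta> = Lim (at_left 1) (\<lambda>r::real. F (of_real r * \<zeta>))"

definition bd_times :: "(complex \<Rightarrow> complex) \<Rightarrow> (complex \<Rightarrow> complex) \<Rightarrow> complex \<Rightarrow> complex" where
  "bd_times B \<phi> \<zeta> = boundary_value B \<zeta> * \<phi> \<zeta>"

end

theory Submission
  imports Defs "HOL-Probability.Probability_Measure"
begin

text \<open>
All four parts follow from two mechanisms.

\<^bold>\<open>Non-extremality.\<close> A function bounded by \<open>1\<close> almost everywhere has Garsia norm at most \<open>1\<close>,
because \<open>\<Phi>\<^sub>f \<le> \<P>(|f|\<^sup>2) \<le> 1\<close>. Hence, if \<open>f = B\<phi>\<close> and \<open>g\<close> is any function of the space that is
not constant and satisfies \<open>|g| \<le> 1 - |\<phi>|\<close>, then \<open>f + g\<close> and \<open>f - g\<close> lie in the ball, represent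
different cosets and have midpoint \<open>f\<close> (\<open>nonextreme_pointI\<close>). For BMO there is a set \<open>E\<close> of
positive measure on which \<open>|\<phi>| \<le> 1 - \<epsilon>\<close>, and \<open>g(\<zeta>) = \<epsilon> \<zeta>\<close> on \<open>E\<close>, \<open>0\<close> off \<open>E\<close>, will do. For
BMOA, \<open>g\<close> has to be analytic; integrability of \<open>log (1 - |\<phi>|)\<close> is exactly what is needed to
form the outer function \<open>G = exp H\<close>, where \<open>H\<close> is the Herglotz transform of \<open>log (1 - |\<phi>|)\<close>, and
Jensen's inequality gives \<open>|G| = exp \<P>(log (1 - |\<phi>|)) \<le> \<P>(1 - |\<phi>|)\<close> in the disc, so that the
boundary values of \<open>z G(z)\<close> are dominated by \<open>1 - |\<phi>|\<close>.

\<^bold>\<open>Norm one.\<close> Since \<open>\<phi>\<close> has supremum norm \<open>1\<close>, there are points \<open>z\<^sub>n\<close> tending rapidly to the circle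
and constants \<open>c\<^sub>n\<close> with \<open>|c\<^sub>n| \<rightarrow> 1\<close> such that \<open>\<P>(|\<phi> - c\<^sub>n|)(z\<^sub>n) \<rightarrow> 0\<close>: approach a density point
of \<open>{|\<phi> - c\<^sub>n| < \<epsilon>}\<close> radially (\<open>near_constant_point\<close>). Let \<open>B\<close> be the Blaschke product with zeros
\<open>z\<^sub>n\<close>. As \<open>|B| = 1\<close> on the circle, \<open>\<P>(|B\<phi>|\<^sup>2)(z\<^sub>n) = \<P>(|\<phi>|\<^sup>2)(z\<^sub>n) \<rightarrow> 1\<close>, while \<open>\<P>(B\<phi>)(z\<^sub>n)\<close> is close
to \<open>c\<^sub>n \<P>(B)(z\<^sub>n) = c\<^sub>n B(z\<^sub>n) = 0\<close>. So \<open>\<Phi>(z\<^sub>n) \<rightarrow> 1\<close>.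

The analysis underneath is built in this order. Lebesgue's density theorem on the line, from
Vitali's covering lemma, yields Fatou's theorem for Poisson integrals of bounded functions:
first for indicators, then for bounded real functions through their level sets. Every bounded
holomorphic function \<open>F\<close> on the disc is the Poisson integral of a bounded function: by Parseval
its dilates \<open>F(r\<zeta>)\<close> form a Cauchy family in \<open>L\<^sup>2\<close>, and a sequence of them converges almost
everywhere. Together these give radial limits of bounded holomorphic functions almost
everywhere and recover \<open>F\<close> from them. Applied to the tails of a Blaschke product, this shows that
its boundary values are unimodular.
\<close>

section \<open>Arc length measure on the circle\<close>

lemma space_circle [simp]: "space circle_measure = sphere 0 1"
  by (simp add: circle_measure_def space_restrict_space)

lemma sets_circle [measurable_cong]: "sets circle_measure = sets (restrict_space borel (sphere 0 1))"
  by (simp add: circle_measure_def)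

lemma measurable_cis_circle: "cis \<in> borel \<rightarrow>\<^sub>M restrict_space borel (sphere 0 1)"
  by (intro measurable_restrict_space2 borel_measurable_continuous_onI) (auto intro: continuous_intros)

lemma prob_space_circle: "prob_space circle_measure"
  unfolding circle_measure_def
  by (rule prob_space.prob_space_distr[OF prob_space_uniform_measure])
     (use measurable_cis_circle in \<open>auto simp: measurable_def\<close>)

interpretation circle: prob_space circle_measure
  by (rule prob_space_circle)

lemma measure_circle_sphere [simp]: "measure circle_measure (sphere 0 1) = 1"
  using circle.prob_space by simp

lemma borel_measurable_circleI:
  "f \<in> borel_measurable borel \<Longrightarrow> f \<in> borel_measurable circle_measure"
  by (simp add: measurable_restrict_space1 cong: measurable_cong_sets[OF sets_circle refl])

lemma continuous_on_circle_measurable: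
  "continuous_on (sphere 0 1) f \<Longrightarrow> f \<in> borel_measurable circle_measure"
  using borel_measurable_continuous_on_restrict measurable_cong_sets[OF sets_circle refl] by blast

lemma measurable_circle_cis:
  assumes "f \<in> circle_measure \<rightarrow>\<^sub>M N"
  shows "(\<lambda>t. f (cis t)) \<in> borel \<rightarrow>\<^sub>M N"
  using measurable_compose[OF measurable_cis_circle] assms measurable_cong_sets[OF sets_circle refl]
  by blast

lemma cis_vimage_borel:
  assumes "E \<in> sets circle_measure" shows "{t. cis t \<in> E} \<in> sets borel"
proof -
  have "cis -` E \<inter> space borel \<in> sets borel"
    using assms measurable_sets[OF measurable_cis_circle, of E] by (simp add: sets_circle)
  then show ?thesis by (simp add: vimage_def)
qed

lemma integral_circle_eq_lborel:
  fixes f :: "complex \<Rightarrow> 'a::{banach, second_countable_topology}"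
  assumes f: "f \<in> borel_measurable circle_measure"
  shows "(LINT \<zeta>|circle_measure. f \<zeta>) = (1 / (2 * pi)) *\<^sub>R (LINT t:{0..<2*pi}|lborel. f (cis t))"
proof -
  have m: "(\<lambda>t. f (cis t)) \<in> borel_measurable borel" using f by (rule measurable_circle_cis)
  have "uniform_measure lborel {0..<2*pi} = density lborel (\<lambda>t. ennreal (indicator {0..<2*pi} t / (2*pi)))"
    unfolding uniform_measure_def
    using divide_ennreal[of 1 "2 * pi"] by (intro density_cong) (auto split: split_indicator)
  moreover have "(LINT \<zeta>|circle_measure. f \<zeta>) = (LINT t|uniform_measure lborel {0..<2*pi}. f (cis t))"
    unfolding circle_measure_def
  proof (rule integral_distr)
    show "cis \<in> uniform_measure lborel {0..<2 * pi} \<rightarrow>\<^sub>M restrict_space borel (sphere 0 1)"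
      using measurable_cis_circle by simp
    show "f \<in> borel_measurable (restrict_space borel (sphere 0 1))"
      using f measurable_cong_sets[OF sets_circle refl] by blast
  qed
  ultimately have "(LINT \<zeta>|circle_measure. f \<zeta>) = (LINT t|lborel. (indicator {0..<2*pi} t / (2*pi)) *\<^sub>R f (cis t))"
    using m by (simp add: integral_density)
  also have "\<dots> = (LINT t|lborel. (1/(2*pi)) *\<^sub>R (indicator {0..<2*pi} t *\<^sub>R f (cis t)))"
    by (simp add: mult.commute)
  also have "\<dots> = (1 / (2 * pi)) *\<^sub>R (LINT t:{0..<2*pi}|lborel. f (cis t))"
    unfolding set_lebesgue_integral_def by (rule integral_scaleR_right)
  finally show ?thesis .
qed

lemma AE_circle_norm: "AE \<zeta> in circle_measure. cmod \<zeta> = 1"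
  using AE_space[of circle_measure] by simp

text \<open>
The inverse of \<^const>\<open>cis\<close> on \<open>[0, 2\<pi>)\<close>, written with \<^const>\<open>arccos\<close> because that makes Borel
measurability on the circle a consequence of continuity.
\<close>

definition circle_angle :: "complex \<Rightarrow> real" where
  "circle_angle \<zeta> = (if Im \<zeta> \<ge> 0 then arccos (Re \<zeta>) else 2 * pi - arccos (Re \<zeta>))"

lemma circle_angle_measurable: "circle_angle \<in> borel_measurable circle_measure"
proof -
  have "(\<lambda>\<zeta>. arccos (Re \<zeta>)) \<in> borel_measurable circle_measure"
    by (rule continuous_on_circle_measurable)
       (intro continuous_intros, auto, smt (verit) abs_Re_le_cmod,
        smt (verit) abs_Re_le_cmod)
  moreover have "Im \<in> borel_measurable circle_measure"
    by (intro borel_measurable_circleI) simp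
  ultimately show ?thesis unfolding circle_angle_def by measurable
qed

lemma circle_angle_cis:
  assumes "0 \<le> t" "t < 2 * pi" shows "circle_angle (cis t) = t"
proof (cases "t \<le> pi")
  case True
  then show ?thesis using assms sin_ge_zero[of t] by (simp add: circle_angle_def arccos_cos)
next
  case False
  then have "sin t < 0" using sin_lt_zero assms by auto
  moreover have "arccos (cos t) = 2 * pi - t"
    using arccos_cos[of "2 * pi - t"] False assms by (simp add: cos_diff)
  ultimately show ?thesis by (simp add: circle_angle_def)
qed

lemma cis_circle_angle:
  assumes "cmod \<zeta> = 1" shows "cis (circle_angle \<zeta>) = \<zeta>" "0 \<le> circle_angle \<zeta>" "circle_angle \<zeta> < 2 * pi"
proof -
  obtain t where t: "\<zeta> = cis t" "0 \<le> t" "t < 2 * pi"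
    using assms complex_norm_eq_1_exp[of \<zeta>]
    by (metis cis_conv_exp Arg2pi_ge_0 Arg2pi_lt_2pi)
  then show "cis (circle_angle \<zeta>) = \<zeta>" "0 \<le> circle_angle \<zeta>" "circle_angle \<zeta> < 2 * pi"
    using circle_angle_cis by auto
qed

text \<open>
An exceptional null set of angles has to be turned into a measurable null set of the circle.
Its image under \<^const>\<open>cis\<close> is the preimage under the Borel function \<^const>\<open>circle_angle\<close>, so
Borel null sets are preserved. The angle \<open>0\<close> is dropped so that
every remaining angle is an interior point of the parameter interval.
\<close>

lemma AE_circleI:
  assumes "AE t in lborel. 0 < t \<and> t < 2 * pi \<longrightarrow> P (cis t)"
  shows "AE \<zeta> in circle_measure. P \<zeta>"
proof -
  from assms obtain N where N: "{t \<in> space lborel. \<not> (0 < t \<and> t < 2 * pi \<longrightarrow> P (cis t))} \<subseteq> N"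
    "emeasure lborel N = 0" "N \<in> sets lborel"
    by (rule AE_E)
  let ?N = "{\<zeta> \<in> space circle_measure. circle_angle \<zeta> \<in> N \<union> {0}}"
  have mN: "?N \<in> sets circle_measure"
    using circle_angle_measurable N(3) by measurable
  have "AE \<zeta> in circle_measure. circle_angle \<zeta> \<notin> N \<union> {0}"
  proof -
    have m: "{x \<in> space (restrict_space borel (sphere 0 1)). circle_angle x \<notin> N \<union> {0}}
       \<in> sets (restrict_space borel (sphere 0 1))"
      using sets.compl_sets[OF mN] unfolding sets_circle
      by (rule back_subst[where P="\<lambda>A. A \<in> _"]) (auto simp: space_restrict_space)
    have c: "cis \<in> uniform_measure lborel {0..<2 * pi} \<rightarrow>\<^sub>M restrict_space borel (sphere 0 1)"
      using measurable_cis_circle by (auto simp: measurable_def)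
    have "AE t in lborel. t \<notin> N \<union> {0}"
      using N(2,3) AE_lborel_singleton[of 0] AE_not_in[of N lborel] by (auto simp: null_sets_def)
    then have "AE t in lborel. t \<in> {0..<2*pi} \<longrightarrow> circle_angle (cis t) \<notin> N \<union> {0}"
      by eventually_elim (auto simp: circle_angle_cis)
    then have "AE t in uniform_measure lborel {0..<2*pi}. circle_angle (cis t) \<notin> N \<union> {0}"
      by (intro AE_uniform_measureI) auto
    then show ?thesis
      unfolding circle_measure_def by (subst AE_distr_iff[OF c m])
  qed
  moreover have "AE \<zeta> in circle_measure. cmod \<zeta> = 1" by (rule AE_circle_norm)
  ultimately show ?thesis
  proof eventually_elim
    case (elim \<zeta>)
    then have a: "cis (circle_angle \<zeta>) = \<zeta>" "0 < circle_angle \<zeta>" "circle_angle \<zeta> < 2 * pi" "circle_angle \<zeta> \<notin> N"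
      using cis_circle_angle[of \<zeta>] by (auto simp: less_le)
    then show ?case using N(1) by force
  qed
qed

lemma circle_singleton_null: "AE \<zeta> in circle_measure. \<zeta> \<noteq> a"
proof (rule AE_circleI)
  have "AE t in lborel. t \<noteq> circle_angle a" by (rule AE_lborel_singleton)
  then show "AE t in lborel. 0 < t \<and> t < 2 * pi \<longrightarrow> cis t \<noteq> a"
    by eventually_elim (auto simp: circle_angle_cis)
qed

section \<open>The Poisson integral\<close>

definition poisson_kernel :: "complex \<Rightarrow> complex \<Rightarrow> real" where
  "poisson_kernel z \<zeta> = (1 - (cmod z)\<^sup>2) / (cmod (\<zeta> - z))\<^sup>2"

lemma poisson_altdef: "poisson f z = (LINT \<zeta>|circle_measure. poisson_kernel z \<zeta> *\<^sub>R f \<zeta>)"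
  by (simp add: poisson_def poisson_kernel_def)

lemma poisson_kernel_nonneg: "cmod z < 1 \<Longrightarrow> poisson_kernel z \<zeta> \<ge> 0"
  by (auto simp: poisson_kernel_def power_le_one intro!: divide_nonneg_nonneg)

lemma poisson_kernel_le:
  assumes "cmod z < 1" "cmod \<zeta> = 1"
  shows "poisson_kernel z \<zeta> \<le> 2 / (1 - cmod z)"
proof -
  have "1 - cmod z \<le> cmod (\<zeta> - z)" using norm_triangle_ineq2[of \<zeta> z] assms by simp
  then have "(1 - cmod z)\<^sup>2 \<le> (cmod (\<zeta> - z))\<^sup>2" using assms by (intro power_mono) auto
  then have "poisson_kernel z \<zeta> \<le> (1 - (cmod z)\<^sup>2) / (1 - cmod z)\<^sup>2"
    unfolding poisson_kernel_def using assms
    by (intro divide_left_mono) (auto simp: power_le_one zero_less_mult_iff)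
  also have "\<dots> = (1 + cmod z) / (1 - cmod z)"
    using assms by (simp add: power2_eq_square square_diff_one_factored divide_simps) (simp add: algebra_simps)
  also have "\<dots> \<le> 2 / (1 - cmod z)" using assms by (intro divide_right_mono) auto
  finally show ?thesis .
qed

lemma poisson_kernel_measurable [measurable]: "poisson_kernel z \<in> borel_measurable circle_measure"
  unfolding poisson_kernel_def by (intro borel_measurable_circleI) measurable

lemma integrable_poisson:
  fixes f :: "complex \<Rightarrow> 'a::{banach, second_countable_topology}"
  assumes "integrable circle_measure f" "cmod z < 1"
  shows "integrable circle_measure (\<lambda>\<zeta>. poisson_kernel z \<zeta> *\<^sub>R f \<zeta>)"
proof -
  have [measurable]: "f \<in> borel_measurable circle_measure" using assms by auto
  have "AE \<zeta> in circle_measure. cmod \<zeta> = 1" by (rule AE_circle_norm)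
  then have bound: "AE \<zeta> in circle_measure. norm (poisson_kernel z \<zeta> *\<^sub>R f \<zeta>) \<le> norm ((2 / (1 - cmod z)) *\<^sub>R f \<zeta>)"
  proof eventually_elim
    case (elim \<zeta>)
    have "\<bar>poisson_kernel z \<zeta>\<bar> \<le> \<bar>2 / (1 - cmod z)\<bar>"
      using poisson_kernel_nonneg[of z \<zeta>] poisson_kernel_le[of z \<zeta>] elim assms by auto
    then show ?case unfolding norm_scaleR by (intro mult_right_mono) auto
  qed
  show ?thesis
    by (rule Bochner_Integration.integrable_bound[OF _ _ bound]) (use assms(1) in simp, measurable)
qed

lemma integrable_circle_bounded:
  fixes f :: "complex \<Rightarrow> 'a::{banach, second_countable_topology}"
  assumes "f \<in> borel_measurable circle_measure" "AE \<zeta> in circle_measure. norm (f \<zeta>) \<le> C"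
  shows "integrable circle_measure f"
  using assms by (intro circle.integrable_const_bound) auto

lemma integral_circle_eq_integral:
  fixes f :: "complex \<Rightarrow> complex"
  assumes "continuous_on (sphere 0 1) f"
  shows "(LINT \<zeta>|circle_measure. f \<zeta>) = (1 / (2 * pi)) *\<^sub>R integral {0..2*pi} (\<lambda>t. f (cis t))"
proof -
  have "continuous_on {0..2*pi} (\<lambda>t. f (cis t))"
    by (intro continuous_on_compose2[OF assms] continuous_intros) auto
  then have "set_integrable lborel {0..2*pi} (\<lambda>t. f (cis t))"
    by (intro borel_integrable_atLeastAtMost')
  then have "set_integrable lborel {0..<2*pi} (\<lambda>t. f (cis t))"
    by (rule set_integrable_subset) auto
  then have "(LINT t:{0..<2*pi}|lborel. f (cis t)) = integral {0..<2*pi} (\<lambda>t. f (cis t))"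
    by (rule set_borel_integral_eq_integral)
  also have "\<dots> = integral {0..2*pi} (\<lambda>t. f (cis t))"
    by (intro integral_spike_set; rule negligible_subset[of "{2*pi}"]) auto
  finally show ?thesis
    using assms by (simp add: integral_circle_eq_lborel continuous_on_circle_measurable)
qed

text \<open>
Cauchy's integral formula in terms of arc length: on the circle \<open>dw = \<i> w dt\<close>.
\<close>

lemma holomorphic_circle_Cauchy:
  assumes "F holomorphic_on ball 0 R" "R > 1" and z: "cmod z < 1"
  shows "(LINT \<zeta>|circle_measure. F \<zeta> * \<zeta> / (\<zeta> - z)) = F z"
proof -
  have F: "F holomorphic_on cball 0 1"
    using assms by (elim holomorphic_on_subset) auto
  have "((\<lambda>u. F u / (u - z)) has_contour_integral (2 * of_real pi * \<i> * F z)) (circlepath 0 1)"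
    using z by (intro Cauchy_integral_circlepath_simple F) auto
  then have "((\<lambda>t. F (cis t) / (cis t - z) * \<i> * cis t) has_integral (2 * of_real pi * \<i> * F z)) {0..2*pi}"
    by (simp add: circlepath_def has_contour_integral_part_circlepath_iff)
  then have "((\<lambda>t. - \<i> * (F (cis t) / (cis t - z) * \<i> * cis t)) has_integral (- \<i> * (2 * of_real pi * \<i> * F z))) {0..2*pi}"
    by (rule has_integral_mult_right)
  then have "((\<lambda>t. F (cis t) * cis t / (cis t - z)) has_integral (2 * of_real pi * F z)) {0..2*pi}"
    by (simp add: algebra_simps)
  then have I: "integral {0..2*pi} (\<lambda>t. F (cis t) * cis t / (cis t - z)) = 2 * of_real pi * F z"
    by (rule integral_unique)
  have "continuous_on (sphere 0 1) F"
    using holomorphic_on_imp_continuous_on[OF F] by (rule continuous_on_subset) auto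
  then have "continuous_on (sphere 0 1) (\<lambda>\<zeta>. F \<zeta> * \<zeta> / (\<zeta> - z))"
    using z by (intro continuous_intros) auto
  from integral_circle_eq_integral[OF this] show ?thesis
    using I by (simp add: scaleR_conv_of_real)
qed

lemma holomorphic_circle_mean:
  assumes "F holomorphic_on ball 0 R" "R > 1"
  shows "(LINT \<zeta>|circle_measure. F \<zeta>) = F 0"
proof -
  have "(LINT \<zeta>|circle_measure. F \<zeta>) = (LINT \<zeta>|circle_measure. F \<zeta> * \<zeta> / (\<zeta> - 0))"
    by (intro Bochner_Integration.integral_cong) auto
  then show ?thesis using holomorphic_circle_Cauchy[OF assms, of 0] by simp
qed

text \<open>
Cauchy's formula is applied to \<open>G(w) = F(w) (1 - |z|\<^sup>2) / (1 - cnj z * w)\<close>, which is still holomorphic near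
the closed disc and has \<open>G(z) = F(z)\<close>. On the circle \<open>(1 - cnj z * \<zeta>)(\<zeta> - z) = \<zeta> |\<zeta> - z|\<^sup>2\<close>, so the
Cauchy kernel turns into the Poisson kernel.
\<close>

lemma poisson_holomorphic:
  assumes F: "F holomorphic_on ball 0 R" "R > 1" and z: "cmod z < 1"
  shows "poisson F z = F z"
proof -
  (* in this disc both F and 1 / (1 - cnj z * w) are holomorphic *)
  define S where "S = (if z = 0 then R else min R (1 / cmod z))"
  have S: "S > 1" "S \<le> R" using F z by (auto simp: S_def)
  have nz: "1 - cnj z * w \<noteq> 0" if "w \<in> ball 0 S" for w
  proof
    assume "1 - cnj z * w = 0"
    then have "cmod z * cmod w = 1"
      by (metis complex_mod_cnj eq_iff_diff_eq_0 norm_mult norm_one)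
    then show False using that by (auto simp: S_def field_simps split: if_splits)
  qed
  define G where "G = (\<lambda>w. F w * (1 - (cmod z)\<^sup>2) / (1 - cnj z * w))"
  have "G holomorphic_on ball 0 S"
    unfolding G_def using S nz
    by (intro holomorphic_intros holomorphic_on_subset[OF F(1)]) auto
  from holomorphic_circle_Cauchy[OF this S(1) z]
  have "G z = (LINT \<zeta>|circle_measure. G \<zeta> * \<zeta> / (\<zeta> - z))" ..
  also have "\<dots> = poisson F z"
    unfolding poisson_altdef
  proof (intro Bochner_Integration.integral_cong refl)
    fix \<zeta> assume "\<zeta> \<in> space circle_measure"
    then have 1: "cmod \<zeta> = 1" by simp
    have inv: "\<zeta> * cnj \<zeta> = 1" using 1 by (simp add: complex_norm_square[symmetric])
    have "(1 - cnj z * \<zeta>) * (\<zeta> - z) = \<zeta> * ((cnj \<zeta> - cnj z) * (\<zeta> - z))"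
      using inv by algebra
    also have "\<dots> = \<zeta> * (cmod (\<zeta> - z))\<^sup>2"
      using complex_norm_square[of "\<zeta> - z"] by (simp add: mult.commute)
    finally have e: "(1 - cnj z * \<zeta>) * (\<zeta> - z) = \<zeta> * (cmod (\<zeta> - z))\<^sup>2" .
    have "\<zeta> \<noteq> 0" using 1 by auto
    have "G \<zeta> * \<zeta> / (\<zeta> - z) = F \<zeta> * (1 - (cmod z)\<^sup>2) * \<zeta> / ((1 - cnj z * \<zeta>) * (\<zeta> - z))"
      by (simp add: G_def)
    also have "\<dots> = poisson_kernel z \<zeta> *\<^sub>R F \<zeta>"
      unfolding e using \<open>\<zeta> \<noteq> 0\<close> by (simp add: poisson_kernel_def scaleR_conv_of_real)
    finally show "G \<zeta> * \<zeta> / (\<zeta> - z) = poisson_kernel z \<zeta> *\<^sub>R F \<zeta>" .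
  qed
  finally have "poisson F z = F z * (1 - (cmod z)\<^sup>2) / (1 - cnj z * z)"
    by (simp add: G_def)
  also have "1 - cnj z * z = of_real (1 - (cmod z)\<^sup>2)"
    using complex_norm_square[of z] by (simp add: mult.commute)
  also have "F z * of_real (1 - (cmod z)\<^sup>2) / of_real (1 - (cmod z)\<^sup>2) = F z"
  proof -
    have "(cmod z)\<^sup>2 < 1" using z by (simp add: power_less_one_iff abs_square_less_1)
    then have "1 - (cmod z)\<^sup>2 \<noteq> 0" by simp
    then show ?thesis by (metis nonzero_mult_div_cancel_right of_real_eq_0_iff)
  qed
  finally show ?thesis by simp
qed

lemma poisson_of_real:
  "poisson (\<lambda>\<zeta>. of_real (f \<zeta>) :: complex) z = of_real (poisson f z)"
  unfolding poisson_altdef by (simp add: scaleR_conv_of_real flip: of_real_mult)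

lemma integral_poisson_kernel:
  assumes "cmod z < 1" shows "(LINT \<zeta>|circle_measure. poisson_kernel z \<zeta>) = 1"
proof -
  have "poisson (\<lambda>_. 1 :: complex) z = 1"
    using assms by (intro poisson_holomorphic[of _ 2]) auto
  then have "poisson (\<lambda>_. 1 :: real) z = 1"
    using poisson_of_real[of "\<lambda>_. 1" z] by simp
  then show ?thesis by (simp add: poisson_altdef)
qed

lemma poisson_add:
  fixes f g :: "complex \<Rightarrow> 'a::{banach, second_countable_topology}"
  assumes "integrable circle_measure f" "integrable circle_measure g" "cmod z < 1"
  shows "poisson (\<lambda>\<zeta>. f \<zeta> + g \<zeta>) z = poisson f z + poisson g z"
  unfolding poisson_altdef scaleR_add_right
  by (intro Bochner_Integration.integral_add integrable_poisson assms)

lemma poisson_diff: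
  fixes f g :: "complex \<Rightarrow> 'a::{banach, second_countable_topology}"
  assumes "integrable circle_measure f" "integrable circle_measure g" "cmod z < 1"
  shows "poisson (\<lambda>\<zeta>. f \<zeta> - g \<zeta>) z = poisson f z - poisson g z"
  unfolding poisson_altdef scaleR_diff_right
  by (intro Bochner_Integration.integral_diff integrable_poisson assms)

lemma poisson_const:
  fixes c :: "'a::{banach, second_countable_topology}"
  assumes "cmod z < 1" shows "poisson (\<lambda>_. c) z = c"
proof -
  have "integrable circle_measure (poisson_kernel z)"
    using integrable_poisson[of "\<lambda>_. 1::real" z] assms by simp
  then show ?thesis
    using integral_poisson_kernel[OF assms] by (simp add: poisson_altdef)
qed

lemma poisson_cmult:
  fixes f :: "complex \<Rightarrow> 'a::{real_normed_field, banach, second_countable_topology}"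
  shows "poisson (\<lambda>\<zeta>. c * f \<zeta>) z = c * poisson f z"
  unfolding poisson_altdef mult_scaleR_right[symmetric] by (rule integral_mult_right_zero)

lemma poisson_mono_AE:
  fixes f g :: "complex \<Rightarrow> real"
  assumes "integrable circle_measure f" "integrable circle_measure g" "cmod z < 1"
    and "AE \<zeta> in circle_measure. f \<zeta> \<le> g \<zeta>"
  shows "poisson f z \<le> poisson g z"
  unfolding poisson_altdef
proof (intro integral_mono_AE integrable_poisson assms)
  show "AE \<zeta> in circle_measure. poisson_kernel z \<zeta> *\<^sub>R f \<zeta> \<le> poisson_kernel z \<zeta> *\<^sub>R g \<zeta>"
    using assms(4)
    by (rule eventually_mono) (use poisson_kernel_nonneg[OF assms(3)] in \<open>auto intro: mult_left_mono\<close>)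
qed

lemma norm_poisson_le:
  fixes f :: "complex \<Rightarrow> 'a::{banach, second_countable_topology}"
  assumes "cmod z < 1"
  shows "norm (poisson f z) \<le> poisson (\<lambda>\<zeta>. norm (f \<zeta>)) z"
proof -
  have "norm (poisson f z) \<le> (LINT \<zeta>|circle_measure. norm (poisson_kernel z \<zeta> *\<^sub>R f \<zeta>))"
    unfolding poisson_altdef by (rule integral_norm_bound)
  then show ?thesis
    using poisson_kernel_nonneg[OF assms] by (simp add: poisson_altdef)
qed

lemma poisson_cong_AE:
  fixes f g :: "complex \<Rightarrow> 'a::{banach, second_countable_topology}"
  assumes "f \<in> borel_measurable circle_measure" "g \<in> borel_measurable circle_measure"
    and "AE \<zeta> in circle_measure. f \<zeta> = g \<zeta>"
  shows "poisson f z = poisson g z"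
  unfolding poisson_altdef
  by (rule integral_cong_AE) (use assms in \<open>auto elim: eventually_mono\<close>)

lemma poisson_norm_bound:
  fixes f :: "complex \<Rightarrow> 'a::{banach, second_countable_topology}"
  assumes "f \<in> borel_measurable circle_measure" "AE \<zeta> in circle_measure. norm (f \<zeta>) \<le> C" "cmod z < 1"
  shows "norm (poisson f z) \<le> C"
proof -
  have "norm (poisson f z) \<le> poisson (\<lambda>\<zeta>. norm (f \<zeta>)) z" by (rule norm_poisson_le[OF assms(3)])
  also have "\<dots> \<le> poisson (\<lambda>_. C) z"
    by (rule poisson_mono_AE) (use assms in \<open>auto intro: integrable_circle_bounded\<close>)
  finally show ?thesis using assms(3) by (simp add: poisson_const)
qed

lemma poisson_tendsto:
  fixes f :: "complex \<Rightarrow> 'a::{banach, second_countable_topology}"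
  assumes "\<And>n. s n \<in> borel_measurable circle_measure" "f \<in> borel_measurable circle_measure"
    and "AE \<zeta> in circle_measure. (\<lambda>n. s n \<zeta>) \<longlonglongrightarrow> f \<zeta>"
    and "\<And>n. AE \<zeta> in circle_measure. norm (s n \<zeta>) \<le> C" and "cmod z < 1"
  shows "(\<lambda>n. poisson (s n) z) \<longlonglongrightarrow> poisson f z"
  unfolding poisson_altdef
proof (rule integral_dominated_convergence[where w="\<lambda>\<zeta>. poisson_kernel z \<zeta> *\<^sub>R C"])
  show "integrable circle_measure (\<lambda>\<zeta>. poisson_kernel z \<zeta> *\<^sub>R C)"
    by (intro integrable_poisson assms) simp
  show "AE \<zeta> in circle_measure. (\<lambda>n. poisson_kernel z \<zeta> *\<^sub>R s n \<zeta>) \<longlonglongrightarrow> poisson_kernel z \<zeta> *\<^sub>R f \<zeta>"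
    using assms(3) by eventually_elim (intro tendsto_intros)
  show "AE \<zeta> in circle_measure. norm (poisson_kernel z \<zeta> *\<^sub>R s n \<zeta>) \<le> poisson_kernel z \<zeta> *\<^sub>R C" for n
    using assms(4)[of n]
    by (rule eventually_mono) (use poisson_kernel_nonneg[OF assms(5)] in \<open>auto intro: mult_left_mono\<close>)
qed (use assms in auto)

section \<open>Density points\<close>

text \<open>
Choose an open \<open>U\<close> around \<open>A\<close> with \<open>U - A\<close> of small measure. A point of \<open>A\<close> that violates the
conclusion is the centre of arbitrarily small balls inside \<open>U\<close> of which a proportion of more than
\<open>\<kappa>\<close> lies in \<open>U - A\<close>. By Vitali's lemma, disjoint balls among these, enlarged five times, cover
all such points, which therefore form a set of outer measure at most \<open>(5 / \<kappa>) |U - A|\<close>.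
\<close>

lemma lebesgue_density:
  fixes A :: "real set"
  assumes A[measurable]: "A \<in> sets borel" and "0 < \<kappa>"
  shows "AE x in lborel. x \<in> A \<longrightarrow>
    (\<exists>\<eta>>0. \<forall>d. 0 < d \<and> d \<le> \<eta> \<longrightarrow> measure lborel (ball x d - A) \<le> \<kappa> * (2 * d))"
    (is "AE x in lborel. x \<in> A \<longrightarrow> ?dense x")
proof -
  define N where "N = {x \<in> A. \<not> ?dense x}"
  have "negligible N"
    unfolding negligible_outer_le
  proof (intro allI impI)
    fix e :: real assume e: "e > 0"
    obtain U where U: "open U" "A \<subseteq> U" "emeasure lborel (U - A) \<le> ennreal (e * \<kappa> / 5)"
      using outer_regular_lborel_le[OF A, of "e * \<kappa> / 5"] e assms by (auto simp: field_simps)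
    have [measurable]: "U \<in> sets borel" using U by auto
    have UA: "U - A \<in> fmeasurable lborel" "measure lborel (U - A) \<le> e * \<kappa> / 5"
    proof -
      show "U - A \<in> fmeasurable lborel"
        using U(3) by (intro fmeasurableI) (auto simp: le_less_trans ennreal_less_top)
      show "measure lborel (U - A) \<le> e * \<kappa> / 5"
        using U(3) e assms unfolding measure_def by (intro enn2real_leI) auto
    qed
    define K where "K = {(x, d). x \<in> N \<and> 0 < d \<and> d \<le> 1 \<and> ball x d \<subseteq> U \<and>
      \<kappa> * (2 * d) < measure lborel (ball x d - A)}"
    have cov: "N \<subseteq> (\<Union>i\<in>K. ball (fst i) (snd i))"
    proof
      fix x assume x: "x \<in> N"
      then obtain e0 where e0: "e0 > 0" "ball x e0 \<subseteq> U"
        using openE[OF U(1), of x] U(2) by (auto simp: N_def)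
      have "\<not> (\<forall>d. 0 < d \<and> d \<le> min 1 e0 \<longrightarrow> measure lborel (ball x d - A) \<le> \<kappa> * (2 * d))"
      proof
        assume "\<forall>d. 0 < d \<and> d \<le> min 1 e0 \<longrightarrow> measure lborel (ball x d - A) \<le> \<kappa> * (2 * d)"
        moreover have "min 1 e0 > 0" using e0 by simp
        ultimately have "?dense x" by blast
        then show False using x unfolding N_def by blast
      qed
      then obtain d where d: "0 < d" "d \<le> 1" "d \<le> e0" "\<kappa> * (2 * d) < measure lborel (ball x d - A)"
        by auto
      moreover have "ball x d \<subseteq> U" using e0 d subset_ball[of d e0 x] by auto
      ultimately have "(x, d) \<in> K" using x by (auto simp: K_def)
      then show "x \<in> (\<Union>i\<in>K. ball (fst i) (snd i))" using d by force
    qed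
    have rad: "0 < snd i \<and> snd i \<le> 1" if "i \<in> K" for i using that by (auto simp: K_def)
    obtain C where C: "countable C" "C \<subseteq> K"
      "pairwise (\<lambda>i j. disjnt (ball (fst i) (snd i)) (ball (fst j) (snd j))) C"
      "N \<subseteq> (\<Union>i\<in>C. ball (fst i) (5 * snd i))"
      by (rule Vitali_covering_lemma_balls[OF cov rad]) (assumption, rule that)
    define T where "T = (\<Union>i\<in>C. ball (fst i) (5 * snd i))"
    have fm: "ball x d \<in> fmeasurable lborel" for x d :: real
      using emeasure_lborel_ball_finite[of x d] by (intro fmeasurableI) auto
    have bd: "measure lborel (\<Union>i\<in>I. ball (fst i) (5 * snd i)) \<le> e" if I: "I \<subseteq> C" "finite I" for I
    proof -
      have pos: "snd i > 0" "\<kappa> * (2 * snd i) \<le> measure lborel (ball (fst i) (snd i) - A)" if "i \<in> I" for i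
      proof -
        have "i \<in> K" using that I(1) C(2) by blast
        then show "snd i > 0" "\<kappa> * (2 * snd i) \<le> measure lborel (ball (fst i) (snd i) - A)"
          by (simp_all add: K_def case_prod_beta)
      qed
      have "measure lborel (\<Union>i\<in>I. ball (fst i) (5 * snd i)) \<le> (\<Sum>i\<in>I. measure lborel (ball (fst i) (5 * snd i)))"
        using I by (intro measure_UNION_le) auto
      also have "\<dots> = (\<Sum>i\<in>I. 10 * snd i)"
        using pos by (intro sum.cong refl) (auto simp: ball_eq_greaterThanLessThan less_imp_le)
      also have "\<dots> = (5 / \<kappa>) * (\<Sum>i\<in>I. \<kappa> * (2 * snd i))"
        using assms by (simp add: sum_distrib_left)
      also have "\<dots> \<le> (5 / \<kappa>) * (\<Sum>i\<in>I. measure lborel (ball (fst i) (snd i) - A))"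
        using assms pos by (intro mult_left_mono sum_mono) auto
      also have "(\<Sum>i\<in>I. measure lborel (ball (fst i) (snd i) - A)) =
        measure lborel (\<Union>i\<in>I. ball (fst i) (snd i) - A)"
      proof (rule measure_UNION'[symmetric])
        show "pairwise (\<lambda>i j. disjnt (ball (fst i) (snd i) - A) (ball (fst j) (snd j) - A)) I"
          using pairwise_subset[OF C(3) I(1)] by (rule pairwise_mono) (auto simp: disjnt_def)
      qed (use I fm in \<open>auto intro!: fmeasurable_Diff\<close>)
      also have "\<dots> \<le> measure lborel (U - A)"
      proof (rule measure_mono_fmeasurable)
        show "(\<Union>i\<in>I. ball (fst i) (snd i) - A) \<subseteq> U - A"
        proof -
          have "ball (fst i) (snd i) \<subseteq> U" if "i \<in> I" for i
          proof -
            have "i \<in> K" using that I(1) C(2) by blast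
            then show ?thesis by (simp add: K_def case_prod_beta)
          qed
          then show ?thesis by blast
        qed
        show "(\<Union>i\<in>I. ball (fst i) (snd i) - A) \<in> sets lborel"
          using I by (intro sets.finite_UN) auto
      qed (rule UA)
      also have "(5 / \<kappa>) * measure lborel (U - A) \<le> (5 / \<kappa>) * (e * \<kappa> / 5)"
        using UA(2) assms by (intro mult_left_mono) auto
      finally show ?thesis using assms by (simp add: divide_right_mono)
    qed
    have T: "T \<in> fmeasurable lborel" "measure lborel T \<le> e"
      unfolding T_def
      by (rule fmeasurable_UN_bound[OF C(1) fm bd] measure_UN_bound[OF C(1) fm bd]; assumption)+
    then have "T \<in> lmeasurable" "measure lebesgue T \<le> e"
      by (auto simp: fmeasurable_def)
    then show "\<exists>T. N \<subseteq> T \<and> T \<in> lmeasurable \<and> measure lebesgue T \<le> e"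
      using C(4) by (auto simp: T_def)
  qed
  then have "N \<in> null_sets (completion lborel)" by (simp add: negligible_iff_null_sets)
  then have "AE x in completion lborel. x \<notin> N" by (rule AE_not_in)
  then have "AE x in lborel. x \<notin> N" by (simp only: AE_completion_iff)
  then show ?thesis by eventually_elim (auto simp: N_def)
qed

section \<open>Radial limits of Poisson integrals of bounded functions\<close>

text \<open>
The layer-cake formula expresses both integrals of \<open>K\<close> through the measures of its superlevel sets.
\<close>

lemma nn_integral_superlevel_mono:
  fixes K :: "real \<Rightarrow> real"
  assumes K[measurable]: "K \<in> borel_measurable borel"
    and [measurable]: "S \<in> sets borel" "I \<in> sets borel"
    and le: "\<And>s. s > 0 \<Longrightarrow> emeasure lborel {t \<in> S. s < K t} \<le> c * emeasure lborel {t \<in> I. s < K t}"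
  shows "(\<integral>\<^sup>+t. indicator S t * ennreal (K t) \<partial>lborel) \<le> c * (\<integral>\<^sup>+t. indicator I t * ennreal (K t) \<partial>lborel)"
proof -
  have layer: "(\<integral>\<^sup>+t. indicator E t * ennreal (K t) \<partial>lborel)
      = (\<integral>\<^sup>+s. indicator {0<..} s * emeasure lborel {t \<in> E. s < K t} \<partial>lborel)"
    if [measurable]: "E \<in> sets borel" for E
  proof -
    have 1: "ennreal (K t) = (\<integral>\<^sup>+s. indicator {0<..<K t} s \<partial>lborel)" for t
      by (cases "0 \<le> K t") (auto simp: ennreal_neg)
    have "(\<integral>\<^sup>+t. indicator E t * ennreal (K t) \<partial>lborel)
        = (\<integral>\<^sup>+t. \<integral>\<^sup>+s. indicator E t * indicator {0<..<K t} s \<partial>lborel \<partial>lborel)"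
      unfolding 1 by (simp add: nn_integral_cmult)
    also have "\<dots> = (\<integral>\<^sup>+t. \<integral>\<^sup>+s. indicator {(t, s). t \<in> E \<and> 0 < s \<and> s < K t} (t, s) \<partial>lborel \<partial>lborel)"
      by (intro nn_integral_cong) (auto split: split_indicator)
    also have "\<dots> = (\<integral>\<^sup>+s. \<integral>\<^sup>+t. indicator {(t, s). t \<in> E \<and> 0 < s \<and> s < K t} (t, s) \<partial>lborel \<partial>lborel)"
      by (rule lborel_pair.Fubini'[symmetric]) measurable
    also have "\<dots> = (\<integral>\<^sup>+s. indicator {0<..} s * (\<integral>\<^sup>+t. indicator {t \<in> E. s < K t} t \<partial>lborel) \<partial>lborel)"
      by (subst nn_integral_cmult[symmetric]) (auto intro!: nn_integral_cong split: split_indicator)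
    finally show ?thesis by (simp add: nn_integral_indicator)
  qed
  have m: "(\<lambda>s. emeasure lborel {t \<in> I. s < K t}) \<in> borel_measurable lborel"
  proof -
    have "(\<lambda>s. \<integral>\<^sup>+t. indicator {(t, s). t \<in> I \<and> s < K t} (t, s) \<partial>lborel) \<in> borel_measurable lborel"
      by measurable
    moreover have "(\<integral>\<^sup>+t. indicator {(t, s). t \<in> I \<and> s < K t} (t, s) \<partial>lborel)
        = emeasure lborel {t \<in> I. s < K t}" for s
    proof -
      have "(\<integral>\<^sup>+t. indicator {(t, s). t \<in> I \<and> s < K t} (t, s) \<partial>lborel)
          = (\<integral>\<^sup>+t. indicator {t \<in> I. s < K t} t \<partial>lborel)"
        by (intro nn_integral_cong) (auto split: split_indicator)
      then show ?thesis by simp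
    qed
    ultimately show ?thesis by simp
  qed
  have "(\<integral>\<^sup>+s. indicator {0<..} s * emeasure lborel {t \<in> S. s < K t} \<partial>lborel)
    \<le> (\<integral>\<^sup>+s. c * (indicator {0<..} s * emeasure lborel {t \<in> I. s < K t}) \<partial>lborel)"
    using le by (intro nn_integral_mono) (auto split: split_indicator)
  also have "\<dots> = c * (\<integral>\<^sup>+s. indicator {0<..} s * emeasure lborel {t \<in> I. s < K t} \<partial>lborel)"
    using m by (intro nn_integral_cmult) measurable
  finally show ?thesis by (simp add: layer)
qed

lemma poisson_kernel_cis:
  "poisson_kernel (of_real r * cis \<theta>) (cis t) = (1 - r\<^sup>2) / (1 - 2 * r * cos (t - \<theta>) + r\<^sup>2)"
proof -
  have "(cmod (cis t - of_real r * cis \<theta>))\<^sup>2 = (cos t - r * cos \<theta>)\<^sup>2 + (sin t - r * sin \<theta>)\<^sup>2"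
    by (simp add: cmod_power2)
  also have "\<dots> = ((sin t)\<^sup>2 + (cos t)\<^sup>2) - 2 * r * (cos t * cos \<theta> + sin t * sin \<theta>) + r\<^sup>2 * ((sin \<theta>)\<^sup>2 + (cos \<theta>)\<^sup>2)"
    by algebra
  also have "\<dots> = 1 - 2 * r * cos (t - \<theta>) + r\<^sup>2" by (simp add: cos_diff)
  finally show ?thesis by (simp add: poisson_kernel_def norm_mult power_mult_distrib)
qed

text \<open>
Near \<open>\<theta>\<close> the Poisson kernel is a decreasing function of the distance to \<open>\<theta>\<close>, hence its superlevel
sets are balls centred at \<open>\<theta>\<close>. In terms of the angle the kernel is an increasing function of
\<open>cos (t - \<theta>)\<close>, so it is enough to see this for the cosine.
\<close>

lemma cos_superlevel_ball:
  fixes \<theta> c \<eta> :: real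
  assumes "0 \<le> \<eta>" "\<eta> \<le> pi"
  shows "\<exists>d. 0 \<le> d \<and> d \<le> \<eta> \<and> {t \<in> ball \<theta> \<eta>. c < cos (t - \<theta>)} = ball \<theta> d"
proof -
  consider "c \<ge> 1" | "c < -1" | "-1 \<le> c" "c < 1" by linarith
  then show ?thesis
  proof cases
    case 1
    have "\<not> c < cos (t - \<theta>)" for t using cos_le_one[of "t - \<theta>"] 1 by linarith
    then have "{t \<in> ball \<theta> \<eta>. c < cos (t - \<theta>)} = ball \<theta> 0" by auto
    then show ?thesis using assms by blast
  next
    case 2
    have "c < cos (t - \<theta>)" for t using cos_ge_minus_one[of "t - \<theta>"] 2 by linarith
    then show ?thesis using assms by (intro exI[of _ \<eta>]) auto
  next
    case 3
    have "c < cos (t - \<theta>) \<longleftrightarrow> \<bar>t - \<theta>\<bar> < arccos c" if "t \<in> ball \<theta> \<eta>" for t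
    proof -
      have "\<bar>t - \<theta>\<bar> \<le> pi" using that assms by (auto simp: dist_real_def)
      then have "cos (arccos c) < cos \<bar>t - \<theta>\<bar> \<longleftrightarrow> \<bar>t - \<theta>\<bar> < arccos c"
        using 3 by (intro cos_mono_less_eq) (auto intro: arccos_lbound arccos_ubound)
      then show ?thesis using 3 by (simp add: cos_arccos)
    qed
    then have "{t \<in> ball \<theta> \<eta>. c < cos (t - \<theta>)} = ball \<theta> (min \<eta> (arccos c))"
      by (auto simp: dist_real_def abs_minus_commute)
    then show ?thesis using assms 3 arccos_lbound[of c] by (intro exI[of _ "min \<eta> (arccos c)"]) auto
  qed
qed

text \<open>
A bound on the proportion of \<open>A\<close> in every small ball around \<open>\<theta>\<close> is inherited by the mean of \<open>A\<close>
with respect to the Poisson kernel, since the kernel is a superposition of indicators of such balls.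
\<close>

lemma poisson_near_le:
  fixes \<theta> \<eta> :: real
  assumes [measurable]: "A \<in> sets borel" and \<theta>: "0 < \<eta>" "\<eta> < \<theta>" "\<theta> + \<eta> < 2 * pi"
    and dens: "\<And>d. 0 < d \<Longrightarrow> d \<le> \<eta> \<Longrightarrow> measure lborel (ball \<theta> d \<inter> A) \<le> \<kappa> * (2 * d)" and "\<kappa> \<ge> 0"
    and r: "0 < r" "r < 1"
  defines "K \<equiv> \<lambda>t. poisson_kernel (of_real r * cis \<theta>) (cis t)"
  shows "(\<integral>\<^sup>+t. indicator (ball \<theta> \<eta> \<inter> A) t * ennreal (K t) \<partial>lborel)
    \<le> ennreal \<kappa> * (\<integral>\<^sup>+t. indicator (ball \<theta> \<eta>) t * ennreal (K t) \<partial>lborel)"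
proof (rule nn_integral_superlevel_mono)
  show "K \<in> borel_measurable borel" unfolding K_def poisson_kernel_cis by measurable
  fix s :: real assume s: "s > 0"
  have pos: "1 - 2 * r * cos u + r\<^sup>2 > 0" for u :: real
  proof -
    have "1 - 2 * r * cos u + r\<^sup>2 \<ge> (1 - r)\<^sup>2"
      using cos_le_one[of u] r by (simp add: power2_eq_square algebra_simps)
    moreover have "(1 - r)\<^sup>2 > 0" using r by auto
    ultimately show ?thesis by linarith
  qed
  (* solving s < (1 - r^2) / (1 - 2 r x + r^2) for x = cos (t - \<theta>) *)
  define c where "c = (1 + r\<^sup>2 - (1 - r\<^sup>2) / s) / (2 * r)"
  have lev: "s < K t \<longleftrightarrow> c < cos (t - \<theta>)" for t
  proof -
    have "s < K t \<longleftrightarrow> s * (1 - 2 * r * cos (t - \<theta>) + r\<^sup>2) < 1 - r\<^sup>2"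
      unfolding K_def poisson_kernel_cis using pos by (simp add: pos_less_divide_eq)
    also have "\<dots> \<longleftrightarrow> 1 - 2 * r * cos (t - \<theta>) + r\<^sup>2 < (1 - r\<^sup>2) / s"
      using s by (simp add: pos_less_divide_eq mult.commute)
    also have "\<dots> \<longleftrightarrow> 1 + r\<^sup>2 - (1 - r\<^sup>2) / s < cos (t - \<theta>) * (2 * r)"
      by (auto simp: algebra_simps)
    also have "\<dots> \<longleftrightarrow> c < cos (t - \<theta>)"
      unfolding c_def using r by (simp add: pos_divide_less_eq)
    finally show ?thesis .
  qed
  have "\<eta> \<le> pi" using \<theta> by linarith
  then obtain d where d: "0 \<le> d" "d \<le> \<eta>" "{t \<in> ball \<theta> \<eta>. s < K t} = ball \<theta> d"
    using cos_superlevel_ball[of \<eta> \<theta> c] \<theta>(1) unfolding lev by auto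
  have fin: "emeasure lborel (ball \<theta> d \<inter> A) < \<infinity>"
    by (rule le_less_trans[OF emeasure_mono emeasure_lborel_ball_finite[of \<theta> d]]) auto
  have "{t \<in> ball \<theta> \<eta> \<inter> A. s < K t} = ball \<theta> d \<inter> A" using d(3) by auto
  then have "emeasure lborel {t \<in> ball \<theta> \<eta> \<inter> A. s < K t} = ennreal (measure lborel (ball \<theta> d \<inter> A))"
    using fin by (simp add: emeasure_eq_ennreal_measure)
  also have "\<dots> \<le> ennreal (\<kappa> * (2 * d))"
    using dens[of d] d by (cases "d = 0") (auto intro!: ennreal_leI)
  also have "\<dots> = ennreal \<kappa> * emeasure lborel (ball \<theta> d)"
    using d \<open>\<kappa> \<ge> 0\<close> by (simp add: ball_eq_greaterThanLessThan ennreal_mult)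
  finally show "emeasure lborel {t \<in> ball \<theta> \<eta> \<inter> A. s < K t} \<le> ennreal \<kappa> * emeasure lborel {t \<in> ball \<theta> \<eta>. s < K t}"
    by (simp only: d(3))
qed measurable

text \<open>
The part of \<open>E\<close> near the point contributes at most \<open>\<kappa>\<close>, by the previous bound. At angular distance
at least \<open>\<eta>\<close> the kernel itself is at most \<open>(1 - r\<^sup>2) / (2 r (1 - cos \<eta>))\<close>, because its denominator
is \<open>(1 - r)\<^sup>2 + 2 r (1 - cos (t - \<theta>))\<close>.
\<close>

lemma poisson_indicator_le:
  fixes \<theta> \<eta> :: real
  assumes E: "E \<in> sets circle_measure" and \<theta>: "0 < \<eta>" "\<eta> < \<theta>" "\<theta> + \<eta> < 2 * pi"
    and dens: "\<And>d. 0 < d \<Longrightarrow> d \<le> \<eta> \<Longrightarrow> measure lborel (ball \<theta> d \<inter> {t. cis t \<in> E}) \<le> \<kappa> * (2 * d)"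
    and "\<kappa> \<ge> 0" and r: "0 < r" "r < 1"
  shows "poisson (indicat_real E) (of_real r * cis \<theta>) \<le> \<kappa> + (1 - r\<^sup>2) / (2 * r * (1 - cos \<eta>))"
proof -
  define A where "A = {t. cis t \<in> E}"
  have A[measurable]: "A \<in> sets borel" unfolding A_def by (rule cis_vimage_borel[OF E])
  define z where "z = of_real r * cis \<theta>"
  have z: "cmod z < 1" using r by (simp add: z_def norm_mult)
  define K where "K = (\<lambda>t. poisson_kernel z (cis t))"
  define q where "q = (1 - r\<^sup>2) / (2 * r * (1 - cos \<eta>))"
  have K0: "K t \<ge> 0" for t using poisson_kernel_nonneg[OF z] by (simp add: K_def)
  have contK: "continuous_on X K" for X
  proof -
    have "cis t \<noteq> z" for t using z by (metis norm_cis less_irrefl)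
    then show ?thesis unfolding K_def poisson_kernel_def by (auto intro!: continuous_intros)
  qed
  have [measurable]: "K \<in> borel_measurable borel"
    using contK by (rule borel_measurable_continuous_onI)
  have intK: "set_integrable lborel X K" if "X \<in> sets borel" "X \<subseteq> {0..2*pi}" for X
  proof (rule set_integrable_subset)
    show "set_integrable lborel {0..2*pi} K"
      by (rule borel_integrable_atLeastAtMost'[OF contK])
  qed (use that in auto)
  have full: "(LINT t:{0..<2*pi}|lborel. K t) = 2 * pi"
    using integral_poisson_kernel[OF z] integral_circle_eq_lborel[OF poisson_kernel_measurable[of z]]
    by (simp add: K_def)
  have sub: "ball \<theta> \<eta> \<subseteq> {0..<2*pi}" using \<theta> by (auto simp: dist_real_def)
  have cosu: "cos \<eta> < 1" using \<theta> cos_monotone_0_pi[of 0 \<eta>] by simp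
  have near: "(LINT t:ball \<theta> \<eta> \<inter> A|lborel. K t) \<le> \<kappa> * (2 * pi)"
  proof -
    have eq: "(\<integral>\<^sup>+t. indicator X t * ennreal (K t) \<partial>lborel) = ennreal (LINT t:X|lborel. K t)"
      if "X \<in> sets borel" "X \<subseteq> {0..2*pi}" for X
    proof -
      have "(\<integral>\<^sup>+t. indicator X t * ennreal (K t) \<partial>lborel) = (\<integral>\<^sup>+t. ennreal (indicator X t *\<^sub>R K t) \<partial>lborel)"
        by (intro nn_integral_cong) (auto split: split_indicator)
      also have "\<dots> = ennreal (LINT t|lborel. indicator X t *\<^sub>R K t)"
        using intK[OF that] K0 unfolding set_integrable_def by (intro nn_integral_eq_integral) auto
      finally show ?thesis by (simp add: set_lebesgue_integral_def)
    qed
    have X: "ball \<theta> \<eta> \<inter> A \<in> sets borel" "ball \<theta> \<eta> \<inter> A \<subseteq> {0..2*pi}"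
      "ball \<theta> \<eta> \<in> sets borel" "ball \<theta> \<eta> \<subseteq> {0..2*pi}" using sub by auto
    have "(\<integral>\<^sup>+t. indicator (ball \<theta> \<eta> \<inter> A) t * ennreal (K t) \<partial>lborel)
      \<le> ennreal \<kappa> * (\<integral>\<^sup>+t. indicator (ball \<theta> \<eta>) t * ennreal (K t) \<partial>lborel)"
      unfolding K_def z_def
      by (rule poisson_near_le[OF A \<theta> _ \<open>\<kappa> \<ge> 0\<close> r]) (use dens in \<open>auto simp: A_def\<close>)
    then have "ennreal (LINT t:ball \<theta> \<eta> \<inter> A|lborel. K t) \<le> ennreal \<kappa> * ennreal (LINT t:ball \<theta> \<eta>|lborel. K t)"
      unfolding eq[OF X(1,2)] eq[OF X(3,4)] .
    also have "\<dots> = ennreal (\<kappa> * (LINT t:ball \<theta> \<eta>|lborel. K t))"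
      using \<open>\<kappa> \<ge> 0\<close> by (simp add: ennreal_mult')
    finally have "(LINT t:ball \<theta> \<eta> \<inter> A|lborel. K t) \<le> \<kappa> * (LINT t:ball \<theta> \<eta>|lborel. K t)"
      using \<open>\<kappa> \<ge> 0\<close> K0
      by (subst (asm) ennreal_le_iff) (auto simp: set_lebesgue_integral_def intro!: mult_nonneg_nonneg integral_nonneg_AE)
    also have "(LINT t:ball \<theta> \<eta>|lborel. K t) \<le> (LINT t:{0..<2*pi}|lborel. K t)"
    proof -
      have "set_integrable lborel {0..<2*pi} K" "set_integrable lborel (ball \<theta> \<eta>) K"
        using X by (auto intro!: intK)
      then show ?thesis
        using sub K0 unfolding set_lebesgue_integral_def set_integrable_def
        by (intro integral_mono) (auto split: split_indicator)
    qed
    finally show ?thesis using full \<open>\<kappa> \<ge> 0\<close> by (simp add: mult_left_mono)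
  qed
  have far: "K t \<le> q" if "t \<in> {0..<2*pi}" "t \<notin> ball \<theta> \<eta>" for t
  proof -
    have "cos (t - \<theta>) \<le> cos \<eta>"
    proof (cases "\<bar>t - \<theta>\<bar> \<le> pi")
      case True
      then have "cos \<bar>t - \<theta>\<bar> \<le> cos \<eta>"
        using that \<theta> by (intro cos_monotone_0_pi_le) (auto simp: dist_real_def abs_minus_commute)
      then show ?thesis by simp
    next
      case False
      then have "cos (2 * pi - \<bar>t - \<theta>\<bar>) \<le> cos \<eta>"
        using that \<theta> by (intro cos_monotone_0_pi_le) auto
      then show ?thesis by (simp add: cos_diff)
    qed
    then have "2 * r * cos (t - \<theta>) \<le> 2 * r * cos \<eta>" using r by (intro mult_left_mono) auto
    moreover have "0 \<le> (1 - r)\<^sup>2" by simp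
    ultimately have "2 * r * (1 - cos \<eta>) \<le> 1 - 2 * r * cos (t - \<theta>) + r\<^sup>2"
      by (simp add: power2_eq_square algebra_simps)
    moreover have "2 * r * (1 - cos \<eta>) > 0" using r cosu by simp
    ultimately show ?thesis
      unfolding K_def z_def poisson_kernel_cis q_def using r
      by (intro divide_left_mono) (auto simp: power_le_one intro!: mult_pos_pos)
  qed
  have q0: "q \<ge> 0" using r cosu by (auto simp: q_def power_le_one intro!: divide_nonneg_nonneg mult_nonneg_nonneg)
  have "(LINT t:{0..<2*pi}|lborel. indicator A t * K t)
      \<le> (LINT t|lborel. indicator (ball \<theta> \<eta> \<inter> A) t *\<^sub>R K t + indicator {0..<2*pi} t *\<^sub>R q)"
    unfolding set_lebesgue_integral_def
  proof (rule integral_mono)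
    have "set_integrable lborel ({0..<2*pi} \<inter> A) K" by (rule intK) auto
    then show "integrable lborel (\<lambda>t. indicat_real {0..<2 * pi} t *\<^sub>R (indicat_real A t * K t))"
      by (simp add: set_integrable_def indicator_inter_arith mult.assoc)
    have "set_integrable lborel (ball \<theta> \<eta> \<inter> A) K" using sub by (intro intK) auto
    then show "integrable lborel (\<lambda>t. indicat_real (ball \<theta> \<eta> \<inter> A) t *\<^sub>R K t + indicat_real {0..<2 * pi} t *\<^sub>R q)"
      by (intro Bochner_Integration.integrable_add) (auto simp: set_integrable_def)
    show "indicat_real {0..<2 * pi} t *\<^sub>R (indicat_real A t * K t)
        \<le> indicat_real (ball \<theta> \<eta> \<inter> A) t *\<^sub>R K t + indicat_real {0..<2 * pi} t *\<^sub>R q" for t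
      using far[of t] sub q0 K0[of t] by (auto split: split_indicator)
  qed
  also have "\<dots> = (LINT t:ball \<theta> \<eta> \<inter> A|lborel. K t) + 2 * pi * q"
  proof -
    have "set_integrable lborel (ball \<theta> \<eta> \<inter> A) K" using sub by (intro intK) auto
    then show ?thesis
      by (subst Bochner_Integration.integral_add) (auto simp: set_integrable_def set_lebesgue_integral_def)
  qed
  finally have "(LINT t:{0..<2*pi}|lborel. indicator A t * K t) \<le> 2 * pi * (\<kappa> + q)"
    using near by (simp add: algebra_simps)
  moreover have "poisson (indicat_real E) z = 1 / (2 * pi) * (LINT t:{0..<2*pi}|lborel. indicator A t * K t)"
  proof -
    have "(\<lambda>\<zeta>. poisson_kernel z \<zeta> *\<^sub>R indicat_real E \<zeta>) \<in> borel_measurable circle_measure"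
      using E by measurable
    then have "poisson (indicat_real E) z = 1 / (2 * pi) * (LINT t:{0..<2*pi}|lborel. K t * indicator E (cis t))"
      unfolding poisson_altdef K_def by (simp add: integral_circle_eq_lborel)
    also have "(\<lambda>t. K t * indicator E (cis t)) = (\<lambda>t. indicator A t * K t)"
      by (auto simp: A_def split: split_indicator)
    finally show ?thesis .
  qed
  ultimately have "poisson (indicat_real E) z \<le> 1 / (2 * pi) * (2 * pi * (\<kappa> + q))"
    by (simp only:) (intro mult_left_mono, auto)
  then show ?thesis by (simp add: z_def q_def)
qed

text \<open>
Fatou's theorem for indicators: at a density point of \<open>E\<close> the complement is seen with a
proportion below any given \<open>1 / (n + 1)\<close> in all small balls.
\<close>

lemma poisson_indicator_compl_tendsto:
  assumes E: "E \<in> sets circle_measure"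
  shows "AE \<zeta> in circle_measure. \<zeta> \<in> E \<longrightarrow>
    ((\<lambda>r. poisson (indicat_real (sphere 0 1 - E)) (of_real r * \<zeta>)) \<longlongrightarrow> 0) (at_left 1)"
proof (rule AE_circleI)
  define A where "A = {t. cis t \<in> E}"
  have A[measurable]: "A \<in> sets borel" unfolding A_def by (rule cis_vimage_borel[OF E])
  have "AE t in lborel. \<forall>n. t \<in> A \<longrightarrow> (\<exists>\<eta>>0. \<forall>d. 0 < d \<and> d \<le> \<eta> \<longrightarrow>
     measure lborel (ball t d - A) \<le> (1 / real (Suc n)) * (2 * d))"
    unfolding AE_all_countable by (intro allI lebesgue_density) auto
  then show "AE t in lborel. 0 < t \<and> t < 2 * pi \<longrightarrow> cis t \<in> E \<longrightarrow>
    ((\<lambda>r. poisson (indicat_real (sphere 0 1 - E)) (of_real r * cis t)) \<longlongrightarrow> 0) (at_left 1)"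
  proof eventually_elim
    case (elim t)
    show ?case
    proof (intro impI order_tendstoI)
      fix a :: real assume "a < 0"
      show "\<forall>\<^sub>F r in at_left 1. a < poisson (indicat_real (sphere 0 1 - E)) (of_real r * cis t)"
      proof (rule eventually_at_leftI[of 0])
        fix r :: real assume "r \<in> {0<..<1}"
        then have "cmod (of_real r * cis t) < 1" by (simp add: norm_mult)
        then have "0 \<le> poisson (indicat_real (sphere 0 1 - E)) (of_real r * cis t)"
          unfolding poisson_altdef using poisson_kernel_nonneg by (intro integral_nonneg_AE) auto
        then show "a < poisson (indicat_real (sphere 0 1 - E)) (of_real r * cis t)"
          using \<open>a < 0\<close> by linarith
      qed simp
    next
      fix a :: real assume t: "0 < t \<and> t < 2 * pi" "cis t \<in> E" and a: "0 < a"
      obtain n where n: "1 / real (Suc n) < a" using a nat_approx_posE by blast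
      obtain \<eta>0 where \<eta>0: "\<eta>0 > 0" "\<And>d. 0 < d \<Longrightarrow> d \<le> \<eta>0 \<Longrightarrow> measure lborel (ball t d - A) \<le> (1 / real (Suc n)) * (2 * d)"
        using elim t unfolding A_def by blast
      define \<eta> where "\<eta> = min \<eta>0 (min (t / 2) ((2 * pi - t) / 2))"
      have \<eta>: "0 < \<eta>" "\<eta> < t" "t + \<eta> < 2 * pi" "\<eta> \<le> \<eta>0"
      proof -
        have "\<eta> \<le> t / 2" "\<eta> \<le> (2 * pi - t) / 2" unfolding \<eta>_def by (meson min.cobounded1 min.cobounded2 order_trans)+
        then show "\<eta> < t" "t + \<eta> < 2 * pi" using t by auto
      qed (use t \<eta>0 in \<open>auto simp: \<eta>_def\<close>)
      have cosu: "cos \<eta> < 1" using \<eta> cos_monotone_0_pi[of 0 \<eta>] by simp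
      have E': "sphere 0 1 - E \<in> sets circle_measure" using sets.compl_sets[OF E] by simp
      have d: "measure lborel (ball t d \<inter> {u. cis u \<in> sphere 0 1 - E}) \<le> (1 / real (Suc n)) * (2 * d)"
        if "0 < d" "d \<le> \<eta>" for d
      proof -
        have "ball t d \<inter> {u. cis u \<in> sphere 0 1 - E} = ball t d - A" by (auto simp: A_def)
        then show ?thesis using \<eta>0(2)[of d] that \<eta> by simp
      qed
      have "((\<lambda>r::real. 1 / real (Suc n) + (1 - r\<^sup>2) / (2 * r * (1 - cos \<eta>))) \<longlongrightarrow> 1 / real (Suc n) + (1 - 1\<^sup>2) / (2 * 1 * (1 - cos \<eta>))) (at_left 1)"
        using cosu by (intro tendsto_intros) auto
      then have "\<forall>\<^sub>F r in at_left 1. 1 / real (Suc n) + (1 - r\<^sup>2) / (2 * r * (1 - cos \<eta>)) < a"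
        using n by (intro order_tendstoD(2)) auto
      moreover have "\<forall>\<^sub>F r::real in at_left 1. r \<in> {0<..<1}"
        by (rule eventually_at_leftI[of 0]) auto
      ultimately show "\<forall>\<^sub>F r in at_left 1. poisson (indicat_real (sphere 0 1 - E)) (of_real r * cis t) < a"
      proof eventually_elim
        case (elim r)
        then show ?case
          using poisson_indicator_le[OF E' \<eta>(1-3) d, of r] by simp
      qed
    qed
  qed
qed

text \<open>
For rational \<open>q\<close> one has \<open>f \<ge> q - (C + |q|) \<one>\<^bsub>{f \<le> q}\<^esub>\<close>, and at almost every point of \<open>{f > q}\<close> the
Poisson integral of the last indicator tends to \<open>0\<close>. Taking the countably many \<open>q\<close> together gives
the lower bound \<open>f(\<zeta>)\<close> for the radial lower limit.
\<close>

lemma poisson_radial_lower: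
  fixes f :: "complex \<Rightarrow> real"
  assumes f[measurable]: "f \<in> borel_measurable circle_measure" and bd: "AE \<zeta> in circle_measure. \<bar>f \<zeta>\<bar> \<le> C"
  shows "AE \<zeta> in circle_measure. \<forall>a < f \<zeta>. \<forall>\<^sub>F r in at_left 1. a < poisson f (of_real r * \<zeta>)"
proof -
  define E where "E = (\<lambda>q::rat. {\<zeta> \<in> space circle_measure. f \<zeta> > of_rat q})"
  have [measurable]: "E q \<in> sets circle_measure" for q unfolding E_def by measurable
  have "AE \<zeta> in circle_measure. \<forall>q. \<zeta> \<in> E q \<longrightarrow>
    ((\<lambda>r. poisson (indicat_real (sphere 0 1 - E q)) (of_real r * \<zeta>)) \<longlongrightarrow> 0) (at_left 1)"
    unfolding AE_all_countable by (intro allI poisson_indicator_compl_tendsto) measurable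
  with AE_circle_norm show ?thesis
  proof eventually_elim
    case (elim \<zeta>)
    show ?case
    proof (intro allI impI)
      fix a assume "a < f \<zeta>"
      then obtain q where q: "a < of_rat q" "of_rat q < f \<zeta>" using of_rat_dense by blast
      (* f >= -C >= q - D almost everywhere, and f > q on E q *)
      define D where "D = C + \<bar>of_rat q\<bar>"
      define P where "P = (\<lambda>r::real. poisson (indicat_real (sphere 0 1 - E q)) (of_real r * \<zeta>))"
      have "\<zeta> \<in> E q" using q elim by (simp add: E_def)
      then have "(P \<longlongrightarrow> 0) (at_left 1)" using elim by (simp add: P_def)
      then have "((\<lambda>r. of_rat q - D * P r) \<longlongrightarrow> of_rat q - D * 0) (at_left 1)" by (intro tendsto_intros)
      then have "\<forall>\<^sub>F r in at_left 1. a < of_rat q - D * P r"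
        using q by (intro order_tendstoD(1)) auto
      moreover have "\<forall>\<^sub>F r::real in at_left 1. r \<in> {0<..<1}"
        by (rule eventually_at_leftI[of 0]) auto
      ultimately show "\<forall>\<^sub>F r in at_left 1. a < poisson f (of_real r * \<zeta>)"
      proof eventually_elim
        case (elim r)
        have z: "cmod (of_real r * \<zeta>) < 1" using elim \<open>cmod \<zeta> = 1\<close> by (simp add: norm_mult)
        have S: "sphere 0 1 - E q \<in> sets circle_measure" using sets.compl_sets[of "E q" circle_measure] by simp
        have i: "integrable circle_measure (indicat_real (sphere 0 1 - E q))"
          using S by (intro integrable_circle_bounded[of _ 1]) (auto split: split_indicator)
        have "of_rat q - D * P r = poisson (\<lambda>\<zeta>. of_rat q - D * indicat_real (sphere 0 1 - E q) \<zeta>) (of_real r * \<zeta>)"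
          using i z by (simp add: P_def poisson_diff poisson_const poisson_cmult)
        also have "\<dots> \<le> poisson f (of_real r * \<zeta>)"
        proof (rule poisson_mono_AE)
          show "AE \<zeta> in circle_measure. of_rat q - D * indicat_real (sphere 0 1 - E q) \<zeta> \<le> f \<zeta>"
            using bd AE_space
          proof eventually_elim
            case (elim \<xi>)
            show ?case
            proof (cases "\<xi> \<in> E q")
              case True
              then show ?thesis by (simp add: E_def)
            next
              case False
              have "real_of_rat q - D \<le> f \<xi>" using elim(1) unfolding D_def by linarith
              then show ?thesis using False elim(2) by simp
            qed
          qed
        qed (use i z integrable_circle_bounded[of f C] bd in auto)
        finally show ?case using elim by simp
      qed
    qed
  qed
qed

text \<open>
Fatou's theorem for bounded functions: apply the lower bound to \<open>f\<close> and to \<open>-f\<close>.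
\<close>

theorem poisson_radial_limit_real:
  fixes f :: "complex \<Rightarrow> real"
  assumes f[measurable]: "f \<in> borel_measurable circle_measure" and bd: "AE \<zeta> in circle_measure. \<bar>f \<zeta>\<bar> \<le> C"
  shows "AE \<zeta> in circle_measure. ((\<lambda>r. poisson f (of_real r * \<zeta>)) \<longlongrightarrow> f \<zeta>) (at_left 1)"
proof -
  have "AE \<zeta> in circle_measure. \<forall>a < - f \<zeta>. \<forall>\<^sub>F r in at_left 1. a < poisson (\<lambda>\<zeta>. - f \<zeta>) (of_real r * \<zeta>)"
    using bd by (intro poisson_radial_lower[of _ C]) auto
  with poisson_radial_lower[OF assms] show ?thesis
  proof eventually_elim
    case (elim \<zeta>)
    show ?case
    proof (rule order_tendstoI)
      fix a assume "a > f \<zeta>"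
      then have "\<forall>\<^sub>F r in at_left 1. - a < poisson (\<lambda>\<zeta>. - f \<zeta>) (of_real r * \<zeta>)" using elim by simp
      moreover have "poisson (\<lambda>\<zeta>. - f \<zeta>) z = - poisson f z" for z
        using poisson_cmult[of "-1" f z] by simp
      ultimately show "\<forall>\<^sub>F r in at_left 1. poisson f (of_real r * \<zeta>) < a" by simp
    qed (use elim in blast)
  qed
qed

theorem poisson_radial_limit:
  fixes f :: "complex \<Rightarrow> complex"
  assumes f[measurable]: "f \<in> borel_measurable circle_measure" and bd: "AE \<zeta> in circle_measure. cmod (f \<zeta>) \<le> C"
  shows "AE \<zeta> in circle_measure. ((\<lambda>r. poisson f (of_real r * \<zeta>)) \<longlongrightarrow> f \<zeta>) (at_left 1)"
proof -
  have i: "integrable circle_measure f" using assms by (rule integrable_circle_bounded)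
  have "AE \<zeta> in circle_measure. \<bar>Re (f \<zeta>)\<bar> \<le> C"
    using bd by eventually_elim (metis abs_Re_le_cmod order_trans)
  then have re: "AE \<zeta> in circle_measure. ((\<lambda>r. poisson (\<lambda>\<zeta>. Re (f \<zeta>)) (of_real r * \<zeta>)) \<longlongrightarrow> Re (f \<zeta>)) (at_left 1)"
    by (intro poisson_radial_limit_real) measurable
  have "AE \<zeta> in circle_measure. \<bar>Im (f \<zeta>)\<bar> \<le> C"
    using bd by eventually_elim (metis abs_Im_le_cmod order_trans)
  then have im: "AE \<zeta> in circle_measure. ((\<lambda>r. poisson (\<lambda>\<zeta>. Im (f \<zeta>)) (of_real r * \<zeta>)) \<longlongrightarrow> Im (f \<zeta>)) (at_left 1)"
    by (intro poisson_radial_limit_real) measurable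
  have split: "poisson f z = Complex (poisson (\<lambda>\<zeta>. Re (f \<zeta>)) z) (poisson (\<lambda>\<zeta>. Im (f \<zeta>)) z)"
    if "cmod z < 1" for z
    using integrable_poisson[OF i that] unfolding poisson_altdef
    by (simp add: complex_eq_iff flip: integral_Re integral_Im)
  show ?thesis using re im AE_circle_norm
  proof eventually_elim
    case (elim \<zeta>)
    have "((\<lambda>r. Complex (poisson (\<lambda>\<zeta>. Re (f \<zeta>)) (of_real r * \<zeta>)) (poisson (\<lambda>\<zeta>. Im (f \<zeta>)) (of_real r * \<zeta>)))
       \<longlongrightarrow> Complex (Re (f \<zeta>)) (Im (f \<zeta>))) (at_left 1)"
      using elim by (intro tendsto_Complex)
    moreover have "\<forall>\<^sub>F r::real in at_left 1. r \<in> {0<..<1}"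
      by (rule eventually_at_leftI[of 0]) auto
    then have "\<forall>\<^sub>F r in at_left 1. Complex (poisson (\<lambda>\<zeta>. Re (f \<zeta>)) (of_real r * \<zeta>)) (poisson (\<lambda>\<zeta>. Im (f \<zeta>)) (of_real r * \<zeta>))
        = poisson f (of_real r * \<zeta>)"
      by eventually_elim (use elim(3) in \<open>simp add: split norm_mult\<close>)
    ultimately show ?case by (simp add: tendsto_cong)
  qed
qed

section \<open>Boundary values of bounded holomorphic functions\<close>

lemma borel_measurable_cnj [measurable]: "cnj \<in> borel_measurable borel"
  by (intro borel_measurable_continuous_onI continuous_intros)

text \<open>
Termwise integration. It is used with \<open>e n \<zeta> = \<zeta>\<^sup>n\<close> for Parseval's formula and with
\<open>e n \<zeta> = cnj \<zeta>\<^sup>n\<close> for the Herglotz transform.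
\<close>

lemma circle_integral_series:
  fixes c :: "nat \<Rightarrow> complex" and h :: "complex \<Rightarrow> complex"
  assumes c: "summable (\<lambda>n. cmod (c n))" and h: "integrable circle_measure h"
    and e: "\<And>n. e n \<in> borel_measurable circle_measure" "\<And>n \<zeta>. cmod \<zeta> = 1 \<Longrightarrow> cmod (e n \<zeta>) \<le> 1"
  shows "(\<lambda>n. c n * (LINT \<zeta>|circle_measure. e n \<zeta> * h \<zeta>)) sums
    (LINT \<zeta>|circle_measure. (\<Sum>n. c n * e n \<zeta>) * h \<zeta>)"
proof -
  have [measurable]: "h \<in> borel_measurable circle_measure" using h by auto
  note e(1)[measurable]
  have bound: "AE \<zeta> in circle_measure. norm (c n * e n \<zeta> * h \<zeta>) \<le> norm (cmod (c n) * cmod (h \<zeta>))" for n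
    using AE_circle_norm
  proof eventually_elim
    case (elim \<zeta>)
    have "cmod (c n) * cmod (e n \<zeta>) * cmod (h \<zeta>) \<le> cmod (c n) * 1 * cmod (h \<zeta>)"
      using e(2)[OF elim, of n] by (intro mult_right_mono mult_left_mono) auto
    then show ?case by (simp add: norm_mult)
  qed
  have ih: "integrable circle_measure (\<lambda>\<zeta>. cmod (c n) * cmod (h \<zeta>))" for n using h by simp
  have i: "integrable circle_measure (\<lambda>\<zeta>. c n * e n \<zeta> * h \<zeta>)" for n
    by (rule Bochner_Integration.integrable_bound[OF ih _ bound]) measurable
  have sc: "summable (\<lambda>n. c n * e n \<zeta>)" "summable (\<lambda>n. cmod (c n * e n \<zeta>))" if "cmod \<zeta> = 1" for \<zeta>
  proof -
    show "summable (\<lambda>n. cmod (c n * e n \<zeta>))"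
    proof (rule summable_comparison_test'[OF c, of 0])
      show "norm (cmod (c n * e n \<zeta>)) \<le> cmod (c n)" for n
        using e(2)[OF that, of n] by (simp add: norm_mult mult_left_le)
    qed
    then show "summable (\<lambda>n. c n * e n \<zeta>)" by (rule summable_norm_cancel)
  qed
  have "(\<lambda>n. LINT \<zeta>|circle_measure. c n * e n \<zeta> * h \<zeta>) sums (LINT \<zeta>|circle_measure. (\<Sum>n. c n * e n \<zeta> * h \<zeta>))"
  proof (rule sums_integral[OF i])
    show "AE \<zeta> in circle_measure. summable (\<lambda>n. norm (c n * e n \<zeta> * h \<zeta>))"
      using AE_circle_norm
    proof eventually_elim
      case (elim \<zeta>)
      from summable_mult2[OF sc(2)[OF this], of "cmod (h \<zeta>)"] show ?case by (simp add: norm_mult)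
    qed
    show "summable (\<lambda>n. LINT \<zeta>|circle_measure. norm (c n * e n \<zeta> * h \<zeta>))"
    proof (rule summable_comparison_test'[where N=0])
      show "summable (\<lambda>n. cmod (c n) * (LINT \<zeta>|circle_measure. cmod (h \<zeta>)))"
        by (rule summable_mult2[OF c])
      fix n
      have "(LINT \<zeta>|circle_measure. norm (c n * e n \<zeta> * h \<zeta>)) \<le> (LINT \<zeta>|circle_measure. cmod (c n) * cmod (h \<zeta>))"
        using bound[of n] by (intro integral_mono_AE integrable_norm i ih) (simp add: norm_mult)
      then show "norm (LINT \<zeta>|circle_measure. norm (c n * e n \<zeta> * h \<zeta>)) \<le> cmod (c n) * (LINT \<zeta>|circle_measure. cmod (h \<zeta>))"
        by (simp add: integral_nonneg_AE)
    qed
  qed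
  also have "(LINT \<zeta>|circle_measure. (\<Sum>n. c n * e n \<zeta> * h \<zeta>)) = (LINT \<zeta>|circle_measure. (\<Sum>n. c n * e n \<zeta>) * h \<zeta>)"
    by (intro Bochner_Integration.integral_cong refl) (simp add: suminf_mult2[OF sc(1)])
  finally show ?thesis by (simp add: mult.assoc)
qed

lemma circle_integral_power:
  "(LINT \<zeta>|circle_measure. \<zeta> ^ n * cnj \<zeta> ^ m) = (if n = m then 1 else 0)"
proof -
  have mean: "(LINT \<zeta>|circle_measure. \<zeta> ^ k) = (if k = 0 then 1 else 0)" for k :: nat
    by (subst holomorphic_circle_mean[of _ 2]) (auto intro!: holomorphic_intros)
  have red: "\<zeta> ^ (j + k) * cnj \<zeta> ^ j = \<zeta> ^ k" if "\<zeta> \<in> space circle_measure" for \<zeta> :: complex and j k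
  proof -
    have "\<zeta> * cnj \<zeta> = 1" using that by (simp add: complex_norm_square[symmetric])
    then have "\<zeta> ^ j * cnj \<zeta> ^ j = 1" by (metis power_mult_distrib power_one)
    then show ?thesis by (simp add: power_add mult.assoc mult.left_commute)
  qed
  show ?thesis
  proof (cases "n \<ge> m")
    case True
    then obtain k where k: "n = m + k" by (metis le_add_diff_inverse)
    then have "(LINT \<zeta>|circle_measure. \<zeta> ^ n * cnj \<zeta> ^ m) = (LINT \<zeta>|circle_measure. \<zeta> ^ k)"
      by (intro Bochner_Integration.integral_cong refl) (simp only: red)
    then show ?thesis using mean k by simp
  next
    case False
    then obtain k where k: "m = n + k" by (metis le_add_diff_inverse nat_le_linear)
    then have "(LINT \<zeta>|circle_measure. \<zeta> ^ n * cnj \<zeta> ^ m) = (LINT \<zeta>|circle_measure. cnj (\<zeta> ^ m * cnj \<zeta> ^ n))"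
      by (simp add: mult.commute)
    also have "\<dots> = cnj (LINT \<zeta>|circle_measure. \<zeta> ^ k)"
      unfolding k by (subst Bochner_Integration.integral_cnj, intro arg_cong[where f=cnj] Bochner_Integration.integral_cong refl) (simp only: red)
    finally show ?thesis using mean[of k] k False by simp
  qed
qed

text \<open>
The inner product of two dilates depends only on the product of the radii. This is what makes the
dilates a Cauchy family in \<open>L\<^sup>2\<close> as soon as they are bounded.
\<close>

lemma holomorphic_circle_parseval:
  assumes a: "\<And>z. cmod z < 1 \<Longrightarrow> (\<lambda>n. a n * z ^ n) sums F z"
    and cont: "continuous_on (ball 0 1) F"
    and r: "0 \<le> r" "r < 1" and s: "0 \<le> s" "s < (1::real)"
  shows "(\<lambda>n. of_real ((cmod (a n))\<^sup>2 * (r * s) ^ n)) sums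
    (LINT \<zeta>|circle_measure. F (of_real r * \<zeta>) * cnj (F (of_real s * \<zeta>)))"
proof -
  have summ: "summable (\<lambda>n. cmod (a n * of_real t ^ n))" if "0 \<le> t" "t < 1" for t :: real
  proof -
    have "summable (\<lambda>n. a n * (complex_of_real ((1 + t) / 2)) ^ n)"
    proof (rule sums_summable[OF a])
      show "cmod (complex_of_real ((1 + t) / 2)) < 1" unfolding norm_of_real using that by simp
    qed
    then show ?thesis
      by (rule powser_insidea) (unfold norm_of_real, use that in simp)
  qed
  have val: "(\<Sum>n. (a n * of_real t ^ n) * \<zeta> ^ n) = F (of_real t * \<zeta>)" if "0 \<le> t" "t < 1" "cmod \<zeta> = 1" for t \<zeta>
    using sums_unique[OF a[of "of_real t * \<zeta>"]] that by (simp add: norm_mult power_mult_distrib mult.assoc)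
  have int: "integrable circle_measure (\<lambda>\<zeta>. F (of_real t * \<zeta>))" if "0 \<le> t" "t < 1" for t
  proof -
    have c: "continuous_on (sphere 0 1) (\<lambda>\<zeta>. F (of_real t * \<zeta>))"
      using that by (intro continuous_on_compose2[OF cont] continuous_intros) (auto simp: norm_mult)
    then have "compact ((\<lambda>\<zeta>. F (of_real t * \<zeta>)) ` sphere 0 1)"
      by (rule compact_continuous_image) simp
    then obtain B where "\<forall>x\<in>(\<lambda>\<zeta>. F (of_real t * \<zeta>)) ` sphere 0 1. norm x \<le> B"
      using compact_imp_bounded bounded_iff by metis
    then show ?thesis
      using AE_circle_norm
      by (intro integrable_circle_bounded[of _ B] continuous_on_circle_measurable[OF c])
         (auto elim!: eventually_mono)
  qed
  have coeff: "(LINT \<zeta>|circle_measure. F (of_real t * \<zeta>) * cnj \<zeta> ^ m) = a m * of_real t ^ m"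
    if "0 \<le> t" "t < 1" for t m
  proof -
    have "(\<lambda>n. (a n * of_real t ^ n) * (LINT \<zeta>|circle_measure. \<zeta> ^ n * cnj \<zeta> ^ m)) sums
      (LINT \<zeta>|circle_measure. (\<Sum>n. (a n * of_real t ^ n) * \<zeta> ^ n) * cnj \<zeta> ^ m)"
    proof (rule circle_integral_series[OF summ[OF that]])
      have "continuous_on (sphere 0 1) (\<lambda>\<zeta>. cnj \<zeta> ^ m)" by (intro continuous_intros)
      then show "integrable circle_measure (\<lambda>\<zeta>. cnj \<zeta> ^ m)"
        using AE_circle_norm
        by (intro integrable_circle_bounded[of _ 1] continuous_on_circle_measurable)
           (auto elim!: eventually_mono simp: norm_power)
    qed (auto simp: norm_power intro!: continuous_on_circle_measurable continuous_intros)
    also have "(\<lambda>n. (a n * of_real t ^ n) * (LINT \<zeta>|circle_measure. \<zeta> ^ n * cnj \<zeta> ^ m)) =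
      (\<lambda>n. if n = m then a n * of_real t ^ n else 0)"
      by (auto simp: circle_integral_power)
    finally have "(\<lambda>n. if n = m then a n * of_real t ^ n else 0) sums
      (LINT \<zeta>|circle_measure. (\<Sum>n. (a n * of_real t ^ n) * \<zeta> ^ n) * cnj \<zeta> ^ m)" .
    then have "(LINT \<zeta>|circle_measure. (\<Sum>n. (a n * of_real t ^ n) * \<zeta> ^ n) * cnj \<zeta> ^ m) = a m * of_real t ^ m"
      using sums_single[of m "\<lambda>n. a n * of_real t ^ n"] by (rule sums_unique2)
    moreover have "(LINT \<zeta>|circle_measure. (\<Sum>n. (a n * of_real t ^ n) * \<zeta> ^ n) * cnj \<zeta> ^ m)
      = (LINT \<zeta>|circle_measure. F (of_real t * \<zeta>) * cnj \<zeta> ^ m)"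
      using val[OF that] by (intro Bochner_Integration.integral_cong refl) simp
    ultimately show ?thesis by simp
  qed
  have "(\<lambda>n. (a n * of_real r ^ n) * (LINT \<zeta>|circle_measure. \<zeta> ^ n * cnj (F (of_real s * \<zeta>)))) sums
      (LINT \<zeta>|circle_measure. (\<Sum>n. (a n * of_real r ^ n) * \<zeta> ^ n) * cnj (F (of_real s * \<zeta>)))"
    using int[OF s] by (intro circle_integral_series[OF summ[OF r]])
      (auto simp: norm_power intro!: continuous_on_circle_measurable continuous_intros)
  also have "(LINT \<zeta>|circle_measure. (\<Sum>n. (a n * of_real r ^ n) * \<zeta> ^ n) * cnj (F (of_real s * \<zeta>)))
    = (LINT \<zeta>|circle_measure. F (of_real r * \<zeta>) * cnj (F (of_real s * \<zeta>)))"
    using val[OF r] by (intro Bochner_Integration.integral_cong refl) simp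
  also have "(\<lambda>n. (a n * of_real r ^ n) * (LINT \<zeta>|circle_measure. \<zeta> ^ n * cnj (F (of_real s * \<zeta>))))
    = (\<lambda>n. of_real ((cmod (a n))\<^sup>2 * (r * s) ^ n))"
  proof
    fix n
    have "(LINT \<zeta>|circle_measure. \<zeta> ^ n * cnj (F (of_real s * \<zeta>)))
      = (LINT \<zeta>|circle_measure. cnj (F (of_real s * \<zeta>) * cnj \<zeta> ^ n))"
      by (simp add: mult.commute)
    also have "\<dots> = cnj (a n * of_real s ^ n)" unfolding Bochner_Integration.integral_cnj coeff[OF s] ..
    finally have e: "(LINT \<zeta>|circle_measure. \<zeta> ^ n * cnj (F (of_real s * \<zeta>))) = cnj (a n * of_real s ^ n)" .
    show "(a n * of_real r ^ n) * (LINT \<zeta>|circle_measure. \<zeta> ^ n * cnj (F (of_real s * \<zeta>)))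
      = of_real ((cmod (a n))\<^sup>2 * (r * s) ^ n)"
      unfolding e using complex_norm_square[of "a n"] by (simp add: power_mult_distrib)
  qed
  finally show ?thesis .
qed

text \<open>
If the increments are summable in \<open>L\<^sup>1\<close>, then the sum of their moduli is integrable, hence finite
almost everywhere.
\<close>

lemma AE_convergent_of_summable_integrals:
  fixes g :: "nat \<Rightarrow> complex \<Rightarrow> complex"
  assumes g: "\<And>k. integrable circle_measure (g k)"
    and s: "summable (\<lambda>k. LINT \<zeta>|circle_measure. cmod (g (Suc k) \<zeta> - g k \<zeta>))"
  shows "AE \<zeta> in circle_measure. convergent (\<lambda>k. g k \<zeta>)"
proof -
  have [measurable]: "g k \<in> borel_measurable circle_measure" for k using g by auto
  have "(\<integral>\<^sup>+\<zeta>. (\<Sum>k. ennreal (cmod (g (Suc k) \<zeta> - g k \<zeta>))) \<partial>circle_measure)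
    = (\<Sum>k. \<integral>\<^sup>+\<zeta>. ennreal (cmod (g (Suc k) \<zeta> - g k \<zeta>)) \<partial>circle_measure)"
    by (rule nn_integral_suminf) measurable
  also have "\<dots> = (\<Sum>k. ennreal (LINT \<zeta>|circle_measure. cmod (g (Suc k) \<zeta> - g k \<zeta>)))"
    using g by (intro suminf_cong nn_integral_eq_integral) auto
  also have "\<dots> = ennreal (\<Sum>k. LINT \<zeta>|circle_measure. cmod (g (Suc k) \<zeta> - g k \<zeta>))"
    using s by (intro suminf_ennreal2) auto
  finally have "(\<integral>\<^sup>+\<zeta>. (\<Sum>k. ennreal (cmod (g (Suc k) \<zeta> - g k \<zeta>))) \<partial>circle_measure) \<noteq> \<infinity>" by simp
  then have "AE \<zeta> in circle_measure. (\<Sum>k. ennreal (cmod (g (Suc k) \<zeta> - g k \<zeta>))) \<noteq> \<infinity>"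
    by (intro nn_integral_PInf_AE) auto
  then show ?thesis
  proof eventually_elim
    case (elim \<zeta>)
    then have "summable (\<lambda>k. cmod (g (Suc k) \<zeta> - g k \<zeta>))"
      by (intro summable_suminf_not_top) auto
    then have "summable (\<lambda>k. g (Suc k) \<zeta> - g k \<zeta>)" by (rule summable_norm_cancel)
    then have "convergent (\<lambda>n. g n \<zeta> - g 0 \<zeta>)"
      using sum_lessThan_telescope[of "\<lambda>k. g k \<zeta>"] by (simp add: summable_iff_convergent)
    then have "convergent (\<lambda>n. (g n \<zeta> - g 0 \<zeta>) + g 0 \<zeta>)" by (intro convergent_add convergent_const)
    then show ?case by simp
  qed
qed

text \<open>
Put \<open>A(t) = \<Sum>\<^sub>n |a\<^sub>n|\<^sup>2 t\<^sup>n\<close> with the Taylor coefficients \<open>a\<^sub>n\<close> of \<open>F\<close>. By Parseval the squared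
\<open>L\<^sup>2\<close>-distance of the dilates of radii \<open>r\<close>, \<open>s\<close> is \<open>A(r\<^sup>2) - 2 A(r s) + A(s\<^sup>2)\<close>. Since \<open>A\<close> is increasing
and bounded by \<open>C\<^sup>2\<close>, this is small for \<open>r\<close>, \<open>s\<close> close to \<open>1\<close>. Along suitable radii \<open>r\<^sub>k\<close> the dilates
thus converge almost everywhere; dominated convergence in \<open>F(r\<^sub>k z) = \<P>(F(r\<^sub>k \<cdot>))(z)\<close> identifies \<open>F\<close>
with the Poisson integral of the limit.
\<close>

theorem bounded_holomorphic_is_poisson:
  assumes F: "F holomorphic_on ball 0 1" and C: "\<And>z. cmod z < 1 \<Longrightarrow> cmod (F z) \<le> C"
  obtains f where "f \<in> borel_measurable circle_measure" "AE \<zeta> in circle_measure. cmod (f \<zeta>) \<le> C"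
    "\<And>z. cmod z < 1 \<Longrightarrow> poisson f z = F z"
proof -
  define a where "a = (\<lambda>n. (deriv ^^ n) F 0 / fact n)"
  have a: "(\<lambda>n. a n * z ^ n) sums F z" if "cmod z < 1" for z
    using holomorphic_power_series[OF F, of z] that by (simp add: a_def)
  have cont: "continuous_on (ball 0 1) F" using F by (rule holomorphic_on_imp_continuous_on)
  define dil where "dil = (\<lambda>(r::real) \<zeta>. F (of_real r * \<zeta>))"
  have dil_meas[measurable]: "dil r \<in> borel_measurable circle_measure" if "0 \<le> r" "r < 1" for r
    unfolding dil_def using that
    by (intro continuous_on_circle_measurable continuous_on_compose2[OF cont] continuous_intros) (auto simp: norm_mult)
  have dil_le: "cmod (dil r \<zeta>) \<le> C" if "0 \<le> r" "r < 1" "cmod \<zeta> = 1" for r \<zeta>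
    unfolding dil_def using that by (intro C) (simp add: norm_mult)
  have dil_AE: "AE \<zeta> in circle_measure. cmod (dil r \<zeta>) \<le> C" if "0 \<le> r" "r < 1" for r
    using AE_circle_norm by eventually_elim (rule dil_le[OF that])
  have int2: "integrable circle_measure (\<lambda>\<zeta>. dil r \<zeta> * cnj (dil s \<zeta>))"
    if "0 \<le> r" "r < 1" "0 \<le> s" "s < 1" for r s
  proof (rule integrable_circle_bounded)
    show "AE \<zeta> in circle_measure. cmod (dil r \<zeta> * cnj (dil s \<zeta>)) \<le> C * C"
      using dil_AE[OF that(1,2)] dil_AE[OF that(3,4)]
      by eventually_elim (auto simp: norm_mult intro!: mult_mono order_trans[OF norm_ge_zero])
  qed (use that in measurable)
  define A where "A = (\<lambda>t. \<Sum>n. (cmod (a n))\<^sup>2 * t ^ n)"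
  have A: "(\<lambda>n. (cmod (a n))\<^sup>2 * (r * s) ^ n) sums A (r * s)"
    "(LINT \<zeta>|circle_measure. dil r \<zeta> * cnj (dil s \<zeta>)) = of_real (A (r * s))"
    if "0 \<le> r" "r < 1" "0 \<le> s" "s < 1" for r s :: real
  proof -
    note P = holomorphic_circle_parseval[OF a cont that]
    have "(\<lambda>n. (cmod (a n))\<^sup>2 * (r * s) ^ n) sums Re (LINT \<zeta>|circle_measure. F (of_real r * \<zeta>) * cnj (F (of_real s * \<zeta>)))"
      using sums_Re[OF P] by simp
    then show S: "(\<lambda>n. (cmod (a n))\<^sup>2 * (r * s) ^ n) sums A (r * s)"
      by (auto simp: A_def sums_iff)
    show "(LINT \<zeta>|circle_measure. dil r \<zeta> * cnj (dil s \<zeta>)) = of_real (A (r * s))"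
      unfolding dil_def using sums_unique2[OF P sums_of_real[OF S]] .
  qed
  have A_mono: "A t \<le> A u" if "0 \<le> t" "t \<le> u" "u < 1" for t u
  proof -
    have t: "t = sqrt t * sqrt t" "0 \<le> sqrt t" "sqrt t < 1" using that by auto
    have u: "u = sqrt u * sqrt u" "0 \<le> sqrt u" "sqrt u < 1" using that by auto
    show ?thesis
    proof (rule sums_le)
      show "(\<lambda>n. (cmod (a n))\<^sup>2 * t ^ n) sums A t"
        using A(1)[OF t(2,3) t(2,3)] t(1)[symmetric] by metis
      show "(\<lambda>n. (cmod (a n))\<^sup>2 * u ^ n) sums A u"
        using A(1)[OF u(2,3) u(2,3)] u(1)[symmetric] by metis
      show "(cmod (a n))\<^sup>2 * t ^ n \<le> (cmod (a n))\<^sup>2 * u ^ n" for n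
        using that by (intro mult_left_mono power_mono) auto
    qed
  qed
  have sq: "cmod w ^ 2 = Re (w * cnj w)" for w using cmod_power2[of w] by (simp add: power2_eq_square)
  have dist_sq: "(LINT \<zeta>|circle_measure. (cmod (dil r \<zeta> - dil s \<zeta>))\<^sup>2) = A (r * r) - 2 * A (r * s) + A (s * s)"
    if "0 \<le> r" "r < 1" "0 \<le> s" "s < 1" for r s
  proof -
    have "(LINT \<zeta>|circle_measure. (cmod (dil r \<zeta> - dil s \<zeta>))\<^sup>2) =
      (LINT \<zeta>|circle_measure. Re (dil r \<zeta> * cnj (dil r \<zeta>) - dil r \<zeta> * cnj (dil s \<zeta>) - dil s \<zeta> * cnj (dil r \<zeta>) + dil s \<zeta> * cnj (dil s \<zeta>)))"
      unfolding sq by (simp add: algebra_simps)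
    also have "\<dots> = Re (LINT \<zeta>|circle_measure. dil r \<zeta> * cnj (dil r \<zeta>) - dil r \<zeta> * cnj (dil s \<zeta>) - dil s \<zeta> * cnj (dil r \<zeta>) + dil s \<zeta> * cnj (dil s \<zeta>))"
      using that by (intro integral_Re Bochner_Integration.integrable_add Bochner_Integration.integrable_diff int2)
    also have "\<dots> = A (r * r) - 2 * A (r * s) + A (s * s)"
      using that by (simp add: int2 A(2) mult.commute[of s r] Bochner_Integration.integrable_diff)
    finally show ?thesis .
  qed
  have A_le: "A (r * r) \<le> C\<^sup>2" if "0 \<le> r" "r < 1" for r
  proof -
    have "A (r * r) = (LINT \<zeta>|circle_measure. Re (dil r \<zeta> * cnj (dil r \<zeta>)))"
      using integral_Re[OF int2[OF that that]] A(2)[OF that that] by simp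
    also have "\<dots> \<le> (LINT \<zeta>|circle_measure. C\<^sup>2)"
    proof (rule integral_mono_AE)
      show "integrable circle_measure (\<lambda>\<zeta>. Re (dil r \<zeta> * cnj (dil r \<zeta>)))"
        using int2[OF that that] by (rule integrable_Re)
      show "AE \<zeta> in circle_measure. Re (dil r \<zeta> * cnj (dil r \<zeta>)) \<le> C\<^sup>2"
        using dil_AE[OF that] unfolding sq[symmetric] by eventually_elim (auto intro: power_mono)
    qed simp
    finally show ?thesis using circle.prob_space by simp
  qed
  define L where "L = (SUP r\<in>{0..<1}. A (r * r))"
  have bdd: "bdd_above ((\<lambda>r. A (r * r)) ` {0..<1})" using A_le by (intro bdd_aboveI[of _ "C\<^sup>2"]) auto
  have AL: "A (r * r) \<le> L" if "0 \<le> r" "r < 1" for r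
    unfolding L_def using that by (intro cSUP_upper bdd) auto
  (* the first condition forces admissible radii r k to tend to 1; the rate (1/4)^k for the
     squared L^2 distances makes the L^1 distances summable *)
  define good where "good = (\<lambda>k::nat. \<lambda>r::real. 1 - 1 / real (k + 2) \<le> r \<and> r < 1 \<and> L - (1/4)^k < A (r * r))"
  have ex: "\<exists>s\<ge>r. good k s" if "0 \<le> r" "r < 1" for k r
  proof -
    have "L - (1/4)^k < L" by simp
    then obtain \<rho> where \<rho>: "0 \<le> \<rho>" "\<rho> < 1" "L - (1/4)^k < A (\<rho> * \<rho>)"
      unfolding L_def using bdd by (subst (asm) less_cSUP_iff) auto
    define s where "s = max r (max \<rho> (1 - 1 / real (k + 2)))"
    have s: "r \<le> s" "\<rho> \<le> s" "1 - 1 / real (k + 2) \<le> s" "s < 1" using that \<rho> by (auto simp: s_def)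
    have "A (\<rho> * \<rho>) \<le> A (s * s)"
      using s \<rho> mult_strict_mono[of s 1 s 1] by (intro A_mono mult_mono) auto
    then show ?thesis using s \<rho> by (auto simp: good_def)
  qed
  have good_pos: "0 < r" if "good k r" for k r
  proof -
    have "1 / real (k + 2) < 1" by simp
    then show ?thesis using that unfolding good_def by linarith
  qed
  obtain r where r: "\<And>k. good k (r k)" "\<And>k. r k \<le> r (Suc k)"
  proof -
    have "\<exists>f. \<forall>n. good n (f n) \<and> f n \<le> f (Suc n)"
    proof (rule dependent_nat_choice)
      show "\<exists>x. good 0 x" using ex[of 0 0] by auto
      show "\<exists>y. good (Suc n) y \<and> x \<le> y" if "good n x" for x n
        using ex[of x "Suc n"] good_pos[OF that] that by (auto simp: good_def)
    qed
    then show ?thesis using that by blast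
  qed
  have r01: "0 < r k" "r k < 1" for k using r(1)[of k] good_pos[of k "r k"] by (auto simp: good_def)
  have r_lim: "r \<longlonglongrightarrow> 1"
  proof (rule tendsto_sandwich[of "\<lambda>k. 1 - 1 / real (k + 2)" _ _ "\<lambda>_. 1"])
    show "(\<lambda>k. 1 - 1 / real (k + 2)) \<longlonglongrightarrow> 1"
      using tendsto_diff[OF tendsto_const[of "1::real"] LIMSEQ_ignore_initial_segment[OF lim_1_over_n, of 2]] by simp
  qed (use r(1) r01 in \<open>auto simp: good_def less_imp_le\<close>)
  have L1: "(LINT \<zeta>|circle_measure. cmod (dil (r (Suc k)) \<zeta> - dil (r k) \<zeta>)) \<le> 2 * (1/2)^k" for k
  proof -
    let ?D = "\<lambda>\<zeta>. cmod (dil (r (Suc k)) \<zeta> - dil (r k) \<zeta>)"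
    have rk: "0 \<le> r k" "r k < 1" "0 \<le> r (Suc k)" "r (Suc k) < 1" using r01 less_imp_le by blast+
    have D_AE: "AE \<zeta> in circle_measure. ?D \<zeta> \<le> 2 * C"
      using dil_AE[OF rk(1,2)] dil_AE[OF rk(3,4)]
      by eventually_elim (rule order_trans[OF norm_triangle_ineq4], simp)
    have D_meas: "?D \<in> borel_measurable circle_measure" using rk by measurable
    have iD: "integrable circle_measure ?D"
      using D_AE D_meas by (intro integrable_circle_bounded[of _ "2 * C"]) auto
    have iD2: "integrable circle_measure (\<lambda>\<zeta>. (?D \<zeta>)\<^sup>2)"
    proof (rule integrable_circle_bounded)
      show "AE \<zeta> in circle_measure. norm ((?D \<zeta>)\<^sup>2) \<le> (2 * C)\<^sup>2"
        using D_AE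
      proof eventually_elim
        case (elim \<zeta>)
        show ?case using power_mono[OF elim norm_ge_zero, of 2] by simp
      qed
    qed (use D_meas in measurable)
    have "r k * r k \<le> r (Suc k) * r k" using rk r(2)[of k] by (intro mult_right_mono) auto
    moreover have "r (Suc k) * r k < 1" using rk mult_strict_mono[of "r (Suc k)" 1 "r k" 1] by auto
    ultimately have "A (r k * r k) \<le> A (r (Suc k) * r k)" using rk by (intro A_mono) auto
    then have "(LINT \<zeta>|circle_measure. (?D \<zeta>)\<^sup>2) \<le> 2 * (1/4)^k"
      using dist_sq[OF rk(3,4,1,2)] AL[OF rk(1,2)] AL[OF rk(3,4)] r(1)[of k] by (simp add: good_def)
    moreover have "(LINT \<zeta>|circle_measure. ?D \<zeta>) \<le> (LINT \<zeta>|circle_measure. (1/2)^k + 2^k * (?D \<zeta>)\<^sup>2 / 2)"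
    proof (rule integral_mono)
      fix \<zeta>
      define x where "x = ?D \<zeta>"
      (* an elementary substitute for the Cauchy-Schwarz inequality, with weights adapted to the
         size (1/4)^k of the mean square *)
      have "0 \<le> (2^k * x - 1)\<^sup>2" by simp
      then have "2 * (2^k * x) \<le> 1 + 2^k * 2^k * x\<^sup>2"
        by (simp add: power2_eq_square algebra_simps)
      then have "(1/2)^k * (2 * (2^k * x)) \<le> (1/2)^k * (1 + 2^k * 2^k * x\<^sup>2)" by (rule mult_left_mono) simp
      moreover have h: "(1/2)^k * (2::real)^k = 1" by (simp flip: power_mult_distrib)
      have cancel: "c * (2 * (d * x)) = 2 * x" "c * (1 + d * d * x\<^sup>2) = c + d * x\<^sup>2"
        if "c * d = 1" for c d :: real
        using that by algebra+
      ultimately have "2 * x \<le> (1/2)^k + 2^k * x\<^sup>2" unfolding cancel[OF h] by simp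
      then show "?D \<zeta> \<le> (1/2)^k + 2^k * (?D \<zeta>)\<^sup>2 / 2"
        unfolding x_def by (smt (verit) zero_le_power field_sum_of_halves divide_nonneg_nonneg)
    qed (use iD iD2 in auto)
    moreover have "(LINT \<zeta>|circle_measure. (1/2)^k + 2^k * (?D \<zeta>)\<^sup>2 / 2) = (1/2)^k + 2^k / 2 * (LINT \<zeta>|circle_measure. (?D \<zeta>)\<^sup>2)"
      using iD2 by simp
    moreover have "2^k / 2 * (2 * (1/4)^k) = (1/2::real)^k"
      by (simp add: power_divide field_simps flip: power_mult_distrib)
    ultimately show ?thesis
      using mult_left_mono[of "LINT \<zeta>|circle_measure. (?D \<zeta>)\<^sup>2" "2 * (1/4)^k" "2^k / 2"] by simp
  qed
  have conv: "AE \<zeta> in circle_measure. convergent (\<lambda>k. dil (r k) \<zeta>)"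
  proof (rule AE_convergent_of_summable_integrals)
    show "integrable circle_measure (dil (r k))" for k
      using r01[of k] dil_AE[of "r k"] by (intro integrable_circle_bounded[of _ C]) auto
    show "summable (\<lambda>k. LINT \<zeta>|circle_measure. cmod (dil (r (Suc k)) \<zeta> - dil (r k) \<zeta>))"
    proof (rule summable_comparison_test'[where N=0])
      show "summable (\<lambda>k. 2 * (1/2::real)^k)" by (intro summable_mult summable_geometric) simp
    qed (use L1 in simp)
  qed
  define f where "f = (\<lambda>\<zeta>. lim (\<lambda>k. dil (r k) \<zeta>))"
  have dm: "dil (r k) \<in> borel_measurable circle_measure" for k using r01[of k] by simp
  show ?thesis
  proof
    show fm: "f \<in> borel_measurable circle_measure"
      unfolding f_def using dm by (rule borel_measurable_lim_metric)
    have lim: "AE \<zeta> in circle_measure. (\<lambda>k. dil (r k) \<zeta>) \<longlonglongrightarrow> f \<zeta>"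
      using conv by eventually_elim (simp add: f_def convergent_LIMSEQ_iff)
    show "AE \<zeta> in circle_measure. cmod (f \<zeta>) \<le> C"
      using lim AE_circle_norm
    proof eventually_elim
      case (elim \<zeta>)
      have "cmod (dil (r k) \<zeta>) \<le> C" for k
        using dil_le[of "r k" \<zeta>] r01[of k] elim(2) by simp
      then show ?case by (intro LIMSEQ_le_const2[OF tendsto_norm[OF elim(1)]]) simp
    qed
    fix z :: complex assume z: "cmod z < 1"
    have "(\<lambda>k. poisson (dil (r k)) z) \<longlonglongrightarrow> poisson f z"
      using r01 by (intro poisson_tendsto[where C=C] dm fm lim dil_AE z) (auto intro: less_imp_le)
    moreover have "poisson (dil (r k)) z = F (of_real (r k) * z)" for k
    proof -
      have "poisson (dil (r k)) z = dil (r k) z"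
      proof (rule poisson_holomorphic[OF _ _ z])
        show "1 / r k > 1" using r01[of k] by simp
        show "dil (r k) holomorphic_on ball 0 (1 / r k)"
          unfolding dil_def using r01[of k]
          by (intro holomorphic_on_compose_gen[OF _ F, unfolded o_def] holomorphic_intros)
             (auto simp: norm_mult field_simps)
      qed
      then show ?thesis by (simp add: dil_def)
    qed
    moreover have "(\<lambda>k. F (of_real (r k) * z)) \<longlonglongrightarrow> F z"
    proof (rule isCont_tendsto_compose[of _ F])
      show "isCont F z"
        using cont z by (simp add: continuous_on_eq_continuous_at)
      have "(\<lambda>k. of_real (r k) * z) \<longlonglongrightarrow> of_real 1 * z"
        by (intro tendsto_intros r_lim)
      then show "(\<lambda>k. of_real (r k) * z) \<longlonglongrightarrow> z" by simp
    qed
    ultimately show "poisson f z = F z" using LIMSEQ_unique by simp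
  qed
qed

text \<open>
Existence of the radial limit is the Cauchy condition as \<open>r \<rightarrow> 1\<close>, which by continuity of \<open>F\<close> only has
to be tested on rational radii; so the set where the limit exists is Borel. On this set the boundary
value is the limit along a fixed sequence of radii, and elsewhere it is constant.
\<close>

lemma boundary_value_measurable:
  assumes "continuous_on (ball 0 1) F"
  shows "boundary_value F \<in> borel_measurable circle_measure"
proof -
  define Q where "Q = {q::rat. 0 < q \<and> q < 1}"
  have line: "continuous_on {0<..<1} (\<lambda>r::real. F (of_real r * \<zeta>))" if "cmod \<zeta> = 1" for \<zeta>
    using that by (intro continuous_on_compose2[OF assms] continuous_intros) (auto simp: norm_mult)
  have meas: "(\<lambda>\<zeta>. F (of_real r * \<zeta>)) \<in> borel_measurable circle_measure" if "0 < r" "r < 1" for r :: real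
    using that
    by (intro continuous_on_circle_measurable continuous_on_compose2[OF assms] continuous_intros) (auto simp: norm_mult)
  define osc where "osc = (\<lambda>k n \<zeta>. \<forall>p\<in>Q. \<forall>q\<in>Q. of_rat p > 1 - 1 / real (Suc n) \<longrightarrow> of_rat q > 1 - 1 / real (Suc n)
     \<longrightarrow> dist (F (of_real (of_rat p) * \<zeta>)) (F (of_real (of_rat q) * \<zeta>)) \<le> 1 / real (Suc k))"
  have iff: "(\<exists>l. ((\<lambda>r::real. F (of_real r * \<zeta>)) \<longlongrightarrow> l) (at_left 1)) \<longleftrightarrow> (\<forall>k. \<exists>n. osc k n \<zeta>)"
    if \<zeta>: "cmod \<zeta> = 1" for \<zeta>
  proof
    assume "\<exists>l. ((\<lambda>r::real. F (of_real r * \<zeta>)) \<longlongrightarrow> l) (at_left 1)"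
    then obtain l where l: "((\<lambda>r::real. F (of_real r * \<zeta>)) \<longlongrightarrow> l) (at_left 1)" ..
    show "\<forall>k. \<exists>n. osc k n \<zeta>"
    proof
      fix k
      have "\<forall>\<^sub>F r::real in at_left 1. dist (F (of_real r * \<zeta>)) l < 1 / real (Suc k) / 2"
        using l by (rule tendstoD) simp
      then obtain b :: real where b: "b < 1" "\<And>r. b < r \<Longrightarrow> r < 1 \<Longrightarrow> dist (F (of_real r * \<zeta>)) l < 1 / real (Suc k) / 2"
        unfolding eventually_at_left_field by auto
      obtain n where n: "1 / real (Suc n) < 1 - b" using b(1) nat_approx_posE[of "1 - b"] by auto
      have "osc k n \<zeta>"
        unfolding osc_def
      proof (intro ballI impI)
        fix p q assume pq: "p \<in> Q" "q \<in> Q" "1 - 1 / real (Suc n) < of_rat p" "1 - 1 / real (Suc n) < of_rat q"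
        have "b < of_rat p" "of_rat p < (1::real)" "b < of_rat q" "of_rat q < (1::real)"
          using pq n by (auto simp: Q_def)
        then show "dist (F (of_real (of_rat p) * \<zeta>)) (F (of_real (of_rat q) * \<zeta>)) \<le> 1 / real (Suc k)"
          using dist_triangle_half_l[OF b(2)[of "of_rat p"] b(2)[of "of_rat q"]] by simp
      qed
      then show "\<exists>n. osc k n \<zeta>" ..
    qed
  next
    assume osc: "\<forall>k. \<exists>n. osc k n \<zeta>"
    have real_osc: "dist (F (of_real r * \<zeta>)) (F (of_real s * \<zeta>)) \<le> 1 / real (Suc k)"
      if "osc k n \<zeta>" "1 - 1 / real (Suc n) < r" "r < 1" "1 - 1 / real (Suc n) < s" "s < 1" for k n r s
    proof (rule ccontr)
      assume "\<not> ?thesis"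
      then have gt: "1 / real (Suc k) < dist (F (of_real r * \<zeta>)) (F (of_real s * \<zeta>))" by simp
      have n01: "0 \<le> 1 - 1 / real (Suc n)" by simp
      define G where "G = (\<lambda>x::real \<times> real. dist (F (of_real (fst x) * \<zeta>)) (F (of_real (snd x) * \<zeta>)))"
      define I where "I = {1 - 1 / real (Suc n)<..<1}"
      have I01: "0 < x \<and> x < 1" if "x \<in> I" for x
        using that n01 unfolding I_def by (metis greaterThanLessThan_iff le_less_trans)
      have "continuous_on (I \<times> I) G"
        unfolding G_def using I01
        by (intro continuous_intros continuous_on_compose2[OF line[OF \<zeta>]]) auto
      moreover have "open (I \<times> I)" unfolding I_def by (intro open_Times) auto
      ultimately have "open (G -` {1 / real (Suc k)<..} \<inter> (I \<times> I))"
        by (intro continuous_on_open_vimage[THEN iffD1, rule_format]) auto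
      moreover have "(r, s) \<in> G -` {1 / real (Suc k)<..} \<inter> (I \<times> I)"
        using gt that by (simp add: G_def I_def)
      ultimately obtain U V where UV': "open U" "open V" "(r, s) \<in> U \<times> V"
        "U \<times> V \<subseteq> G -` {1 / real (Suc k)<..} \<inter> (I \<times> I)" by (rule open_prod_elim)
      then have UV: "open U" "open V" "r \<in> U" "s \<in> V"
        "U \<times> V \<subseteq> G -` {1 / real (Suc k)<..} \<inter> (I \<times> I)" by auto
      have rat: "\<exists>q::rat. of_rat q \<in> W" if "open W" "x \<in> W" for W and x :: real
      proof -
        obtain e where "e > 0" "ball x e \<subseteq> W" using \<open>open W\<close> \<open>x \<in> W\<close> by (rule openE)
        moreover obtain q where "x < of_rat q" "of_rat q < x + e" using of_rat_dense[of x "x + e"] \<open>e > 0\<close> by auto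
        ultimately have "of_rat q \<in> W" by (auto simp: dist_real_def subset_iff)
        then show ?thesis ..
      qed
      obtain p q where pq: "of_rat p \<in> U" "of_rat q \<in> V" using rat[OF UV(1,3)] rat[OF UV(2,4)] by blast
      then have in_UV: "(of_rat p, of_rat q) \<in> G -` {1 / real (Suc k)<..} \<inter> (I \<times> I)" using UV(5) by blast
      then have "of_rat p \<in> I" "of_rat q \<in> I" by auto
      moreover have "0 < p \<and> p < 1" if "of_rat p \<in> I" for p
        using I01[OF that] by simp
      ultimately have "G (of_rat p, of_rat q) \<le> 1 / real (Suc k)"
        using \<open>osc k n \<zeta>\<close> unfolding osc_def G_def Q_def I_def by simp
      then show False using in_UV by simp
    qed
    define s where "s = (\<lambda>n::nat. 1 - 1 / real (n + 2))"
    have s: "s n < 1" "1 - 1 / real (Suc m) < s n" if "n \<ge> m" for n m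
      using that by (auto simp: s_def intro!: divide_strict_left_mono)
    have "Cauchy (\<lambda>n. F (of_real (s n) * \<zeta>))"
      unfolding Cauchy_altdef2
    proof (intro allI impI)
      fix e :: real assume "e > 0"
      then obtain k where k: "1 / real (Suc k) < e" using nat_approx_posE by blast
      obtain n where n: "osc k n \<zeta>" using osc by blast
      have "dist (F (of_real (s m) * \<zeta>)) (F (of_real (s n) * \<zeta>)) < e" if "m \<ge> n" for m
        using real_osc[OF n s(2)[OF that] s(1)[OF that] s(2)[of n n] s(1)[of n n]] k by simp
      then show "\<exists>N. \<forall>n\<ge>N. dist (F (of_real (s n) * \<zeta>)) (F (of_real (s N) * \<zeta>)) < e" by blast
    qed
    then obtain l where l: "(\<lambda>n. F (of_real (s n) * \<zeta>)) \<longlonglongrightarrow> l"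
      using Cauchy_convergent convergent_def by blast
    have "((\<lambda>r::real. F (of_real r * \<zeta>)) \<longlongrightarrow> l) (at_left 1)"
    proof (rule tendstoI)
      fix e :: real assume "e > 0"
      then obtain k where k: "1 / real (Suc k) < e" using nat_approx_posE by blast
      obtain n where n: "osc k n \<zeta>" using osc by blast
      show "\<forall>\<^sub>F r in at_left 1. dist (F (of_real r * \<zeta>)) l < e"
      proof (rule eventually_at_leftI[of "1 - 1 / real (Suc n)"])
        fix r assume r: "r \<in> {1 - 1 / real (Suc n)<..<1}"
        have "dist (F (of_real r * \<zeta>)) l \<le> 1 / real (Suc k)"
        proof (rule LIMSEQ_le_const2[OF tendsto_dist[OF tendsto_const l]])
          show "\<exists>N. \<forall>m\<ge>N. dist (F (of_real r * \<zeta>)) (F (of_real (s m) * \<zeta>)) \<le> 1 / real (Suc k)"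
            using r s by (intro exI[of _ n] allI impI real_osc[OF n]) auto
        qed
        then show "dist (F (of_real r * \<zeta>)) l < e" using k by simp
      qed simp
    qed
    then show "\<exists>l. ((\<lambda>r::real. F (of_real r * \<zeta>)) \<longlongrightarrow> l) (at_left 1)" ..
  qed
  have [measurable]: "Measurable.pred circle_measure (osc k n)" for k n
  proof -
    have "Measurable.pred circle_measure (\<lambda>\<zeta>. dist (F (of_real (of_rat p) * \<zeta>)) (F (of_real (of_rat q) * \<zeta>)) \<le> 1 / real (Suc k))"
      if "p \<in> Q" "q \<in> Q" for p q
    proof -
      have [measurable]: "(\<lambda>\<zeta>. F (of_real (of_rat p) * \<zeta>)) \<in> borel_measurable circle_measure"
        "(\<lambda>\<zeta>. F (of_real (of_rat q) * \<zeta>)) \<in> borel_measurable circle_measure"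
        using that by (auto simp: Q_def intro!: meas)
      show ?thesis by measurable
    qed
    then show ?thesis
      unfolding osc_def by (intro pred_intros_countable_bounded(3) pred_intros_imp' pred_intros_countable) auto
  qed
  define s where "s = (\<lambda>n::nat. 1 - 1 / real (n + 2))"
  have s: "0 < s n" "s n < 1" for n by (auto simp: s_def)
  have s_lim: "filterlim s (at_left 1) sequentially"
    unfolding filterlim_at
  proof
    show "s \<longlonglongrightarrow> 1"
      unfolding s_def using tendsto_diff[OF tendsto_const[of "1::real"] LIMSEQ_ignore_initial_segment[OF lim_1_over_n, of 2]] by simp
    show "\<forall>\<^sub>F n in sequentially. s n \<in> {..<1} \<and> s n \<noteq> 1"
      using s(2) by (intro always_eventually) (auto simp: less_imp_neq)
  qed
  have eq: "boundary_value F \<zeta> = (if \<forall>k. \<exists>n. osc k n \<zeta> then lim (\<lambda>n. F (of_real (s n) * \<zeta>)) else (THE l. False))"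
    if "\<zeta> \<in> space circle_measure" for \<zeta>
  proof (cases "\<forall>k. \<exists>n. osc k n \<zeta>")
    case True
    have "\<exists>l. ((\<lambda>r::real. F (of_real r * \<zeta>)) \<longlongrightarrow> l) (at_left 1)"
      using iff[of \<zeta>] that True by simp
    then obtain l where l: "((\<lambda>r::real. F (of_real r * \<zeta>)) \<longlongrightarrow> l) (at_left 1)" ..
    have "boundary_value F \<zeta> = l"
      unfolding boundary_value_def using l by (intro tendsto_Lim) auto
    moreover have "lim (\<lambda>n. F (of_real (s n) * \<zeta>)) = l"
      using filterlim_compose[OF l s_lim] by (rule limI)
    ultimately show ?thesis using True by simp
  next
    case False
    then have "\<not> ((\<lambda>r::real. F (of_real r * \<zeta>)) \<longlongrightarrow> l) (at_left 1)" for l using iff[of \<zeta>] that by auto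
    then have "boundary_value F \<zeta> = (THE l. False)"
      by (simp add: boundary_value_def Topological_Spaces.Lim_def)
    then show ?thesis using False by auto
  qed
  have [measurable]: "(\<lambda>\<zeta>. lim (\<lambda>n. F (of_real (s n) * \<zeta>))) \<in> borel_measurable circle_measure"
    using meas[OF s] by (rule borel_measurable_lim_metric)
  have m: "(\<lambda>\<zeta>. if \<forall>k. \<exists>n. osc k n \<zeta> then lim (\<lambda>n. F (of_real (s n) * \<zeta>)) else (THE l. False)) \<in> borel_measurable circle_measure"
    by measurable
  show ?thesis by (rule measurable_cong[OF eq, THEN iffD2, OF _ m])
qed

text \<open>
\<open>F\<close> is the Poisson integral of a bounded \<open>f\<close>, and Poisson integrals of bounded functions have radial
limits almost everywhere; so the radial limits of \<open>F\<close> are \<open>f\<close>.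
\<close>

theorem bounded_holomorphic_boundary:
  assumes F: "F holomorphic_on ball 0 1" and C: "\<And>z. cmod z < 1 \<Longrightarrow> cmod (F z) \<le> C"
  shows "boundary_value F \<in> borel_measurable circle_measure"
    and "AE \<zeta> in circle_measure. ((\<lambda>r. F (of_real r * \<zeta>)) \<longlongrightarrow> boundary_value F \<zeta>) (at_left 1)"
    and "AE \<zeta> in circle_measure. cmod (boundary_value F \<zeta>) \<le> C"
    and "cmod z < 1 \<Longrightarrow> poisson (boundary_value F) z = F z"
proof -
  show m: "boundary_value F \<in> borel_measurable circle_measure"
    by (rule boundary_value_measurable[OF holomorphic_on_imp_continuous_on[OF F]])
  obtain f where f: "f \<in> borel_measurable circle_measure" "AE \<zeta> in circle_measure. cmod (f \<zeta>) \<le> C"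
    "\<And>z. cmod z < 1 \<Longrightarrow> poisson f z = F z"
    using bounded_holomorphic_is_poisson[OF F C] by blast
  have "AE \<zeta> in circle_measure. ((\<lambda>r. F (of_real r * \<zeta>)) \<longlongrightarrow> f \<zeta>) (at_left 1)"
    using poisson_radial_limit[OF f(1,2)] AE_circle_norm
  proof eventually_elim
    case (elim \<zeta>)
    have "\<forall>\<^sub>F r::real in at_left 1. poisson f (of_real r * \<zeta>) = F (of_real r * \<zeta>)"
      by (rule eventually_at_leftI[of 0]) (use elim(2) in \<open>auto intro!: f(3) simp: norm_mult\<close>)
    then show ?case using elim(1) by (simp add: tendsto_cong)
  qed
  then have lim: "AE \<zeta> in circle_measure. ((\<lambda>r. F (of_real r * \<zeta>)) \<longlongrightarrow> f \<zeta>) (at_left 1) \<and> boundary_value F \<zeta> = f \<zeta>"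
    by eventually_elim (auto simp: boundary_value_def intro: tendsto_Lim)
  then show "AE \<zeta> in circle_measure. ((\<lambda>r. F (of_real r * \<zeta>)) \<longlongrightarrow> boundary_value F \<zeta>) (at_left 1)"
    by eventually_elim auto
  show "AE \<zeta> in circle_measure. cmod (boundary_value F \<zeta>) \<le> C"
    using lim f(2) by eventually_elim auto
  assume "cmod z < 1"
  moreover have "AE \<zeta> in circle_measure. boundary_value F \<zeta> = f \<zeta>" using lim by eventually_elim auto
  ultimately show "poisson (boundary_value F) z = F z"
    using f(3) poisson_cong_AE[OF m f(1)] by simp
qed

lemma poisson_of_radial_limit:
  assumes F: "F holomorphic_on ball 0 1" "\<And>z. cmod z < 1 \<Longrightarrow> cmod (F z) \<le> C"
    and g: "g \<in> borel_measurable circle_measure"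
    and lim: "AE \<zeta> in circle_measure. ((\<lambda>r. F (of_real r * \<zeta>)) \<longlongrightarrow> g \<zeta>) (at_left 1)"
    and z: "cmod z < 1"
  shows "poisson g z = F z"
proof -
  have "AE \<zeta> in circle_measure. g \<zeta> = boundary_value F \<zeta>"
    using lim by eventually_elim (auto simp: boundary_value_def intro!: tendsto_Lim[symmetric])
  from poisson_cong_AE[OF g bounded_holomorphic_boundary(1)[OF F] this]
  have "poisson g z = poisson (boundary_value F) z" .
  then show ?thesis using bounded_holomorphic_boundary(4)[OF F z] by simp
qed

section \<open>Blaschke products\<close>

lemma blaschke_denominator_nonzero:
  assumes "cmod a < 1" "cmod z \<le> 1" shows "1 - cnj a * z \<noteq> 0"
proof
  assume "1 - cnj a * z = 0"
  then have "cmod a * cmod z = 1" by (metis complex_mod_cnj eq_iff_diff_eq_0 norm_mult norm_one)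
  moreover have "cmod a * cmod z \<le> cmod a * 1" using assms by (intro mult_left_mono) auto
  ultimately show False using assms by simp
qed

lemma blaschke_factor_holomorphic:
  assumes "cmod a < 1" shows "blaschke_factor a holomorphic_on ball 0 1"
proof -
  have "1 - cnj a * z \<noteq> 0" if "z \<in> ball 0 1" for z
    using that by (intro blaschke_denominator_nonzero assms) auto
  then show ?thesis unfolding blaschke_factor_def by (intro holomorphic_intros) auto
qed

lemma norm_blaschke_factor:
  "cmod (blaschke_factor a z) = cmod (a - z) / cmod (1 - cnj a * z)"
  by (simp add: blaschke_factor_def norm_mult norm_divide)

lemma norm_blaschke_factor_le:
  assumes "cmod a < 1" "cmod z < 1" shows "cmod (blaschke_factor a z) \<le> 1"
  using Moebius_function_norm_lt_1[of a z 0] assms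
  by (simp add: norm_blaschke_factor Moebius_function_def norm_divide norm_minus_commute)

lemma norm_one_minus_blaschke_factor_le:
  assumes a: "cmod a < 1" and z: "cmod z < 1"
  shows "cmod (1 - blaschke_factor a z) \<le> (1 + cmod z) / (1 - cmod z) * (1 - cmod a)"
proof (cases "a = 0")
  case True
  have "cmod (1 - z) \<le> 1 + cmod z" using norm_triangle_ineq4[of 1 z] by simp
  also have "\<dots> \<le> (1 + cmod z) / (1 - cmod z)" using z by (simp add: field_simps)
  finally show ?thesis using True by (simp add: blaschke_factor_def)
next
  case False
  have nz: "1 - cnj a * z \<noteq> 0" using assms by (intro blaschke_denominator_nonzero) auto
  have sq: "a * cnj a = of_real (cmod a) * of_real (cmod a)"
    using complex_norm_square[of a] by (simp add: power2_eq_square)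
  have "a * (1 - cnj a * z) - of_real (cmod a) * (a - z) = (1 - of_real (cmod a)) * (a + of_real (cmod a) * z)"
    using sq by (simp add: algebra_simps)
  moreover have "1 - blaschke_factor a z = (a * (1 - cnj a * z) - of_real (cmod a) * (a - z)) / (a * (1 - cnj a * z))"
    using False nz by (simp add: blaschke_factor_def field_simps)
  ultimately have e: "1 - blaschke_factor a z = (1 - of_real (cmod a)) * (a + of_real (cmod a) * z) / (a * (1 - cnj a * z))"
    by simp
  have "cmod (1 - blaschke_factor a z) = (1 - cmod a) * cmod (a + of_real (cmod a) * z) / (cmod a * cmod (1 - cnj a * z))"
  proof -
    have "cmod (1 - of_real (cmod a)) = 1 - cmod a"
      using a norm_of_real[of "1 - cmod a", where 'a=complex] by simp
    then show ?thesis using e by (simp only: norm_mult norm_divide norm_of_real abs_norm_cancel)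
  qed
  also have "\<dots> \<le> (1 - cmod a) * (cmod a * (1 + cmod z)) / (cmod a * (1 - cmod z))"
  proof (rule frac_le)
    have "cmod (a + of_real (cmod a) * z) \<le> cmod a * (1 + cmod z)"
      using norm_triangle_ineq[of a "of_real (cmod a) * z"] by (simp add: norm_mult algebra_simps)
    then show "(1 - cmod a) * cmod (a + of_real (cmod a) * z) \<le> (1 - cmod a) * (cmod a * (1 + cmod z))"
      using a by (intro mult_left_mono) auto
    have "1 - cmod z \<le> 1 - cmod a * cmod z" using a mult_right_mono[of "cmod a" 1 "cmod z"] by simp
    also have "\<dots> \<le> cmod (1 - cnj a * z)" using norm_triangle_ineq2[of 1 "cnj a * z"] by (simp add: norm_mult)
    finally show "cmod a * (1 - cmod z) \<le> cmod a * cmod (1 - cnj a * z)" by (intro mult_left_mono) auto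
  qed (use a z False in auto)
  also have "\<dots> = (1 + cmod z) / (1 - cmod z) * (1 - cmod a)" using False by simp
  finally show ?thesis .
qed

text \<open>
A Blaschke factor is unimodular on the circle, as \<open>|1 - cnj a * \<zeta>| = |a - \<zeta>|\<close> there.
\<close>

lemma blaschke_factor_radial:
  assumes "cmod a < 1" "cmod \<zeta> = 1"
  shows "((\<lambda>r. cmod (blaschke_factor a (of_real r * \<zeta>))) \<longlongrightarrow> 1) (at_left 1)"
proof -
  have nz: "1 - cnj a * \<zeta> \<noteq> 0" using assms by (intro blaschke_denominator_nonzero) auto
  have "((\<lambda>r::real. cmod (a - of_real r * \<zeta>) / cmod (1 - cnj a * (of_real r * \<zeta>))) \<longlongrightarrow>
     cmod (a - of_real 1 * \<zeta>) / cmod (1 - cnj a * (of_real 1 * \<zeta>))) (at_left 1)"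
    using nz by (intro tendsto_intros) auto
  moreover have "cmod (1 - cnj a * \<zeta>) = cmod (a - \<zeta>)"
  proof -
    have "\<zeta> * cnj \<zeta> = 1" using assms by (simp add: complex_norm_square[symmetric])
    then have "1 - cnj a * \<zeta> = \<zeta> * cnj (\<zeta> - a)" by (simp add: algebra_simps)
    then show ?thesis using assms by (metis complex_mod_cnj mult_1 norm_minus_commute norm_mult)
  qed
  moreover from this have "a \<noteq> \<zeta>" using nz by auto
  ultimately show ?thesis by (simp add: norm_blaschke_factor)
qed

text \<open>
Infinite products of functions on the disc that are bounded by \<open>1\<close> and close to \<open>1\<close>, with an error summable locally
uniformly. The statement covers a Blaschke product and all its tails at once. The last part is
the inequality \<open>\<Prod>(1 - d\<^sub>j) \<ge> 1 - \<Sum> d\<^sub>j\<close> of Weierstrass; it shows that the tails tend to \<open>1\<close> in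
modulus at the origin.
\<close>

lemma disc_product:
  fixes b :: "nat \<Rightarrow> complex \<Rightarrow> complex"
  assumes hol: "\<And>j. b j holomorphic_on ball 0 1"
    and le1: "\<And>j z. cmod z < 1 \<Longrightarrow> cmod (b j z) \<le> 1"
    and near1: "\<And>j z. cmod z < 1 \<Longrightarrow> cmod (1 - b j z) \<le> (1 + cmod z) / (1 - cmod z) * d j"
    and d: "summable d"
  shows disc_product_LIMSEQ: "cmod z < 1 \<Longrightarrow> (\<lambda>n. \<Prod>j<n. b j z) \<longlonglongrightarrow> (\<Prod>j. b j z)"
    and disc_product_holomorphic: "(\<lambda>z. \<Prod>j. b j z) holomorphic_on ball 0 1"
    and disc_product_le: "cmod z < 1 \<Longrightarrow> cmod (\<Prod>j. b j z) \<le> 1"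
    and disc_product_0_ge: "1 - (\<Sum>j. d j) \<le> cmod (\<Prod>j. b j 0)"
proof -
  have d0: "d j \<ge> 0" for j using near1[of 0 j] order_trans[OF norm_ge_zero] by fastforce
  show lim: "(\<lambda>n. \<Prod>j<n. b j z) \<longlonglongrightarrow> (\<Prod>j. b j z)" if "cmod z < 1" for z
  proof -
    have "summable (\<lambda>j. norm (b j z - 1))"
      using near1[OF that] by (intro summable_comparison_test'[OF summable_mult[OF d, of "(1 + cmod z) / (1 - cmod z)"], of 0])
        (simp add: norm_minus_commute)
    then have "convergent_prod (\<lambda>j. b j z)"
      by (intro abs_convergent_prod_imp_convergent_prod summable_imp_abs_convergent_prod)
    then have "(\<lambda>n. \<Prod>j\<le>n. b j z) \<longlonglongrightarrow> (\<Prod>j. b j z)" by (rule convergent_prod_LIMSEQ)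
    then show ?thesis
      using filterlim_sequentially_Suc[of "\<lambda>n. \<Prod>j<n. b j z"] by (simp only: lessThan_Suc_atMost)
  qed
  show "cmod (\<Prod>j. b j z) \<le> 1" if "cmod z < 1" for z
  proof (rule LIMSEQ_le_const2[OF tendsto_norm[OF lim[OF that]]])
    have "cmod (\<Prod>j<n. b j z) \<le> 1" for n
      unfolding prod_norm[symmetric] using le1[OF that] by (intro prod_le_1) auto
    then show "\<exists>N. \<forall>n\<ge>N. cmod (\<Prod>j<n. b j z) \<le> 1" by blast
  qed
  show "(\<lambda>z. \<Prod>j. b j z) holomorphic_on ball 0 1"
  proof (rule holomorphic_uniform_sequence[where f="\<lambda>n z. \<Prod>j<n. b j z"])
    show "(\<lambda>z. \<Prod>j<n. b j z) holomorphic_on ball 0 1" for n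
      by (intro holomorphic_intros hol)
    fix x :: complex assume "x \<in> ball 0 1"
    (* on the ball of radius e about x all moduli are at most R < 1 *)
    define e where "e = (1 - cmod x) / 2"
    define R where "R = (1 + cmod x) / 2"
    have R: "R < 1" and e0: "e > 0" using \<open>x \<in> ball 0 1\<close> by (auto simp: R_def e_def)
    have inR: "cmod z \<le> R" "cmod z < 1" if "z \<in> cball x e" for z
    proof -
      have "cmod z \<le> cmod x + dist x z" using norm_triangle_sub[of z x] by (simp add: dist_norm norm_minus_commute)
      also have "\<dots> \<le> cmod x + e" using that by simp
      also have "\<dots> = R" by (simp add: R_def e_def field_simps)
      finally show "cmod z \<le> R" .
      then show "cmod z < 1" using R by simp
    qed
    have e: "e > 0" "cball x e \<subseteq> ball 0 1" using e0 inR(2) by auto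
    have "uniformly_convergent_on (cball x e) (\<lambda>n z. \<Prod>j<n. b j z)"
    proof (rule uniformly_convergent_on_prod')
      show "continuous_on (cball x e) (b j)" for j
        using holomorphic_on_imp_continuous_on[OF hol] e(2) by (rule continuous_on_subset)
      show "uniformly_convergent_on (cball x e) (\<lambda>n z. \<Sum>j<n. norm (b j z - 1))"
      proof (rule Weierstrass_m_test')
        show "summable (\<lambda>j. (1 + R) / (1 - R) * d j)" by (rule summable_mult[OF d])
        fix j z assume z: "z \<in> cball x e"
        have "cmod (b j z - 1) \<le> (1 + cmod z) / (1 - cmod z) * d j"
          using near1[OF inR(2)[OF z], of j] by (simp add: norm_minus_commute)
        also have "\<dots> \<le> (1 + R) / (1 - R) * d j"
          using inR[OF z] R d0 by (intro mult_right_mono frac_le) (auto simp: R_def)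
        finally show "norm (norm (b j z - 1)) \<le> (1 + R) / (1 - R) * d j" by simp
      qed
    qed simp
    then obtain g where g: "uniform_limit (cball x e) (\<lambda>n z. \<Prod>j<n. b j z) g sequentially"
      by (auto simp: uniformly_convergent_on_def)
    have g_eq: "g z = (\<Prod>j. b j z)" if "z \<in> cball x e" for z
      using tendsto_uniform_limitI[OF g that] lim[OF inR(2)[OF that]] by (rule LIMSEQ_unique)
    have "uniform_limit (cball x e) (\<lambda>n z. \<Prod>j<n. b j z) (\<lambda>z. \<Prod>j. b j z) sequentially"
      by (rule uniform_limit_cong'[THEN iffD1, rotated 2, OF g]) (auto simp: g_eq)
    then show "\<exists>e>0. cball x e \<subseteq> ball 0 1 \<and> uniform_limit (cball x e) (\<lambda>n z. \<Prod>j<n. b j z) (\<lambda>z. \<Prod>j. b j z) sequentially"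
      using e by blast
  qed simp
  show "1 - (\<Sum>j. d j) \<le> cmod (\<Prod>j. b j 0)"
  proof (rule LIMSEQ_le_const[OF tendsto_norm[OF lim]])
    have "1 - (\<Sum>j. d j) \<le> cmod (\<Prod>j<n. b j 0)" for n
    proof -
      have "1 - (\<Sum>j<n. d j) \<le> cmod (\<Prod>j<n. b j 0)"
      proof (induction n)
        case (Suc n)
        let ?p = "cmod (\<Prod>j<n. b j 0)"
        have p1: "?p \<le> 1" unfolding prod_norm[symmetric] using le1[of 0] by (intro prod_le_1) auto
        have "cmod (b n 0) \<ge> 1 - d n"
          using near1[of 0 n] norm_triangle_ineq2[of 1 "1 - b n 0"] by simp
        then have "?p * (1 - d n) \<le> ?p * cmod (b n 0)" by (intro mult_left_mono) auto
        moreover have "?p * d n \<le> d n" using p1 d0[of n] by (intro mult_left_le_one_le) auto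
        ultimately have "?p - d n \<le> ?p * cmod (b n 0)" by (simp add: algebra_simps)
        then show ?case using Suc by (simp add: norm_mult)
      qed simp
      moreover have "(\<Sum>j<n. d j) \<le> (\<Sum>j. d j)" using d d0 by (intro sum_le_suminf) auto
      ultimately show ?thesis by linarith
    qed
    then show "\<exists>N. \<forall>n\<ge>N. 1 - (\<Sum>j. d j) \<le> cmod (\<Prod>j<n. b j 0)" by blast
  qed simp
qed

text \<open>
For the unimodularity let \<open>T\<close> be the product of all factors with index at least \<open>n\<close>. The first \<open>n\<close>
factors have modulus tending to \<open>1\<close> along every radius, so \<open>|B| = |T|\<close> almost everywhere on the
circle. Therefore \<open>\<integral> |B| dm = \<integral> |T| dm \<ge> |T(0)|\<close>, which tends to \<open>1\<close> as \<open>n\<close> grows. Hence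
\<open>\<integral> |B| dm \<ge> 1\<close>, while \<open>|B| \<le> 1\<close>.
\<close>

lemma blaschke_product_properties:
  assumes seq: "blaschke_sequence N a"
    and B: "\<And>z. z \<in> ball 0 1 \<Longrightarrow> B z = (\<Prod>j. if enat j < N then blaschke_factor (a j) z else 1)"
  shows blaschke_product_holomorphic: "B holomorphic_on ball 0 1"
    and norm_blaschke_product_le: "cmod z < 1 \<Longrightarrow> cmod (B z) \<le> 1"
    and blaschke_product_zero: "enat k < N \<Longrightarrow> B (a k) = 0"
    and blaschke_product_boundary: "AE \<zeta> in circle_measure. cmod (boundary_value B \<zeta>) = 1"
proof -
  define b where "b = (\<lambda>j z. if enat j < N then blaschke_factor (a j) z else 1)"
  define d where "d = (\<lambda>j. if enat j < N then 1 - cmod (a j) else 0)"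
  have a1: "cmod (a j) < 1" if "enat j < N" for j using seq that by (simp add: blaschke_sequence_def)
  have d: "summable d" using seq by (simp add: blaschke_sequence_def d_def)
  have hol: "b j holomorphic_on ball 0 1" for j
    by (cases "enat j < N") (auto simp: b_def a1 blaschke_factor_holomorphic)
  have le1: "cmod (b j z) \<le> 1" if "cmod z < 1" for j z
    using that by (auto simp: b_def a1 norm_blaschke_factor_le)
  have near1: "cmod (1 - b j z) \<le> (1 + cmod z) / (1 - cmod z) * d j" if "cmod z < 1" for j z
    using that norm_one_minus_blaschke_factor_le[OF a1, of j z] by (auto simp: b_def d_def)
  have B': "B z = (\<Prod>j. b j z)" if "cmod z < 1" for z using B that by (simp add: b_def)
  show holB: "B holomorphic_on ball 0 1"
    by (rule holomorphic_transform[OF disc_product_holomorphic[OF hol le1 near1 d]]) (auto simp: B')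
  show leB: "cmod (B z) \<le> 1" if "cmod z < 1" for z
    using disc_product_le[OF hol le1 near1 d that] B'[OF that] by simp
  show "B (a k) = 0" if k: "enat k < N" for k
  proof -
    have "(\<lambda>n. \<Prod>j<n. b j (a k)) \<longlonglongrightarrow> B (a k)"
      unfolding B'[OF a1[OF k]] by (rule disc_product_LIMSEQ[OF hol le1 near1 d a1[OF k]])
    moreover have "b k (a k) = 0" using k by (simp add: b_def blaschke_factor_def)
    then have "(\<Prod>j<n. b j (a k)) = 0" if "n > k" for n
      using that by (intro prod_zero) auto
    then have "(\<lambda>n. \<Prod>j<n. b j (a k)) \<longlonglongrightarrow> 0"
      by (intro tendsto_eventually eventually_sequentiallyI[of "Suc k"]) auto
    ultimately show ?thesis by (rule LIMSEQ_unique)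
  qed
  have bvB: "boundary_value B \<in> borel_measurable circle_measure"
    "AE \<zeta> in circle_measure. ((\<lambda>r. B (of_real r * \<zeta>)) \<longlongrightarrow> boundary_value B \<zeta>) (at_left 1)"
    "AE \<zeta> in circle_measure. cmod (boundary_value B \<zeta>) \<le> 1"
    by (rule bounded_holomorphic_boundary[OF holB leB]; assumption)+
  note [measurable] = bvB(1)
  have ge: "1 - (\<Sum>j. d (j + n)) \<le> poisson (\<lambda>\<zeta>. cmod (boundary_value B \<zeta>)) 0" for n
  proof -
    define T where "T = (\<lambda>z. \<Prod>j. b (j + n) z)"
    have dn: "summable (\<lambda>j. d (j + n))" using d by (rule summable_ignore_initial_segment)
    note tail = disc_product[where b="\<lambda>j. b (j + n)" and d="\<lambda>j. d (j + n)", OF hol le1 near1 dn]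
    have holT: "T holomorphic_on ball 0 1" unfolding T_def by (rule tail(2))
    have leT: "cmod (T z) \<le> 1" if "cmod z < 1" for z
      using tail(3)[of z] that by (simp add: T_def)
    have bvT: "boundary_value T \<in> borel_measurable circle_measure"
      "AE \<zeta> in circle_measure. ((\<lambda>r. T (of_real r * \<zeta>)) \<longlongrightarrow> boundary_value T \<zeta>) (at_left 1)"
      "poisson (boundary_value T) 0 = T 0"
      using bounded_holomorphic_boundary(1,2,4)[OF holT leT] by (simp_all only: norm_zero zero_less_one)
    have split: "B z = (\<Prod>j<n. b j z) * T z" if z: "cmod z < 1" for z
    proof (rule LIMSEQ_unique)
      have "(\<lambda>m. \<Prod>j<m + n. b j z) \<longlonglongrightarrow> B z"
        unfolding B'[OF z]
        by (rule LIMSEQ_ignore_initial_segment[OF disc_product_LIMSEQ[OF hol le1 near1 d z]])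
      moreover have "(\<Prod>j<m + n. b j z) = (\<Prod>j<n. b j z) * (\<Prod>j<m. b (j + n) z)" for m
        by (induction m) (auto simp: mult.assoc)
      ultimately show "(\<lambda>m. (\<Prod>j<n. b j z) * (\<Prod>j<m. b (j + n) z)) \<longlonglongrightarrow> B z" by simp
      show "(\<lambda>m. (\<Prod>j<n. b j z) * (\<Prod>j<m. b (j + n) z)) \<longlonglongrightarrow> (\<Prod>j<n. b j z) * T z"
        unfolding T_def by (intro tendsto_mult_left tail(1) z)
    qed
    have same: "AE \<zeta> in circle_measure. cmod (boundary_value T \<zeta>) = cmod (boundary_value B \<zeta>)"
      using bvB(2) bvT(2) AE_circle_norm
    proof eventually_elim
      case (elim \<zeta>)
      have "((\<lambda>r. cmod (b j (of_real r * \<zeta>))) \<longlongrightarrow> 1) (at_left 1)" for j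
        using blaschke_factor_radial[OF a1 elim(3), of j] by (cases "enat j < N") (auto simp: b_def)
      then have "((\<lambda>r. (\<Prod>j<n. cmod (b j (of_real r * \<zeta>))) * cmod (T (of_real r * \<zeta>))) \<longlongrightarrow>
          (\<Prod>j<n. 1) * cmod (boundary_value T \<zeta>)) (at_left 1)"
        using elim(2) by (intro tendsto_intros)
      moreover have "\<forall>\<^sub>F r::real in at_left 1. (\<Prod>j<n. cmod (b j (of_real r * \<zeta>))) * cmod (T (of_real r * \<zeta>)) = cmod (B (of_real r * \<zeta>))"
        by (rule eventually_at_leftI[of 0])
           (use elim(3) in \<open>auto simp: split norm_mult prod_norm\<close>)
      ultimately have "((\<lambda>r. cmod (B (of_real r * \<zeta>))) \<longlongrightarrow> cmod (boundary_value T \<zeta>)) (at_left 1)"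
        by (simp add: tendsto_cong)
      moreover have "((\<lambda>r. cmod (B (of_real r * \<zeta>))) \<longlongrightarrow> cmod (boundary_value B \<zeta>)) (at_left 1)"
        using elim(1) by (rule tendsto_norm)
      ultimately show ?case using tendsto_unique[OF trivial_limit_at_left_real] by blast
    qed
    have "1 - (\<Sum>j. d (j + n)) \<le> cmod (T 0)" unfolding T_def by (rule tail(4))
    also have "\<dots> = cmod (poisson (boundary_value T) 0)" by (simp add: bvT(3))
    also have "\<dots> \<le> poisson (\<lambda>\<zeta>. cmod (boundary_value T \<zeta>)) 0" by (rule norm_poisson_le) simp
    also have "\<dots> = poisson (\<lambda>\<zeta>. cmod (boundary_value B \<zeta>)) 0"
      using bvT(1) bvB(1) same by (intro poisson_cong_AE) auto
    finally show ?thesis .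
  qed
  have "(\<lambda>n. 1 - (\<Sum>j. d (j + n))) \<longlonglongrightarrow> 1 - 0"
    by (intro tendsto_intros suminf_exist_split2 d)
  from LIMSEQ_le_const2[OF this] ge have mean: "1 \<le> poisson (\<lambda>\<zeta>. cmod (boundary_value B \<zeta>)) 0"
    by auto
  have iB: "integrable circle_measure (\<lambda>\<zeta>. cmod (boundary_value B \<zeta>))"
    using bvB(3) by (intro integrable_circle_bounded[of _ 1]) auto
  have "(LINT \<zeta>|circle_measure. 1 - cmod (boundary_value B \<zeta>)) = poisson (\<lambda>\<zeta>. 1 - cmod (boundary_value B \<zeta>)) 0"
    unfolding poisson_altdef by (intro Bochner_Integration.integral_cong refl) (simp add: poisson_kernel_def)
  also have "\<dots> = 1 - poisson (\<lambda>\<zeta>. cmod (boundary_value B \<zeta>)) 0"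
    using iB by (simp add: poisson_diff poisson_const)
  finally have le0: "(LINT \<zeta>|circle_measure. 1 - cmod (boundary_value B \<zeta>)) \<le> 0" using mean by simp
  have nn: "AE \<zeta> in circle_measure. 0 \<le> 1 - cmod (boundary_value B \<zeta>)" using bvB(3) by eventually_elim simp
  have "(LINT \<zeta>|circle_measure. 1 - cmod (boundary_value B \<zeta>)) = 0"
    using le0 integral_nonneg_AE[OF nn] by linarith
  then have "AE \<zeta> in circle_measure. 1 - cmod (boundary_value B \<zeta>) = 0"
    using iB nn by (subst (asm) integral_nonneg_eq_0_iff_AE) auto
  then show "AE \<zeta> in circle_measure. cmod (boundary_value B \<zeta>) = 1" by eventually_elim simp
qed

section \<open>Non-extreme points by perturbation\<close>

lemma Linf_norm_eq_1D:
  assumes "\<phi> \<in> Linf" "Linf_norm \<phi> = 1"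
  shows "\<phi> \<in> borel_measurable circle_measure" "AE \<zeta> in circle_measure. cmod (\<phi> \<zeta>) \<le> 1"
proof -
  show "\<phi> \<in> borel_measurable circle_measure" using assms by (simp add: Linf_def)
  have "AE \<zeta> in circle_measure. ereal (cmod (\<phi> \<zeta>)) \<le> 1"
    using esssup_AE[of "\<lambda>\<zeta>. ereal (cmod (\<phi> \<zeta>))" circle_measure] assms(2) by (simp add: Linf_norm_def)
  then show "AE \<zeta> in circle_measure. cmod (\<phi> \<zeta>) \<le> 1"
    by (simp add: one_ereal_def)
qed

text \<open>
This is \<open>\<Phi>\<^sub>f \<le> \<P>(|f|\<^sup>2) \<le> \<parallel>f\<parallel>\<^sub>\<infinity>\<^sup>2\<close>.
\<close>

lemma bounded_by_1_in_BMO_ball: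
  assumes f[measurable]: "f \<in> borel_measurable circle_measure" and bd: "AE \<zeta> in circle_measure. cmod (f \<zeta>) \<le> 1"
  shows "f \<in> L2" "garsia_norm f \<le> 1" "f \<in> BMO"
proof -
  have sq: "AE \<zeta> in circle_measure. norm ((cmod (f \<zeta>))\<^sup>2) \<le> 1"
    using bd by eventually_elim (simp add: power_le_one)
  have m2: "(\<lambda>\<zeta>. (cmod (f \<zeta>))\<^sup>2) \<in> borel_measurable circle_measure" by measurable
  show L2: "f \<in> L2" unfolding L2_def using f integrable_circle_bounded[OF m2 sq] by simp
  show norm: "garsia_norm f \<le> 1"
    unfolding garsia_norm_def
  proof (rule SUP_least)
    fix z :: complex assume "z \<in> ball 0 1"
    then have z: "cmod z < 1" by simp
    have "norm (poisson (\<lambda>\<zeta>. (cmod (f \<zeta>))\<^sup>2) z) \<le> 1"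
      by (rule poisson_norm_bound[OF m2 sq z])
    then have "poisson (\<lambda>\<zeta>. (cmod (f \<zeta>))\<^sup>2) z \<le> 1" by (simp add: abs_le_iff)
    then have "garsia_Phi f z \<le> 1"
      unfolding garsia_Phi_def using zero_le_power2[of "cmod (poisson f z)"] by linarith
    then have "sqrt (garsia_Phi f z) \<le> 1" by simp
    then show "ereal (sqrt (garsia_Phi f z)) \<le> 1" by (simp add: one_ereal_def)
  qed
  show "f \<in> BMO" using L2 norm by (auto simp: BMO_def intro: le_less_trans)
qed

text \<open>
\<open>f\<close> is the midpoint of \<open>f + g\<close> and \<open>f - g\<close>, both bounded by \<open>1\<close>. Their cosets differ unless
\<open>2 g\<close> is constant.
\<close>

lemma nonextreme_pointI:
  assumes f[measurable]: "f \<in> borel_measurable circle_measure" and g[measurable]: "g \<in> borel_measurable circle_measure"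
    and X: "f \<in> X" "(\<lambda>\<zeta>. f \<zeta> + g \<zeta>) \<in> X" "(\<lambda>\<zeta>. f \<zeta> - g \<zeta>) \<in> X"
    and bd: "AE \<zeta> in circle_measure. cmod (f \<zeta>) + cmod (g \<zeta>) \<le> 1"
    and nonconst: "\<And>c. \<not> (AE \<zeta> in circle_measure. g \<zeta> = c)"
  shows "nonextreme_point_of_ball X (coset f)"
proof -
  let ?u = "\<lambda>\<zeta>. f \<zeta> + g \<zeta>" and ?v = "\<lambda>\<zeta>. f \<zeta> - g \<zeta>"
  have "AE \<zeta> in circle_measure. cmod (f \<zeta>) \<le> 1"
    using bd by eventually_elim (smt (verit) norm_ge_zero)
  then have nf: "garsia_norm f \<le> 1" by (rule bounded_by_1_in_BMO_ball(2)[OF f])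
  have "AE \<zeta> in circle_measure. cmod (?u \<zeta>) \<le> 1"
    using bd by eventually_elim (rule order_trans[OF norm_triangle_ineq])
  then have nu: "garsia_norm ?u \<le> 1" by (intro bounded_by_1_in_BMO_ball(2)) measurable
  have "AE \<zeta> in circle_measure. cmod (?v \<zeta>) \<le> 1"
    using bd by eventually_elim (rule order_trans[OF norm_triangle_ineq4])
  then have nv: "garsia_norm ?v \<le> 1" by (intro bounded_by_1_in_BMO_ball(2)) measurable
  have ball: "coset f \<in> quotient_ball X" "coset ?u \<in> quotient_ball X" "coset ?v \<in> quotient_ball X"
    using X nf nu nv by (auto simp: quotient_ball_def)
  have ne: "coset ?u \<noteq> coset ?v"
  proof
    assume "coset ?u = coset ?v"
    moreover have "?u \<in> coset ?u" unfolding coset_def by (auto intro!: exI[of _ 0])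
    ultimately have "?u \<in> coset ?v" by simp
    then obtain c where "AE \<zeta> in circle_measure. f \<zeta> + g \<zeta> = f \<zeta> - g \<zeta> + c"
      unfolding coset_def by auto
    then have "AE \<zeta> in circle_measure. g \<zeta> = c / 2"
      by eventually_elim (simp add: field_simps)
    then show False using nonconst by blast
  qed
  have mid: "coset f = coset_midpoint (coset ?u) (coset ?v)"
  proof
    show "coset f \<subseteq> coset_midpoint (coset ?u) (coset ?v)"
    proof
      fix w assume "w \<in> coset f"
      then obtain c where w[measurable]: "w \<in> borel_measurable circle_measure"
        and c: "AE \<zeta> in circle_measure. w \<zeta> = f \<zeta> + c" by (auto simp: coset_def)
      have "AE \<zeta> in circle_measure. w \<zeta> + g \<zeta> = ?u \<zeta> + c" using c by eventually_elim simp
      moreover have "(\<lambda>\<zeta>. w \<zeta> + g \<zeta>) \<in> borel_measurable circle_measure" by measurable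
      ultimately have 1: "(\<lambda>\<zeta>. w \<zeta> + g \<zeta>) \<in> coset ?u" unfolding coset_def by blast
      have "AE \<zeta> in circle_measure. w \<zeta> - g \<zeta> = ?v \<zeta> + c" using c by eventually_elim simp
      moreover have "(\<lambda>\<zeta>. w \<zeta> - g \<zeta>) \<in> borel_measurable circle_measure" by measurable
      ultimately have 2: "(\<lambda>\<zeta>. w \<zeta> - g \<zeta>) \<in> coset ?v" unfolding coset_def by blast
      have "w = (\<lambda>\<zeta>. ((w \<zeta> + g \<zeta>) + (w \<zeta> - g \<zeta>)) / 2)" by (simp add: fun_eq_iff)
      then show "w \<in> coset_midpoint (coset ?u) (coset ?v)"
        unfolding coset_midpoint_def mem_Collect_eq using 1 2
        by (intro exI[of _ "\<lambda>\<zeta>. w \<zeta> + g \<zeta>"] exI[of _ "\<lambda>\<zeta>. w \<zeta> - g \<zeta>"] conjI)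
    qed
    show "coset_midpoint (coset ?u) (coset ?v) \<subseteq> coset f"
    proof
      fix w assume "w \<in> coset_midpoint (coset ?u) (coset ?v)"
      then obtain p q where w: "w = (\<lambda>\<zeta>. (p \<zeta> + q \<zeta>) / 2)" and pq: "p \<in> coset ?u" "q \<in> coset ?v"
        unfolding coset_midpoint_def by blast
      obtain c where [measurable]: "p \<in> borel_measurable circle_measure"
        and c: "AE \<zeta> in circle_measure. p \<zeta> = ?u \<zeta> + c" using pq(1) by (auto simp: coset_def)
      obtain d where [measurable]: "q \<in> borel_measurable circle_measure"
        and d: "AE \<zeta> in circle_measure. q \<zeta> = ?v \<zeta> + d" using pq(2) by (auto simp: coset_def)
      have "AE \<zeta> in circle_measure. w \<zeta> = f \<zeta> + (c + d) / 2"
        using c d unfolding w by eventually_elim (simp add: field_simps)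
      moreover have "w \<in> borel_measurable circle_measure" unfolding w by measurable
      ultimately show "w \<in> coset f" unfolding coset_def by blast
    qed
  qed
  show ?thesis
    unfolding nonextreme_point_of_ball_def extreme_point_of_ball_def using ball ne mid by blast
qed

lemma blaschke_productD:
  assumes "blaschke_product B"
  shows "B holomorphic_on ball 0 1" "\<And>z. cmod z < 1 \<Longrightarrow> cmod (B z) \<le> 1"
    "AE \<zeta> in circle_measure. cmod (boundary_value B \<zeta>) = 1"
    "boundary_value B \<in> borel_measurable circle_measure"
    "AE \<zeta> in circle_measure. ((\<lambda>r. B (of_real r * \<zeta>)) \<longlongrightarrow> boundary_value B \<zeta>) (at_left 1)"
    "\<And>z. cmod z < 1 \<Longrightarrow> poisson (boundary_value B) z = B z"
proof -
  obtain N a where Na: "blaschke_sequence N a"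
    "\<And>z. z \<in> ball 0 1 \<Longrightarrow> B z = (\<Prod>j. if enat j < N then blaschke_factor (a j) z else 1)"
    using assms unfolding blaschke_product_def by blast
  show hol: "B holomorphic_on ball 0 1" by (rule blaschke_product_holomorphic[OF Na])
  show le: "cmod (B z) \<le> 1" if "cmod z < 1" for z by (rule norm_blaschke_product_le[OF Na that])
  show "AE \<zeta> in circle_measure. cmod (boundary_value B \<zeta>) = 1" by (rule blaschke_product_boundary[OF Na])
  show "boundary_value B \<in> borel_measurable circle_measure"
    "AE \<zeta> in circle_measure. ((\<lambda>r. B (of_real r * \<zeta>)) \<longlongrightarrow> boundary_value B \<zeta>) (at_left 1)"
    "\<And>z. cmod z < 1 \<Longrightarrow> poisson (boundary_value B) z = B z"
    by (rule bounded_holomorphic_boundary[OF hol le]; assumption)+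
qed

lemma bd_times_blaschke:
  assumes B: "blaschke_product B" and \<phi>: "\<phi> \<in> borel_measurable circle_measure"
  shows "bd_times B \<phi> \<in> borel_measurable circle_measure"
    "AE \<zeta> in circle_measure. cmod (bd_times B \<phi> \<zeta>) = cmod (\<phi> \<zeta>)"
proof -
  show "bd_times B \<phi> \<in> borel_measurable circle_measure"
    using blaschke_productD(4)[OF B] \<phi> unfolding bd_times_def[abs_def] by measurable
  show "AE \<zeta> in circle_measure. cmod (bd_times B \<phi> \<zeta>) = cmod (\<phi> \<zeta>)"
    using blaschke_productD(3)[OF B] by eventually_elim (simp add: bd_times_def norm_mult)
qed

text \<open>
The function \<open>\<phi>\<close> leaves room for a perturbation on a set of positive measure where \<open>|\<phi>| \<le> 1 - \<epsilon>\<close>.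
\<close>

lemma nonextreme_BMO:
  assumes \<phi>: "\<phi> \<in> Linf" "\<not> unimodular \<phi>" "Linf_norm \<phi> = 1" and B: "blaschke_product B"
  shows "nonextreme_point_of_ball BMO (coset (bd_times B \<phi>))"
proof -
  note [measurable] = Linf_norm_eq_1D(1)[OF \<phi>(1,3)] bd_times_blaschke(1)[OF B Linf_norm_eq_1D(1)[OF \<phi>(1,3)]]
  note abs_f = bd_times_blaschke(2)[OF B Linf_norm_eq_1D(1)[OF \<phi>(1,3)]]
  note le1 = Linf_norm_eq_1D(2)[OF \<phi>(1,3)]
  define E where "E = (\<lambda>n. {\<zeta> \<in> space circle_measure. cmod (\<phi> \<zeta>) \<le> 1 - 1 / real (Suc n)})"
  have [measurable]: "E n \<in> sets circle_measure" for n unfolding E_def by measurable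
  have "\<exists>n. \<not> (AE \<zeta> in circle_measure. \<zeta> \<notin> E n)"
  proof (rule ccontr)
    assume "\<not> ?thesis"
    then have "AE \<zeta> in circle_measure. \<forall>n. \<zeta> \<notin> E n" by (simp add: AE_all_countable)
    then have "AE \<zeta> in circle_measure. cmod (\<phi> \<zeta>) = 1"
      using le1 AE_space
    proof eventually_elim
      case (elim \<zeta>)
      show ?case
      proof (rule ccontr)
        assume "cmod (\<phi> \<zeta>) \<noteq> 1"
        then have "0 < 1 - cmod (\<phi> \<zeta>)" using elim by simp
        then obtain n where "1 / real (Suc n) < 1 - cmod (\<phi> \<zeta>)" using nat_approx_posE by blast
        then have "\<zeta> \<in> E n" using elim(3) by (simp add: E_def)
        then show False using elim by blast
      qed
    qed
    then show False using \<phi> by (simp add: unimodular_def)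
  qed
  then obtain n where n: "\<not> (AE \<zeta> in circle_measure. \<zeta> \<notin> E n)" ..
  define \<epsilon> where "\<epsilon> = 1 / real (Suc n)"
  (* the factor \<zeta> keeps g from being constant, even if E n is the whole circle *)
  define g where "g = (\<lambda>\<zeta>::complex. indicator (E n) \<zeta> * (of_real \<epsilon> * \<zeta>) :: complex)"
  have id_m: "(\<lambda>\<zeta>. \<zeta>) \<in> borel_measurable circle_measure" by (intro borel_measurable_circleI) simp
  have [measurable]: "g \<in> borel_measurable circle_measure" unfolding g_def using id_m by measurable
  have bd: "AE \<zeta> in circle_measure. cmod (bd_times B \<phi> \<zeta>) + cmod (g \<zeta>) \<le> 1"
    using abs_f le1 AE_circle_norm
  proof eventually_elim
    case (elim \<zeta>)
    have "\<epsilon> > 0" by (simp add: \<epsilon>_def)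
    then have "cmod (g \<zeta>) = indicator (E n) \<zeta> * \<epsilon>"
      using elim(3) by (simp add: g_def norm_mult split: split_indicator)
    then show ?case using elim(1,2) by (auto simp: E_def \<epsilon>_def split: split_indicator)
  qed
  show ?thesis
  proof (rule nonextreme_pointI[OF _ _ _ _ _ bd])
    show "bd_times B \<phi> \<in> BMO"
    proof (rule bounded_by_1_in_BMO_ball(3))
      show "AE \<zeta> in circle_measure. cmod (bd_times B \<phi> \<zeta>) \<le> 1"
        using abs_f le1 by eventually_elim simp
    qed measurable
    have "AE \<zeta> in circle_measure. cmod (bd_times B \<phi> \<zeta> + g \<zeta>) \<le> 1"
      using bd by eventually_elim (rule order_trans[OF norm_triangle_ineq])
    then show "(\<lambda>\<zeta>. bd_times B \<phi> \<zeta> + g \<zeta>) \<in> BMO" by (intro bounded_by_1_in_BMO_ball(3)) measurable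
    have "AE \<zeta> in circle_measure. cmod (bd_times B \<phi> \<zeta> - g \<zeta>) \<le> 1"
      using bd by eventually_elim (rule order_trans[OF norm_triangle_ineq4])
    then show "(\<lambda>\<zeta>. bd_times B \<phi> \<zeta> - g \<zeta>) \<in> BMO" by (intro bounded_by_1_in_BMO_ball(3)) measurable
    show "\<not> (AE \<zeta> in circle_measure. g \<zeta> = c)" for c
    proof
      assume "AE \<zeta> in circle_measure. g \<zeta> = c"
      then have "AE \<zeta> in circle_measure. \<zeta> \<notin> E n"
        using circle_singleton_null[of "c / of_real \<epsilon>"]
      proof eventually_elim
        case (elim \<zeta>)
        have "\<epsilon> \<noteq> 0" by (simp add: \<epsilon>_def)
        then show ?case using elim by (auto simp: g_def)
      qed
      then show False using n by blast
    qed
  qed measurable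
qed

section \<open>Outer functions\<close>

text \<open>
\<open>H\<close> is the integral of \<open>h\<close> against \<open>(1 + z \<zeta>\<^sup>*) / (1 - z \<zeta>\<^sup>*)\<close>, where \<open>\<zeta>\<^sup>*\<close> is the conjugate of \<open>\<zeta>\<close>; the
real part of this kernel is the Poisson kernel. Holomorphy comes from expanding the kernel into
powers of \<open>z\<close>.
\<close>

lemma herglotz_transform:
  fixes h :: "complex \<Rightarrow> real"
  assumes h: "integrable circle_measure h"
  obtains H where "H holomorphic_on ball 0 1" "\<And>z. cmod z < 1 \<Longrightarrow> Re (H z) = poisson h z"
proof -
  define H where "H = (\<lambda>z. LINT \<zeta>|circle_measure. (1 + z * cnj \<zeta>) / (1 - z * cnj \<zeta>) * of_real (h \<zeta>))"
  define I where "I = (\<lambda>n. LINT \<zeta>|circle_measure. cnj \<zeta> ^ n * of_real (h \<zeta>))"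
  have hc: "integrable circle_measure (\<lambda>\<zeta>. complex_of_real (h \<zeta>))" using h by simp
  have cm: "(\<lambda>\<zeta>. cnj \<zeta> ^ n) \<in> borel_measurable circle_measure" for n
    by (intro borel_measurable_circleI) measurable
  have "(\<lambda>n. (if n = 0 then 1 else 2) * I n * (z - 0) ^ n) sums H z" if "z \<in> ball 0 1" for z
  proof -
    have z: "cmod z < 1" using that by simp
    (* (1 + w) / (1 - w) is twice the geometric series minus 1 *)
    define c where "c = (\<lambda>n. 2 * z ^ n - (if n = 0 then 1 else 0))"
    have "summable (\<lambda>n. 2 * cmod z ^ n + (if n = 0 then 1 else 0))"
      using z by (intro summable_add summable_mult summable_geometric) auto
    then have c: "summable (\<lambda>n. cmod (c n))"
    proof (rule summable_comparison_test'[where N=0])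
      show "norm (cmod (c n)) \<le> 2 * cmod z ^ n + (if n = 0 then 1 else 0)" for n
        using norm_triangle_ineq4[of "2 * z ^ n" "if n = 0 then 1 else 0"]
        by (simp add: c_def norm_mult norm_power split: if_splits)
    qed
    have "(\<lambda>n. c n * (LINT \<zeta>|circle_measure. cnj \<zeta> ^ n * of_real (h \<zeta>))) sums
        (LINT \<zeta>|circle_measure. (\<Sum>n. c n * cnj \<zeta> ^ n) * of_real (h \<zeta>))"
      by (rule circle_integral_series[OF c hc cm]) (simp add: norm_power)
    also have "(LINT \<zeta>|circle_measure. (\<Sum>n. c n * cnj \<zeta> ^ n) * of_real (h \<zeta>)) = H z"
      unfolding H_def
    proof (intro Bochner_Integration.integral_cong refl)
      fix \<zeta> assume "\<zeta> \<in> space circle_measure"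
      then have w: "cmod (z * cnj \<zeta>) < 1" using z by (simp add: norm_mult)
      have "(\<lambda>n. 2 * (z * cnj \<zeta>) ^ n - (if n = 0 then 1 else 0)) sums (2 * (1 / (1 - z * cnj \<zeta>)) - 1)"
        using w sums_single[of 0 "\<lambda>_. 1::complex"] by (intro sums_diff sums_mult geometric_sums) auto
      moreover have "(\<lambda>n. 2 * (z * cnj \<zeta>) ^ n - (if n = 0 then 1 else 0)) = (\<lambda>n. c n * cnj \<zeta> ^ n)"
        by (auto simp: c_def algebra_simps power_mult_distrib)
      moreover have "2 * (1 / (1 - z * cnj \<zeta>)) - 1 = (1 + z * cnj \<zeta>) / (1 - z * cnj \<zeta>)"
      proof -
        have "z * cnj \<zeta> \<noteq> 1" using w by auto
        then show ?thesis by (simp add: divide_simps)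
      qed
      ultimately show "(\<Sum>n. c n * cnj \<zeta> ^ n) * of_real (h \<zeta>) = (1 + z * cnj \<zeta>) / (1 - z * cnj \<zeta>) * of_real (h \<zeta>)"
        by (simp add: sums_iff)
    qed
    also have "(\<lambda>n. c n * (LINT \<zeta>|circle_measure. cnj \<zeta> ^ n * of_real (h \<zeta>))) =
        (\<lambda>n. (if n = 0 then 1 else 2) * I n * (z - 0) ^ n)"
      by (auto simp: c_def I_def)
    finally show ?thesis .
  qed
  then have hol: "H holomorphic_on ball 0 1" by (rule power_series_holomorphic)
  have "Re (H z) = poisson h z" if z: "cmod z < 1" for z
  proof -
    have nz: "1 - z * cnj \<zeta> \<noteq> 0" "1 - cmod z \<le> cmod (1 - z * cnj \<zeta>)" if "cmod \<zeta> = 1" for \<zeta>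
    proof -
      show "1 - cmod z \<le> cmod (1 - z * cnj \<zeta>)"
        using norm_triangle_ineq2[of 1 "z * cnj \<zeta>"] that by (simp add: norm_mult)
      then show "1 - z * cnj \<zeta> \<noteq> 0" using z by auto
    qed
    have m: "(\<lambda>\<zeta>. (1 + z * cnj \<zeta>) / (1 - z * cnj \<zeta>) * of_real (h \<zeta>)) \<in> borel_measurable circle_measure"
    proof -
      have "(\<lambda>\<zeta>. (1 + z * cnj \<zeta>) / (1 - z * cnj \<zeta>)) \<in> borel_measurable circle_measure"
        by (intro borel_measurable_circleI) measurable
      then show ?thesis using hc by (intro borel_measurable_times) auto
    qed
    have bd: "AE \<zeta> in circle_measure. norm ((1 + z * cnj \<zeta>) / (1 - z * cnj \<zeta>) * of_real (h \<zeta>)) \<le> norm (2 / (1 - cmod z) * h \<zeta>)"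
      using AE_circle_norm
    proof eventually_elim
      case (elim \<zeta>)
      have "cmod (1 + z * cnj \<zeta>) \<le> 2"
        using norm_triangle_ineq[of 1 "z * cnj \<zeta>"] elim z by (simp add: norm_mult)
      then have "cmod (1 + z * cnj \<zeta>) / cmod (1 - z * cnj \<zeta>) \<le> 2 / (1 - cmod z)"
        using nz[OF elim] z by (intro frac_le) auto
      then have "cmod (1 + z * cnj \<zeta>) / cmod (1 - z * cnj \<zeta>) * \<bar>h \<zeta>\<bar> \<le> 2 / (1 - cmod z) * \<bar>h \<zeta>\<bar>"
        by (rule mult_right_mono) simp
      then show ?case using z by (simp add: norm_mult norm_divide abs_mult)
    qed
    have i: "integrable circle_measure (\<lambda>\<zeta>. (1 + z * cnj \<zeta>) / (1 - z * cnj \<zeta>) * of_real (h \<zeta>))"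
      by (rule Bochner_Integration.integrable_bound[OF _ m bd]) (use h in simp)
    have "Re (H z) = (LINT \<zeta>|circle_measure. Re ((1 + z * cnj \<zeta>) / (1 - z * cnj \<zeta>) * of_real (h \<zeta>)))"
      unfolding H_def by (rule integral_Re[OF i, symmetric])
    also have "\<dots> = poisson h z"
      unfolding poisson_altdef
    proof (intro Bochner_Integration.integral_cong refl)
      fix \<zeta> assume "\<zeta> \<in> space circle_measure"
      then have 1: "cmod \<zeta> = 1" by simp
      define w where "w = z * cnj \<zeta>"
      have "\<zeta> * cnj \<zeta> = 1" using 1 by (simp add: complex_norm_square[symmetric])
      then have "\<zeta> * (1 - w) = \<zeta> - z" by (simp add: w_def algebra_simps)
      then have n: "cmod (1 - w) = cmod (\<zeta> - z)" using 1 by (metis mult_1 norm_mult)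
      have nw: "cmod w = cmod z" using 1 by (simp add: w_def norm_mult)
      have "(1 + w) / (1 - w) = (1 + w) * cnj (1 - w) / (of_real (cmod (1 - w)))\<^sup>2"
        using complex_div_cnj[of "1 + w" "1 - w"] by simp
      also have "(of_real (cmod (1 - w)))\<^sup>2 = complex_of_real ((cmod (1 - w))\<^sup>2)" by simp
      finally have "Re ((1 + w) / (1 - w)) = Re ((1 + w) * cnj (1 - w)) / (cmod (1 - w))\<^sup>2"
        by (simp only: Re_divide_of_real)
      also have "Re ((1 + w) * cnj (1 - w)) = 1 - (cmod w)\<^sup>2"
        using cmod_power2[of w] by (simp add: power2_eq_square algebra_simps)
      finally have "Re ((1 + w) / (1 - w)) = poisson_kernel z \<zeta>"
        by (simp add: n nw poisson_kernel_def)
      moreover have "Re (u * of_real y) = Re u * y" for u y by simp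
      ultimately show "Re ((1 + z * cnj \<zeta>) / (1 - z * cnj \<zeta>) * of_real (h \<zeta>)) = poisson_kernel z \<zeta> *\<^sub>R h \<zeta>"
        by (simp only: w_def real_scaleR_def)
    qed
    finally show ?thesis .
  qed
  with hol show ?thesis using that by blast
qed

text \<open>
On \<open>{|\<phi>| = 1}\<close> the integrand takes the value \<open>\<infinity>\<close>, so this set is null, and elsewhere it is the
modulus of the logarithm.
\<close>

lemma log_integral_finiteD:
  assumes \<phi>[measurable]: "\<phi> \<in> borel_measurable circle_measure" and le1: "AE \<zeta> in circle_measure. cmod (\<phi> \<zeta>) \<le> 1"
    and fin: "log_integral_finite \<phi>"
  shows "AE \<zeta> in circle_measure. cmod (\<phi> \<zeta>) < 1" "integrable circle_measure (\<lambda>\<zeta>. ln (1 - cmod (\<phi> \<zeta>)))"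
proof -
  have m: "(\<lambda>\<zeta>. neg_log (1 - cmod (\<phi> \<zeta>))) \<in> borel_measurable circle_measure"
    unfolding neg_log_def by measurable
  have fin': "(\<integral>\<^sup>+ \<zeta>. neg_log (1 - cmod (\<phi> \<zeta>)) \<partial>circle_measure) < \<infinity>"
    using fin by (simp add: log_integral_finite_def)
  then have "AE \<zeta> in circle_measure. neg_log (1 - cmod (\<phi> \<zeta>)) \<noteq> \<infinity>"
    by (intro nn_integral_PInf_AE m) auto
  then show lt: "AE \<zeta> in circle_measure. cmod (\<phi> \<zeta>) < 1"
    by eventually_elim (auto simp: neg_log_def split: if_splits)
  have "(\<integral>\<^sup>+ \<zeta>. ennreal (norm (ln (1 - cmod (\<phi> \<zeta>)))) \<partial>circle_measure) = (\<integral>\<^sup>+ \<zeta>. neg_log (1 - cmod (\<phi> \<zeta>)) \<partial>circle_measure)"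
  proof (rule nn_integral_cong_AE)
    show "AE \<zeta> in circle_measure. ennreal (norm (ln (1 - cmod (\<phi> \<zeta>)))) = neg_log (1 - cmod (\<phi> \<zeta>))"
      using lt
    proof eventually_elim
      case (elim \<zeta>)
      then have "ln (1 - cmod (\<phi> \<zeta>)) \<le> 0" by simp
      then show ?case using elim by (simp add: neg_log_def)
    qed
  qed
  then show "integrable circle_measure (\<lambda>\<zeta>. ln (1 - cmod (\<phi> \<zeta>)))"
    using fin' by (intro integrableI_bounded) auto
qed

text \<open>
\<open>G\<close> is the outer function \<open>exp H\<close>, where \<open>H\<close> is the Herglotz transform of \<open>ln w\<close>. Its modulus is
\<open>exp (\<P>(ln w))\<close>, and Jensen's inequality for the probability measures given by the Poisson kernel
bounds this by \<open>\<P>(w)\<close>.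
\<close>

lemma outer_majorant:
  fixes w :: "complex \<Rightarrow> real"
  assumes w[measurable]: "w \<in> borel_measurable circle_measure"
    and w01: "AE \<zeta> in circle_measure. 0 < w \<zeta> \<and> w \<zeta> \<le> 1" and h: "integrable circle_measure (\<lambda>\<zeta>. ln (w \<zeta>))"
  obtains G where "G holomorphic_on ball 0 1" "\<And>z. cmod z < 1 \<Longrightarrow> G z \<noteq> 0"
    "\<And>z. cmod z < 1 \<Longrightarrow> cmod (G z) \<le> poisson w z"
proof -
  obtain H where H: "H holomorphic_on ball 0 1" "\<And>z. cmod z < 1 \<Longrightarrow> Re (H z) = poisson (\<lambda>\<zeta>. ln (w \<zeta>)) z"
    using herglotz_transform[OF h] by blast
  have iw: "integrable circle_measure w"
  proof (rule integrable_circle_bounded[OF w])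
    show "AE \<zeta> in circle_measure. norm (w \<zeta>) \<le> 1" using w01 by eventually_elim simp
  qed
  have "cmod (exp (H z)) \<le> poisson w z" if z: "cmod z < 1" for z
  proof -
    define c where "c = poisson (\<lambda>\<zeta>. ln (w \<zeta>)) z"
    (* the tangent to exp at c lies below exp; integrate this at ln (w \<zeta>) *)
    have "exp c = exp c * (1 - c) + exp c * c" by (simp add: algebra_simps)
    also have "\<dots> = poisson (\<lambda>\<zeta>. exp c * (1 - c) + exp c * ln (w \<zeta>)) z"
      using h z by (simp add: poisson_add poisson_const poisson_cmult c_def)
    also have "\<dots> \<le> poisson w z"
    proof (rule poisson_mono_AE)
      show "AE \<zeta> in circle_measure. exp c * (1 - c) + exp c * ln (w \<zeta>) \<le> w \<zeta>"
        using w01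
      proof eventually_elim
        case (elim \<zeta>)
        have "exp c * (1 + (ln (w \<zeta>) - c)) \<le> exp c * exp (ln (w \<zeta>) - c)"
          by (intro mult_left_mono exp_ge_add_one_self) simp
        also have "\<dots> = w \<zeta>" using elim by (simp flip: exp_add)
        finally show ?case by (simp add: algebra_simps)
      qed
    qed (use h iw z in auto)
    finally show ?thesis using H(2)[OF z] by (simp add: c_def)
  qed
  moreover have "(\<lambda>z. exp (H z)) holomorphic_on ball 0 1" using H(1) by (intro holomorphic_intros)
  ultimately show ?thesis using that[of "\<lambda>z. exp (H z)"] by simp
qed

text \<open>
Let \<open>F(z) = z G(z)\<close> with \<open>G\<close> the outer function for \<open>1 - |\<phi>|\<close>. From \<open>|F| \<le> \<P>(1 - |\<phi>|)\<close> in the disc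
and Fatou's theorem, the boundary function \<open>g\<close> of \<open>F\<close> satisfies \<open>|g| \<le> 1 - |\<phi>|\<close>. The sum and the
difference of \<open>B\<phi>\<close> and \<open>g\<close> have the analytic Poisson integrals \<open>B \<P>\<phi> + F\<close> and \<open>B \<P>\<phi> - F\<close>.
\<close>

lemma nonextreme_BMOA:
  assumes \<phi>: "\<phi> \<in> Hinf" "Linf_norm \<phi> = 1" "log_integral_finite \<phi>" and B: "blaschke_product B"
  shows "nonextreme_point_of_ball BMOA (coset (bd_times B \<phi>))"
proof -
  have Li: "\<phi> \<in> Linf" and an: "poisson \<phi> analytic_on ball 0 1" using \<phi>(1) by (auto simp: Hinf_def)
  note m\<phi>[measurable] = Linf_norm_eq_1D(1)[OF Li \<phi>(2)]
  note le1 = Linf_norm_eq_1D(2)[OF Li \<phi>(2)]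
  note mf[measurable] = bd_times_blaschke(1)[OF B m\<phi>] and abs_f = bd_times_blaschke(2)[OF B m\<phi>]
  note lt1 = log_integral_finiteD(1)[OF m\<phi> le1 \<phi>(3)]
  have f_le1: "AE \<zeta> in circle_measure. cmod (bd_times B \<phi> \<zeta>) \<le> 1" using abs_f le1 by eventually_elim simp
  have hol\<phi>: "poisson \<phi> holomorphic_on ball 0 1" using an by (rule analytic_imp_holomorphic)
  have poisson_f: "poisson (bd_times B \<phi>) z = B z * poisson \<phi> z" if "cmod z < 1" for z
  proof (rule poisson_of_radial_limit[OF _ _ mf _ that])
    show "(\<lambda>z. B z * poisson \<phi> z) holomorphic_on ball 0 1"
      using blaschke_productD(1)[OF B] hol\<phi> by (intro holomorphic_intros)
    show "cmod (B z * poisson \<phi> z) \<le> 1" if "cmod z < 1" for z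
      using mult_mono[OF blaschke_productD(2)[OF B that] poisson_norm_bound[OF m\<phi> le1 that]] by (simp add: norm_mult)
    show "AE \<zeta> in circle_measure. ((\<lambda>r. B (of_real r * \<zeta>) * poisson \<phi> (of_real r * \<zeta>)) \<longlongrightarrow> bd_times B \<phi> \<zeta>) (at_left 1)"
      using blaschke_productD(5)[OF B] poisson_radial_limit[OF m\<phi> le1]
      by eventually_elim (auto simp: bd_times_def intro: tendsto_mult)
  qed
  define w where "w = (\<lambda>\<zeta>. 1 - cmod (\<phi> \<zeta>))"
  have mw[measurable]: "w \<in> borel_measurable circle_measure" unfolding w_def by measurable
  have w01: "AE \<zeta> in circle_measure. 0 < w \<zeta> \<and> w \<zeta> \<le> 1" using lt1 by eventually_elim (simp add: w_def)
  have "integrable circle_measure (\<lambda>\<zeta>. ln (w \<zeta>))"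
    unfolding w_def by (rule log_integral_finiteD(2)[OF m\<phi> le1 \<phi>(3)])
  then obtain G where G: "G holomorphic_on ball 0 1" "\<And>z. cmod z < 1 \<Longrightarrow> G z \<noteq> 0"
    "\<And>z. cmod z < 1 \<Longrightarrow> cmod (G z) \<le> poisson w z"
    using outer_majorant[OF mw w01] by blast
  have w_AE: "AE \<zeta> in circle_measure. \<bar>w \<zeta>\<bar> \<le> 1" using w01 by eventually_elim simp
  (* G itself may be constant; z * G z is not, as it vanishes only at 0 *)
  define F where "F = (\<lambda>z. z * G z)"
  have holF: "F holomorphic_on ball 0 1" unfolding F_def using G(1) by (intro holomorphic_intros)
  have F_w: "cmod (F z) \<le> poisson w z" if "cmod z < 1" for z
  proof -
    have "cmod (F z) \<le> 1 * cmod (G z)" unfolding F_def norm_mult using that by (intro mult_right_mono) auto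
    then show ?thesis using G(3)[OF that] by simp
  qed
  have F1: "cmod (F z) \<le> 1" if "cmod z < 1" for z
    using F_w[OF that] poisson_norm_bound[of w 1 z] w_AE that by simp
  define g where "g = boundary_value F"
  have mg[measurable]: "g \<in> borel_measurable circle_measure"
    and lim_g: "AE \<zeta> in circle_measure. ((\<lambda>r. F (of_real r * \<zeta>)) \<longlongrightarrow> g \<zeta>) (at_left 1)"
    and g1: "AE \<zeta> in circle_measure. cmod (g \<zeta>) \<le> 1"
    and poisson_g: "\<And>z. cmod z < 1 \<Longrightarrow> poisson g z = F z"
    unfolding g_def by (rule bounded_holomorphic_boundary[OF holF F1]; assumption)+
  have g_le: "AE \<zeta> in circle_measure. cmod (g \<zeta>) \<le> w \<zeta>"
    using lim_g poisson_radial_limit_real[OF mw w_AE] AE_circle_norm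
  proof eventually_elim
    case (elim \<zeta>)
    show ?case
    proof (rule tendsto_le[OF _ elim(2) tendsto_norm[OF elim(1)]])
      show "\<forall>\<^sub>F r in at_left 1. cmod (F (of_real r * \<zeta>)) \<le> poisson w (of_real r * \<zeta>)"
        by (rule eventually_at_leftI[of 0]) (use elim(3) in \<open>auto intro!: F_w simp: norm_mult\<close>)
    qed simp
  qed
  have bd: "AE \<zeta> in circle_measure. cmod (bd_times B \<phi> \<zeta>) + cmod (g \<zeta>) \<le> 1"
    using g_le abs_f by eventually_elim (simp add: w_def)
  have if_g: "integrable circle_measure (bd_times B \<phi>)" "integrable circle_measure g"
    by (rule integrable_circle_bounded[OF mf f_le1], rule integrable_circle_bounded[OF mg g1])
  have BMOA_I: "u \<in> BMOA" if "u \<in> borel_measurable circle_measure" "AE \<zeta> in circle_measure. cmod (u \<zeta>) \<le> 1"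
      "U holomorphic_on ball 0 1" "\<And>z. cmod z < 1 \<Longrightarrow> poisson u z = U z" for u U
  proof -
    have "poisson u holomorphic_on ball 0 1"
      by (rule holomorphic_transform[OF that(3)]) (simp add: that(4))
    then have "poisson u analytic_on ball 0 1" by (simp add: analytic_on_open)
    then show ?thesis
      using bounded_by_1_in_BMO_ball[OF that(1,2)] by (simp add: BMOA_def H2_def)
  qed
  have holBP: "(\<lambda>z. B z * poisson \<phi> z) holomorphic_on ball 0 1"
    using blaschke_productD(1)[OF B] hol\<phi> by (intro holomorphic_intros)
  show ?thesis
  proof (rule nonextreme_pointI[OF mf mg _ _ _ bd])
    show "bd_times B \<phi> \<in> BMOA" by (rule BMOA_I[OF mf f_le1 holBP poisson_f])
    show "(\<lambda>\<zeta>. bd_times B \<phi> \<zeta> + g \<zeta>) \<in> BMOA"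
    proof (rule BMOA_I)
      show "AE \<zeta> in circle_measure. cmod (bd_times B \<phi> \<zeta> + g \<zeta>) \<le> 1"
        using bd by eventually_elim (rule order_trans[OF norm_triangle_ineq])
      show "(\<lambda>z. B z * poisson \<phi> z + F z) holomorphic_on ball 0 1" by (intro holomorphic_intros holBP holF)
      show "poisson (\<lambda>\<zeta>. bd_times B \<phi> \<zeta> + g \<zeta>) z = B z * poisson \<phi> z + F z" if "cmod z < 1" for z
        using that by (simp add: poisson_add if_g poisson_f poisson_g)
    qed measurable
    show "(\<lambda>\<zeta>. bd_times B \<phi> \<zeta> - g \<zeta>) \<in> BMOA"
    proof (rule BMOA_I)
      show "AE \<zeta> in circle_measure. cmod (bd_times B \<phi> \<zeta> - g \<zeta>) \<le> 1"
        using bd by eventually_elim (rule order_trans[OF norm_triangle_ineq4])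
      show "(\<lambda>z. B z * poisson \<phi> z - F z) holomorphic_on ball 0 1" by (intro holomorphic_intros holBP holF)
      show "poisson (\<lambda>\<zeta>. bd_times B \<phi> \<zeta> - g \<zeta>) z = B z * poisson \<phi> z - F z" if "cmod z < 1" for z
        using that by (simp add: poisson_diff if_g poisson_f poisson_g)
    qed measurable
    show "\<not> (AE \<zeta> in circle_measure. g \<zeta> = c)" for c
    proof
      assume "AE \<zeta> in circle_measure. g \<zeta> = c"
      then have "F z = c" if "cmod z < 1" for z
        using poisson_cong_AE[OF mg, of "\<lambda>_. c" z] poisson_g[OF that] that by (simp add: poisson_const)
      then have "F 0 = F (1/2)" by (simp add: norm_divide)
      then show False using G(2)[of "1/2"] by (simp add: F_def norm_divide)
    qed
  qed
qed

section \<open>Blaschke products giving Garsia norm one\<close>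

text \<open>
If all discs of radius \<open>\<epsilon>\<close> with centres of modulus above \<open>1 - \<epsilon>\<close> were avoided by \<open>\<phi>\<close> almost
everywhere, then countably many of them would confine \<open>\<phi>\<close> to \<open>|\<phi>| \<le> 1 - \<epsilon>\<close>.
\<close>

lemma near_full_modulus:
  assumes \<phi>[measurable]: "\<phi> \<in> borel_measurable circle_measure" and norm: "Linf_norm \<phi> = 1" and "\<epsilon> > 0"
  obtains c where "1 - \<epsilon> < cmod c" "\<not> (AE \<zeta> in circle_measure. \<not> cmod (\<phi> \<zeta> - c) < \<epsilon>)"
proof -
  obtain D :: "complex set" where D: "countable D" "\<And>X. open X \<Longrightarrow> X \<noteq> {} \<Longrightarrow> \<exists>d\<in>D. d \<in> X"
    using countable_dense_setE by blast
  have "\<exists>c. 1 - \<epsilon> < cmod c \<and> \<not> (AE \<zeta> in circle_measure. \<not> cmod (\<phi> \<zeta> - c) < \<epsilon>)"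
  proof (rule ccontr)
    assume "\<not> ?thesis"
    then have "AE \<zeta> in circle_measure. \<forall>c\<in>D \<inter> {c. 1 - \<epsilon> < cmod c}. \<not> cmod (\<phi> \<zeta> - c) < \<epsilon>"
      using D(1) by (subst AE_ball_countable) auto
    then have "AE \<zeta> in circle_measure. ereal (cmod (\<phi> \<zeta>)) \<le> ereal (1 - \<epsilon>)"
    proof eventually_elim
      case (elim \<zeta>)
      show ?case
      proof (rule ccontr)
        assume "\<not> ?thesis"
        then have gt: "1 - \<epsilon> < cmod (\<phi> \<zeta>)" by simp
        have op: "open ({c. 1 - \<epsilon> < cmod c} \<inter> ball (\<phi> \<zeta>) \<epsilon>)"
          by (intro open_Int open_Collect_less continuous_intros open_ball)
        have "\<phi> \<zeta> \<in> {c. 1 - \<epsilon> < cmod c} \<inter> ball (\<phi> \<zeta>) \<epsilon>" using gt \<open>\<epsilon> > 0\<close> by simp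
        then have "{c. 1 - \<epsilon> < cmod c} \<inter> ball (\<phi> \<zeta>) \<epsilon> \<noteq> {}" by (metis empty_iff)
        from D(2)[OF op this] obtain c where "c \<in> D" "1 - \<epsilon> < cmod c" "dist (\<phi> \<zeta>) c < \<epsilon>" by auto
        then show False using elim by (auto simp: dist_norm)
      qed
    qed
    then have "Linf_norm \<phi> \<le> ereal (1 - \<epsilon>)"
      unfolding Linf_norm_def by (intro esssup_I) measurable
    then show False using norm \<open>\<epsilon> > 0\<close> by (simp add: one_ereal_def)
  qed
  then show ?thesis using that by blast
qed

text \<open>
Approach a point of \<open>E = {|\<phi> - c| < \<epsilon>}\<close> at which the Poisson integral of the complement of \<open>E\<close> tends
to \<open>0\<close> radially; almost every point of \<open>E\<close> has this property, and \<open>E\<close> is not null.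
\<close>

lemma near_constant_point:
  assumes \<phi>[measurable]: "\<phi> \<in> borel_measurable circle_measure" and le1: "AE \<zeta> in circle_measure. cmod (\<phi> \<zeta>) \<le> 1"
    and norm: "Linf_norm \<phi> = 1" and \<epsilon>: "0 < \<epsilon>" "\<epsilon> \<le> 1"
  obtains z c where "cmod z < 1" "1 - cmod z < \<epsilon>" "1 - \<epsilon> < cmod c"
    "poisson (\<lambda>\<zeta>. cmod (\<phi> \<zeta> - c)) z \<le> 4 * \<epsilon>"
proof -
  obtain c where c: "1 - \<epsilon> < cmod c" "\<not> (AE \<zeta> in circle_measure. \<not> cmod (\<phi> \<zeta> - c) < \<epsilon>)"
    using near_full_modulus[OF \<phi> norm \<epsilon>(1)] by blast
  define E where "E = {\<zeta> \<in> space circle_measure. cmod (\<phi> \<zeta> - c) < \<epsilon>}"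
  have E[measurable]: "E \<in> sets circle_measure" unfolding E_def by measurable
  have "\<not> (AE \<zeta> in circle_measure. \<zeta> \<notin> E)"
  proof
    assume "AE \<zeta> in circle_measure. \<zeta> \<notin> E"
    then have "AE \<zeta> in circle_measure. \<not> cmod (\<phi> \<zeta> - c) < \<epsilon>"
      using AE_space by eventually_elim (simp add: E_def)
    then show False using c(2) by blast
  qed
  moreover have "AE \<zeta> in circle_measure. \<zeta> \<notin> E"
    if none: "\<not> (\<exists>\<zeta>\<in>E. cmod \<zeta> = 1 \<and> cmod (\<phi> \<zeta>) \<le> 1 \<and>
      ((\<lambda>r. poisson (indicat_real (sphere 0 1 - E)) (of_real r * \<zeta>)) \<longlongrightarrow> 0) (at_left 1))"
    using poisson_indicator_compl_tendsto[OF E] le1 AE_circle_norm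
    by eventually_elim (use none in blast)
  ultimately obtain \<zeta> where \<zeta>: "\<zeta> \<in> E" "cmod \<zeta> = 1" "cmod (\<phi> \<zeta>) \<le> 1"
    "((\<lambda>r. poisson (indicat_real (sphere 0 1 - E)) (of_real r * \<zeta>)) \<longlongrightarrow> 0) (at_left 1)" by blast
  have "cmod c \<le> cmod (\<phi> \<zeta>) + cmod (\<phi> \<zeta> - c)" using norm_triangle_sub[of c "\<phi> \<zeta>"] by (simp add: norm_minus_commute)
  then have c2: "cmod c \<le> 2" using \<zeta> \<epsilon> by (simp add: E_def)
  have "\<forall>\<^sub>F r in at_left 1. poisson (indicat_real (sphere 0 1 - E)) (of_real r * \<zeta>) < \<epsilon>"
    using order_tendstoD(2)[OF \<zeta>(4) \<epsilon>(1)] .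
  moreover have "\<forall>\<^sub>F r::real in at_left 1. r \<in> {1 - \<epsilon><..<1}"
    by (rule eventually_at_leftI[of "1 - \<epsilon>"]) (use \<epsilon> in auto)
  ultimately have "\<forall>\<^sub>F r in at_left 1. poisson (indicat_real (sphere 0 1 - E)) (of_real r * \<zeta>) < \<epsilon> \<and> r \<in> {1 - \<epsilon><..<1}"
    by eventually_elim auto
  then obtain r where r: "poisson (indicat_real (sphere 0 1 - E)) (of_real r * \<zeta>) < \<epsilon>" "1 - \<epsilon> < r" "r < 1"
    using eventually_happens'[OF trivial_limit_at_left_real] by (metis (no_types, lifting) greaterThanLessThan_iff)
  define z where "z = of_real r * \<zeta>"
  have z: "cmod z < 1" "1 - cmod z < \<epsilon>" using r \<epsilon> \<zeta>(2) by (auto simp: z_def norm_mult)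
  have S: "sphere 0 1 - E \<in> sets circle_measure" using sets.compl_sets[OF E] by simp
  have i: "integrable circle_measure (indicat_real (sphere 0 1 - E))"
    using S by (intro integrable_circle_bounded[of _ 1]) (auto split: split_indicator)
  (* |\<phi>| \<le> 1 and |c| \<le> 2; so |\<phi> - c| is at most \<epsilon> on E and 3 off E *)
  have diff3: "AE \<zeta> in circle_measure. cmod (\<phi> \<zeta> - c) \<le> 3"
    using le1
  proof eventually_elim
    case (elim \<zeta>)
    then show ?case using norm_triangle_ineq4[of "\<phi> \<zeta>" c] c2 by simp
  qed
  have "poisson (\<lambda>\<zeta>. cmod (\<phi> \<zeta> - c)) z \<le> poisson (\<lambda>\<zeta>. \<epsilon> + 3 * indicat_real (sphere 0 1 - E) \<zeta>) z"
  proof (rule poisson_mono_AE)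
    show "integrable circle_measure (\<lambda>\<zeta>. cmod (\<phi> \<zeta> - c))"
      using diff3 by (intro integrable_circle_bounded[of _ 3]) auto
    show "AE \<zeta> in circle_measure. cmod (\<phi> \<zeta> - c) \<le> \<epsilon> + 3 * indicat_real (sphere 0 1 - E) \<zeta>"
      using diff3 AE_space
    proof eventually_elim
      case (elim \<zeta>)
      then show ?case using \<epsilon> by (cases "\<zeta> \<in> E") (auto simp: E_def indicator_def)
    qed
  qed (use i z in auto)
  also have "\<dots> = \<epsilon> + 3 * poisson (indicat_real (sphere 0 1 - E)) z"
    using i z by (simp add: poisson_add poisson_const poisson_cmult)
  also have "\<dots> \<le> 4 * \<epsilon>" using r(1) by (simp add: z_def)
  finally show ?thesis using that z c(1) by blast
qed

text \<open>
\<open>B\<close> has its zeros at points \<open>a n\<close> where \<open>\<phi>\<close> is nearly a constant \<open>c n\<close> of modulus nearly \<open>1\<close>, in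
the Poisson mean. Then \<open>\<P>(|B\<phi>|\<^sup>2)(a n)\<close> is near \<open>1\<close>, and \<open>\<P>(B\<phi>)(a n)\<close> is near \<open>c n * B (a n) = 0\<close>.
\<close>

lemma exists_blaschke_norm_1:
  assumes \<phi>: "\<phi> \<in> Linf" "Linf_norm \<phi> = 1"
  shows "\<exists>B. blaschke_product B \<and> garsia_norm (bd_times B \<phi>) = 1"
proof -
  note m\<phi>[measurable] = Linf_norm_eq_1D(1)[OF \<phi>] and le1 = Linf_norm_eq_1D(2)[OF \<phi>]
  have "\<forall>n. \<exists>z c. cmod z < 1 \<and> 1 - cmod z < (1/2)^n \<and> 1 - (1/2)^n < cmod c \<and>
     poisson (\<lambda>\<zeta>. cmod (\<phi> \<zeta> - c)) z \<le> 4 * (1/2)^n"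
  proof
    fix n :: nat
    have "0 < (1/2::real)^n" "(1/2::real)^n \<le> 1" by (auto simp: power_le_one)
    then obtain z c where "cmod z < 1" "1 - cmod z < (1/2)^n" "1 - (1/2)^n < cmod c"
      "poisson (\<lambda>\<zeta>. cmod (\<phi> \<zeta> - c)) z \<le> 4 * (1/2)^n"
      by (rule near_constant_point[OF m\<phi> le1 \<phi>(2)])
    then show "\<exists>z c. cmod z < 1 \<and> 1 - cmod z < (1/2)^n \<and> 1 - (1/2)^n < cmod c \<and>
     poisson (\<lambda>\<zeta>. cmod (\<phi> \<zeta> - c)) z \<le> 4 * (1/2)^n" by blast
  qed
  then obtain a c where ac: "\<And>n. cmod (a n) < 1" "\<And>n. 1 - cmod (a n) < (1/2)^n" "\<And>n. 1 - (1/2)^n < cmod (c n)"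
    "\<And>n. poisson (\<lambda>\<zeta>. cmod (\<phi> \<zeta> - c n)) (a n) \<le> 4 * (1/2)^n" by metis
  have seq: "blaschke_sequence \<infinity> a"
  proof -
    have "summable (\<lambda>j. 1 - cmod (a j))"
    proof (rule summable_comparison_test'[where N=0])
      show "summable (\<lambda>n. (1/2::real)^n)" by (intro summable_geometric) simp
      show "norm (1 - cmod (a n)) \<le> (1/2)^n" for n using ac(1,2)[of n] by simp
    qed
    then show ?thesis using ac(1) by (simp add: blaschke_sequence_def)
  qed
  define B where "B = (\<lambda>z. \<Prod>j. if enat j < \<infinity> then blaschke_factor (a j) z else 1)"
  have B: "blaschke_product B"
    unfolding blaschke_product_def
    by (intro exI[of _ \<infinity>] exI[of _ a] conjI seq ballI) (simp only: B_def)
  have zero: "B (a n) = 0" for n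
    by (rule blaschke_product_zero[OF seq, of B n]) (auto simp: B_def)
  define f where "f = bd_times B \<phi>"
  note mf[measurable] = bd_times_blaschke(1)[OF B m\<phi>, folded f_def]
  note abs_f = bd_times_blaschke(2)[OF B m\<phi>, folded f_def]
  note mB[measurable] = blaschke_productD(4)[OF B]
  note B1 = blaschke_productD(3)[OF B]
  have f1: "AE \<zeta> in circle_measure. cmod (f \<zeta>) \<le> 1" using abs_f le1 by eventually_elim simp
  have i\<phi>: "integrable circle_measure \<phi>" using m\<phi> le1 by (rule integrable_circle_bounded)
  have id: "integrable circle_measure (\<lambda>\<zeta>. cmod (\<phi> \<zeta> - c n))" for n using i\<phi> by (intro integrable_norm) simp
  (* In units of (1/2)^n, 26 = 10 + 16: the mean of |f|^2 loses 2 for c n and 2 * 4 for the deviation of \<phi> from c n,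
     and the squared modulus of the mean of f is at most 4^2 *)
  have Phi: "garsia_Phi f (a n) \<ge> 1 - 26 * (1/2)^n" for n
  proof -
    let ?e = "(1/2::real)^n"
    let ?d = "poisson (\<lambda>\<zeta>. cmod (\<phi> \<zeta> - c n)) (a n)"
    have e: "0 \<le> ?e" "?e \<le> 1" by (auto simp: power_le_one)
    have "1 - 2 * ?e - 2 * ?d = poisson (\<lambda>\<zeta>. (1 - 2 * ?e) - 2 * cmod (\<phi> \<zeta> - c n)) (a n)"
      using id[of n] ac(1)[of n] by (simp add: poisson_diff poisson_const poisson_cmult)
    also have "\<dots> \<le> poisson (\<lambda>\<zeta>. (cmod (f \<zeta>))\<^sup>2) (a n)"
    proof (rule poisson_mono_AE)
      show "integrable circle_measure (\<lambda>\<zeta>. (cmod (f \<zeta>))\<^sup>2)"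
        using bounded_by_1_in_BMO_ball(1)[OF mf f1] by (simp add: L2_def)
      show "AE \<zeta> in circle_measure. (1 - 2 * ?e) - 2 * cmod (\<phi> \<zeta> - c n) \<le> (cmod (f \<zeta>))\<^sup>2"
        using abs_f
      proof eventually_elim
        case (elim \<zeta>)
        have "0 \<le> (cmod (\<phi> \<zeta>) - 1)\<^sup>2" by simp
        then have "2 * cmod (\<phi> \<zeta>) - 1 \<le> (cmod (\<phi> \<zeta>))\<^sup>2" by (simp add: power2_eq_square algebra_simps)
        moreover have "cmod (c n) \<le> cmod (\<phi> \<zeta>) + cmod (\<phi> \<zeta> - c n)"
          using norm_triangle_sub[of "c n" "\<phi> \<zeta>"] by (simp add: norm_minus_commute)
        ultimately show ?case unfolding elim using ac(3)[of n] by linarith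
      qed
    qed (use id ac(1) in auto)
    finally have low: "1 - 10 * ?e \<le> poisson (\<lambda>\<zeta>. (cmod (f \<zeta>))\<^sup>2) (a n)" using ac(4)[of n] by linarith
    have iB: "integrable circle_measure (\<lambda>\<zeta>. c n * boundary_value B \<zeta>)"
      using B1 by (intro integrable_mult_right integrable_circle_bounded[of _ 1] mB) (auto elim: eventually_mono)
    have mp: "(\<lambda>\<zeta>. boundary_value B \<zeta> * (\<phi> \<zeta> - c n)) \<in> borel_measurable circle_measure" by measurable
    have eqn: "AE \<zeta> in circle_measure. cmod (boundary_value B \<zeta> * (\<phi> \<zeta> - c n)) = cmod (\<phi> \<zeta> - c n)"
      using B1 by eventually_elim (simp add: norm_mult)
    have ip: "integrable circle_measure (\<lambda>\<zeta>. boundary_value B \<zeta> * (\<phi> \<zeta> - c n))"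
      by (rule Bochner_Integration.integrable_bound[OF id[of n] mp]) (use eqn in \<open>eventually_elim, simp\<close>)
    have "poisson f (a n) = poisson (\<lambda>\<zeta>. boundary_value B \<zeta> * (\<phi> \<zeta> - c n) + c n * boundary_value B \<zeta>) (a n)"
      by (simp add: f_def bd_times_def[abs_def] algebra_simps)
    also have "\<dots> = poisson (\<lambda>\<zeta>. boundary_value B \<zeta> * (\<phi> \<zeta> - c n)) (a n) + c n * B (a n)"
      using ac(1)[of n] by (simp add: poisson_add[OF ip iB] poisson_cmult blaschke_productD(6)[OF B])
    finally have "cmod (poisson f (a n)) \<le> poisson (\<lambda>\<zeta>. cmod (boundary_value B \<zeta> * (\<phi> \<zeta> - c n))) (a n)"
      using norm_poisson_le[OF ac(1)[of n]] zero[of n] by simp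
    also have "\<dots> = ?d" using eqn by (intro poisson_cong_AE) measurable
    also have "\<dots> \<le> 4 * ?e" by (rule ac(4))
    finally have "(cmod (poisson f (a n)))\<^sup>2 \<le> (4 * ?e)\<^sup>2" by (intro power_mono) auto
    also have "\<dots> = 16 * (?e * ?e)" by (simp add: power2_eq_square)
    also have "\<dots> \<le> 16 * ?e" using e by (intro mult_left_mono mult_left_le) auto
    finally show ?thesis using low unfolding garsia_Phi_def by linarith
  qed
  have "1 \<le> garsia_norm f"
  proof (rule LIMSEQ_le_const2)
    have "(\<lambda>n. sqrt (1 - 26 * (1/2)^n)) \<longlonglongrightarrow> sqrt (1 - 26 * 0)"
      by (intro tendsto_intros LIMSEQ_power_zero) simp
    then show "(\<lambda>n. ereal (sqrt (1 - 26 * (1/2)^n))) \<longlonglongrightarrow> 1"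
      by (simp add: one_ereal_def)
    have "ereal (sqrt (1 - 26 * (1/2)^n)) \<le> garsia_norm f" for n
    proof -
      have "ereal (sqrt (1 - 26 * (1/2)^n)) \<le> ereal (sqrt (garsia_Phi f (a n)))" using Phi[of n] by simp
      also have "\<dots> \<le> garsia_norm f" unfolding garsia_norm_def using ac(1)[of n] by (intro SUP_upper) simp
      finally show ?thesis .
    qed
    then show "\<exists>N. \<forall>n\<ge>N. ereal (sqrt (1 - 26 * (1/2)^n)) \<le> garsia_norm f" by blast
  qed
  moreover have "garsia_norm f \<le> 1" by (rule bounded_by_1_in_BMO_ball(2)[OF mf f1])
  ultimately show ?thesis using B by (auto simp: f_def intro: antisym)
qed

theorem theorem2p11:
  shows
    "(\<forall>\<phi>. \<phi> \<in> Linf \<and> \<not> unimodular \<phi> \<and> Linf_norm \<phi> = 1 \<longrightarrow>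
        (\<exists>B. blaschke_product B \<and> garsia_norm (bd_times B \<phi>) = 1 \<and>
             nonextreme_point_of_ball BMO (coset (bd_times B \<phi>)))) \<and>
     (\<forall>\<phi>. \<phi> \<in> Hinf \<and> Linf_norm \<phi> = 1 \<and> log_integral_finite \<phi> \<longrightarrow>
        (\<exists>B. blaschke_product B \<and> garsia_norm (bd_times B \<phi>) = 1 \<and>
             nonextreme_point_of_ball BMOA (coset (bd_times B \<phi>)))) \<and>
     (\<forall>\<phi> B. \<phi> \<in> Linf \<and> \<not> unimodular \<phi> \<and> Linf_norm \<phi> = 1 \<and> blaschke_product B \<longrightarrow>
        nonextreme_point_of_ball BMO (coset (bd_times B \<phi>))) \<and>
     (\<forall>\<phi> B. \<phi> \<in> Hinf \<and> Linf_norm \<phi> = 1 \<and> log_integral_finite \<phi> \<and> blaschke_product B \<longrightarrow>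
        nonextreme_point_of_ball BMOA (coset (bd_times B \<phi>)))"
proof -
  have "\<phi> \<in> Linf" if "\<phi> \<in> Hinf" for \<phi> using that by (simp add: Hinf_def)
  then show ?thesis
    using exists_blaschke_norm_1 nonextreme_BMO nonextreme_BMOA by blast
qed

end
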